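(* Let $L$ be the minimal operator in $H=L^2((a,b),\mathbb{R}^n)$ of a Sturm–Liouville expression $l=-\frac{d}{dt}\big(P\frac{d}{dt}+Q\big)+Q^{T}\frac{d}{dt}+R$ on $(a,b)$ with regular endpoint $b$, and assume that $L$ is a closed, densely defined, symmetric Fredholm operator. Let $Y=\{y_1,\dots,y_k\}$ be a basis of $\ker L^*$. Then $n\le k\le 2n$. Moreover, there exists a $2k$-dimensional subspace $W$ such that $$D(L^* )=D(L)\oplus W,$$ where - if $k\ne n$, $W=\mathrm{span}(\overline Y)\oplus Z$ for some subset $\overline Y\subset Y$ with $\#\overline Y=\dim\mathrm{span}(\overline Y)=2k-2n$; - if $k=n$, $W=Z$.
   Context: $a<b$ in $[-\infty,\infty]$; $P(t)$ invertible with $P^{-1}\in C^1((a,b),\mathrm{Sym}_n(\mathbb{R}))$, $Q\in C^1((a,b),\mathrm{Mat}_n(\mathbb{R}))$, $R\in C^0((a,b),\mathrm{Sym}_n(\mathbb{R}))$. Regular endpoint $b$: $b$ finite and $P$ (as a path of invertible matrices), $Q$, $R$ continuous up to $b$. $L$ is the closure of $l$ on $C_0^\infty((a,b),\mathbb{R}^n)$, $L^*$ its adjoint, $D(\cdot)$ domains. $Z=\mathrm{span}\{z_1,\dots,z_{2n}\}$ where $z_i\in D(L^* )$ are smooth functions vanishing near $a$ such that $\{(z_i^{[1]}(b),z_i(b))\}_{i=1}^{2n}$ is a basis of $\mathbb{R}^{2n}$, with $z^{[1]}=Pz'+Qz$. *)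

theory Defs
  imports "HOL-Analysis.Analysis"
begin

section \<open>The real inner product space of square integrable functions\<close>

definition square_integrable :: "(real \<Rightarrow> 'a::euclidean_space) \<Rightarrow> bool" where
  "square_integrable f \<longleftrightarrow>
     f \<in> borel_measurable lborel \<and> integrable lborel (\<lambda>t. (norm (f t))\<^sup>2)"

definition l2_rel :: "(real \<Rightarrow> 'a::euclidean_space) \<Rightarrow> (real \<Rightarrow> 'a) \<Rightarrow> bool" where
  "l2_rel f g \<longleftrightarrow>
     square_integrable f \<and> square_integrable g \<and> (AE t in lborel. f t = g t)"

lemma square_integrable_zero: "square_integrable (\<lambda>t. 0)"
  by (simp add: square_integrable_def)

lemma square_integrable_inner:
  assumes "square_integrable f" "square_integrable g"
  shows "integrable lborel (\<lambda>t. f t \<bullet> g t)"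
proof (rule Bochner_Integration.integrable_bound)
  show "integrable lborel (\<lambda>t. (norm (f t))\<^sup>2 + (norm (g t))\<^sup>2)"
    using assms by (auto simp: square_integrable_def)
  show "(\<lambda>t. f t \<bullet> g t) \<in> borel_measurable lborel"
    using assms by (auto simp: square_integrable_def)
  have "\<bar>f t \<bullet> g t\<bar> \<le> (norm (f t))\<^sup>2 + (norm (g t))\<^sup>2" for t
  proof -
    have "\<bar>f t \<bullet> g t\<bar> \<le> norm (f t) * norm (g t)"
      by (rule Cauchy_Schwarz_ineq2)
    moreover have "2 * (norm (f t) * norm (g t)) \<le> (norm (f t))\<^sup>2 + (norm (g t))\<^sup>2"
      using sum_squares_bound[of "norm (f t)" "norm (g t)"] by (simp add: mult.assoc)
    moreover have "0 \<le> norm (f t) * norm (g t)"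
      by simp
    ultimately show ?thesis
      by linarith
  qed
  then show "AE t in lborel. norm (f t \<bullet> g t) \<le> norm ((norm (f t))\<^sup>2 + (norm (g t))\<^sup>2)"
    by simp
qed

lemma square_integrable_add:
  assumes "square_integrable f" "square_integrable g"
  shows "square_integrable (\<lambda>t. f t + g t)"
proof -
  have "integrable lborel (\<lambda>t. (norm (f t))\<^sup>2 + (norm (g t))\<^sup>2 + 2 * (f t \<bullet> g t))"
    using assms square_integrable_inner[OF assms] by (auto simp: square_integrable_def)
  moreover have "(norm (f t))\<^sup>2 + (norm (g t))\<^sup>2 + 2 * (f t \<bullet> g t) = (norm (f t + g t))\<^sup>2" for t
    by (simp add: power2_norm_eq_inner inner_add_left inner_add_right inner_commute)
  ultimately show ?thesis
    using assms by (auto simp: square_integrable_def)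
qed

lemma square_integrable_scaleR:
  assumes "square_integrable f"
  shows "square_integrable (\<lambda>t. c *\<^sub>R f t)"
  using assms by (auto simp: square_integrable_def power_mult_distrib)

quotient_type (overloaded) 'a l2 = "real \<Rightarrow> 'a::euclidean_space" / partial: "l2_rel"
proof (rule part_equivpI)
  show "\<exists>f::real \<Rightarrow> 'a. l2_rel f f"
    using square_integrable_zero by (auto simp: l2_rel_def)
  show "symp (l2_rel :: (real \<Rightarrow> 'a) \<Rightarrow> _)"
    by (rule sympI) (auto simp: l2_rel_def)
  show "transp (l2_rel :: (real \<Rightarrow> 'a) \<Rightarrow> _)"
  proof (rule transpI)
    fix f g h :: "real \<Rightarrow> 'a"
    assume *: "l2_rel f g" "l2_rel g h"
    then have "AE t in lborel. f t = h t"
      by (auto simp: l2_rel_def elim: AE_mp)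
    with * show "l2_rel f h"
      by (auto simp: l2_rel_def)
  qed
qed

instantiation l2 :: (euclidean_space) real_inner
begin

lift_definition zero_l2 :: "'a l2" is "\<lambda>t. 0"
  by (auto simp: l2_rel_def square_integrable_zero)

lift_definition plus_l2 :: "'a l2 \<Rightarrow> 'a l2 \<Rightarrow> 'a l2" is "\<lambda>f g t. f t + g t"
  by (auto simp: l2_rel_def square_integrable_add)

lift_definition scaleR_l2 :: "real \<Rightarrow> 'a l2 \<Rightarrow> 'a l2" is "\<lambda>c f t. c *\<^sub>R f t"
  by (auto simp: l2_rel_def square_integrable_scaleR)

lift_definition uminus_l2 :: "'a l2 \<Rightarrow> 'a l2" is "\<lambda>f t. - f t"
  by (auto simp: l2_rel_def square_integrable_def)

definition minus_l2 :: "'a l2 \<Rightarrow> 'a l2 \<Rightarrow> 'a l2" where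
  "minus_l2 x y = x + - y"

lift_definition inner_l2 :: "'a l2 \<Rightarrow> 'a l2 \<Rightarrow> real" is
  "\<lambda>f g. integral\<^sup>L lborel (\<lambda>t. f t \<bullet> g t)"
proof -
  fix f f' g g' :: "real \<Rightarrow> 'a"
  assume *: "l2_rel f f'" "l2_rel g g'"
  then have "AE t in lborel. f t \<bullet> g t = f' t \<bullet> g' t"
    by (auto simp: l2_rel_def)
  then show "integral\<^sup>L lborel (\<lambda>t. f t \<bullet> g t) = integral\<^sup>L lborel (\<lambda>t. f' t \<bullet> g' t)"
    using * by (intro integral_cong_AE) (auto simp: l2_rel_def square_integrable_def)
qed

definition norm_l2 :: "'a l2 \<Rightarrow> real" where
  "norm_l2 x = sqrt (x \<bullet> x)"

definition sgn_l2 :: "'a l2 \<Rightarrow> 'a l2" where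
  "sgn_l2 x = inverse (norm x) *\<^sub>R x"

definition dist_l2 :: "'a l2 \<Rightarrow> 'a l2 \<Rightarrow> real" where
  "dist_l2 x y = norm (x - y)"

definition uniformity_l2 :: "('a l2 \<times> 'a l2) filter" where
  "uniformity_l2 = (INF e\<in>{0<..}. principal {(x, y). dist x y < e})"

definition open_l2 :: "'a l2 set \<Rightarrow> bool" where
  "open_l2 U \<longleftrightarrow> (\<forall>x\<in>U. eventually (\<lambda>(x', y). x' = x \<longrightarrow> y \<in> U) uniformity)"

instance
proof
  fix x y z :: "'a l2" and c d :: real
  show "x + y + z = x + (y + z)"
    by transfer
       (auto simp: l2_rel_def add.assoc intro!: square_integrable_add)
  show "x + y = y + x"
    by transfer (auto simp: l2_rel_def add.commute intro!: square_integrable_add)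
  show "0 + x = x"
    by transfer (auto simp: l2_rel_def)
  show "- x + x = 0"
    by transfer (auto simp: l2_rel_def square_integrable_zero)
  show "x - y = x + - y"
    by (simp add: minus_l2_def)
  show "c *\<^sub>R (x + y) = c *\<^sub>R x + c *\<^sub>R y"
    by transfer (auto simp: l2_rel_def scaleR_add_right
        intro!: square_integrable_add square_integrable_scaleR)
  show "(c + d) *\<^sub>R x = c *\<^sub>R x + d *\<^sub>R x"
    by transfer (auto simp: l2_rel_def scaleR_add_left
        intro!: square_integrable_add square_integrable_scaleR)
  show "c *\<^sub>R d *\<^sub>R x = (c * d) *\<^sub>R x"
    by transfer (auto simp: l2_rel_def intro!: square_integrable_scaleR)
  show "1 *\<^sub>R x = x"
    by transfer (auto simp: l2_rel_def)
  show "sgn x = inverse (norm x) *\<^sub>R x"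
    by (simp add: sgn_l2_def)
  show "dist x y = norm (x - y)"
    by (simp add: dist_l2_def)
  show "uniformity = (INF e\<in>{0<..}. principal {(x, y :: 'a l2). dist x y < e})"
    by (simp add: uniformity_l2_def)
  show "open U \<longleftrightarrow> (\<forall>x\<in>U. eventually (\<lambda>(x', y). x' = x \<longrightarrow> y \<in> U) uniformity)"
    for U :: "'a l2 set"
    by (simp add: open_l2_def)
  show "x \<bullet> y = y \<bullet> x"
    by transfer (simp add: inner_commute)
  show "(x + y) \<bullet> z = x \<bullet> z + y \<bullet> z"
    by transfer (auto simp: l2_rel_def inner_add_left square_integrable_inner)
  show "c *\<^sub>R x \<bullet> y = c * (x \<bullet> y)"
    by transfer auto
  show "0 \<le> x \<bullet> x"
    by transfer auto
  show "x \<bullet> x = 0 \<longleftrightarrow> x = 0"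
  proof transfer
    fix f :: "real \<Rightarrow> 'a"
    assume "l2_rel f f"
    then have f: "square_integrable f"
      by (simp add: l2_rel_def)
    have "integral\<^sup>L lborel (\<lambda>t. f t \<bullet> f t) = 0 \<longleftrightarrow> (AE t in lborel. f t \<bullet> f t = 0)"
      by (rule integral_nonneg_eq_0_iff_AE) (auto simp: square_integrable_inner[OF f f])
    then show "integral\<^sup>L lborel (\<lambda>t. f t \<bullet> f t) = 0 \<longleftrightarrow> l2_rel f (\<lambda>t. 0)"
      using f by (simp add: l2_rel_def square_integrable_zero)
  qed
  show "norm x = sqrt (x \<bullet> x)"
    by (simp add: norm_l2_def)
qed

end

text \<open>
  A type cannot depend on the interval, so the square integrable functions on
  \<open>I \<subseteq> \<real>\<close> are realised, by extension by zero, as a closed subspace of the square integrable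
  functions on the whole line.  \<open>L2_class I f\<close> is the class of \<open>f\<close> restricted to \<open>I\<close>; it is
  meaningful only if \<open>square_integrable_on I f\<close>.
\<close>

definition square_integrable_on :: "real set \<Rightarrow> (real \<Rightarrow> 'a::euclidean_space) \<Rightarrow> bool" where
  "square_integrable_on I f \<longleftrightarrow> square_integrable (\<lambda>t. indicator I t *\<^sub>R f t)"

definition L2_class :: "real set \<Rightarrow> (real \<Rightarrow> 'a::euclidean_space) \<Rightarrow> 'a l2" where
  "L2_class I f = abs_l2 (\<lambda>t. indicator I t *\<^sub>R f t)"

definition L2 :: "real set \<Rightarrow> 'a::euclidean_space l2 set" where
  "L2 I = {L2_class I f |f. square_integrable_on I f}"


section \<open>Unbounded operators, represented by their graphs\<close>

definition linear_operator_in :: "'h::real_inner set \<Rightarrow> ('h \<times> 'h) set \<Rightarrow> bool" where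
  "linear_operator_in H T \<longleftrightarrow> T \<subseteq> H \<times> H \<and> subspace T \<and> single_valued T"

definition closed_operator_in :: "'h::real_inner set \<Rightarrow> ('h \<times> 'h) set \<Rightarrow> bool" where
  "closed_operator_in H T \<longleftrightarrow> linear_operator_in H T \<and> closed T"

definition densely_defined_in :: "'h::real_inner set \<Rightarrow> ('h \<times> 'h) set \<Rightarrow> bool" where
  "densely_defined_in H T \<longleftrightarrow> H \<subseteq> closure (Domain T)"

definition symmetric_operator :: "('h::real_inner \<times> 'h) set \<Rightarrow> bool" where
  "symmetric_operator T \<longleftrightarrow> (\<forall>(x, y)\<in>T. \<forall>(x', y')\<in>T. y \<bullet> x' = x \<bullet> y')"

definition operator_adjoint_in :: "'h::real_inner set \<Rightarrow> ('h \<times> 'h) set \<Rightarrow> ('h \<times> 'h) set" where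
  "operator_adjoint_in H T = {(f, g). f \<in> H \<and> g \<in> H \<and> (\<forall>(x, y)\<in>T. y \<bullet> f = x \<bullet> g)}"

definition operator_kernel :: "('h::real_inner \<times> 'h) set \<Rightarrow> 'h set" where
  "operator_kernel T = {x. (x, 0) \<in> T}"

definition finite_codimension_in :: "'h::real_vector set \<Rightarrow> 'h set \<Rightarrow> bool" where
  "finite_codimension_in H S \<longleftrightarrow> (\<exists>B. finite B \<and> B \<subseteq> H \<and> span (S \<union> B) = H)"

definition fredholm_operator_in :: "'h::real_inner set \<Rightarrow> ('h \<times> 'h) set \<Rightarrow> bool" where
  "fredholm_operator_in H T \<longleftrightarrow>
     (\<exists>B. finite B \<and> span B = operator_kernel T) \<and>
     closed (Range T) \<and> finite_codimension_in H (Range T)"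

definition is_direct_sum :: "'v::real_vector set \<Rightarrow> 'v set \<Rightarrow> 'v set \<Rightarrow> bool" where
  "is_direct_sum U A B \<longleftrightarrow>
     subspace A \<and> subspace B \<and> A \<inter> B = {0} \<and> U = {x + y |x y. x \<in> A \<and> y \<in> B}"


section \<open>Sturm--Liouville expressions\<close>

text \<open>Infinite differentiability, to be used for open \<open>S\<close>; \<open>D k\<close> is the \<open>k\<close>-th derivative.\<close>

definition smooth_on :: "real set \<Rightarrow> (real \<Rightarrow> 'a::real_normed_vector) \<Rightarrow> bool" where
  "smooth_on S f \<longleftrightarrow>
     (\<exists>D. D 0 = f \<and> (\<forall>k. \<forall>t\<in>S. (D k has_vector_derivative D (Suc k) t) (at t)))"

definition test_functions :: "ereal \<Rightarrow> ereal \<Rightarrow> (real \<Rightarrow> real^'n) set" where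
  "test_functions a b =
     {u. smooth_on UNIV u \<and> (\<exists>K. compact K \<and> K \<subseteq> einterval a b \<and> (\<forall>t. t \<notin> K \<longrightarrow> u t = 0))}"

definition symmetric_matrix :: "real^'n^'n \<Rightarrow> bool" where
  "symmetric_matrix A \<longleftrightarrow> transpose A = A"

definition sl_coefficients ::
  "ereal \<Rightarrow> ereal \<Rightarrow> (real \<Rightarrow> real^'n^'n) \<Rightarrow> (real \<Rightarrow> real^'n^'n) \<Rightarrow> (real \<Rightarrow> real^'n^'n) \<Rightarrow> bool" where
  "sl_coefficients a b P Q R \<longleftrightarrow>
     (\<forall>t\<in>einterval a b. invertible (P t)) \<and>
     (\<forall>t\<in>einterval a b. symmetric_matrix (matrix_inv (P t))) \<and>
     (\<lambda>t. matrix_inv (P t)) C1_differentiable_on einterval a b \<and>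
     Q C1_differentiable_on einterval a b \<and>
     (\<forall>t\<in>einterval a b. symmetric_matrix (R t)) \<and>
     continuous_on (einterval a b) R"

text \<open>The limit of \<open>P\<close> at \<open>b\<close> has to be invertible as well.\<close>

definition regular_right_endpoint ::
  "ereal \<Rightarrow> (real \<Rightarrow> real^'n^'n) \<Rightarrow> (real \<Rightarrow> real^'n^'n) \<Rightarrow> (real \<Rightarrow> real^'n^'n) \<Rightarrow> bool" where
  "regular_right_endpoint b P Q R \<longleftrightarrow>
     \<bar>b\<bar> \<noteq> \<infinity> \<and>
     (\<exists>Pb. invertible Pb \<and> (P \<longlongrightarrow> Pb) (at_left (real_of_ereal b))) \<and>
     (\<exists>Qb. (Q \<longlongrightarrow> Qb) (at_left (real_of_ereal b))) \<and>
     (\<exists>Rb. (R \<longlongrightarrow> Rb) (at_left (real_of_ereal b)))"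

definition quasi_derivative ::
  "(real \<Rightarrow> real^'n^'n) \<Rightarrow> (real \<Rightarrow> real^'n^'n) \<Rightarrow> (real \<Rightarrow> real^'n) \<Rightarrow> real \<Rightarrow> real^'n" where
  "quasi_derivative P Q u t = P t *v vector_derivative u (at t) + Q t *v u t"

definition sl_expression ::
  "(real \<Rightarrow> real^'n^'n) \<Rightarrow> (real \<Rightarrow> real^'n^'n) \<Rightarrow> (real \<Rightarrow> real^'n^'n) \<Rightarrow>
   (real \<Rightarrow> real^'n) \<Rightarrow> real \<Rightarrow> real^'n" where
  "sl_expression P Q R u t =
     - vector_derivative (quasi_derivative P Q u) (at t)
     + transpose (Q t) *v vector_derivative u (at t) + R t *v u t"

definition minimal_operator ::
  "ereal \<Rightarrow> ereal \<Rightarrow> (real \<Rightarrow> real^'n^'n) \<Rightarrow> (real \<Rightarrow> real^'n^'n) \<Rightarrow> (real \<Rightarrow> real^'n^'n) \<Rightarrow>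
   ((real^'n) l2 \<times> (real^'n) l2) set" where
  "minimal_operator a b P Q R =
     closure {(L2_class (einterval a b) u, L2_class (einterval a b) (sl_expression P Q R u)) |u.
       u \<in> test_functions a b}"

definition vanishes_near_left :: "ereal \<Rightarrow> ereal \<Rightarrow> (real \<Rightarrow> real^'n) \<Rightarrow> bool" where
  "vanishes_near_left a b z \<longleftrightarrow>
     (\<exists>c\<in>einterval a b. \<forall>t\<in>einterval a b. t < c \<longrightarrow> z t = 0)"

text \<open>
  The pair \<open>(z\<^sup>[\<^sup>1\<^sup>](b), z(b))\<close>.  The values at the endpoint are those of the continuous extensions
  to \<open>b\<close>, which exist for every element of the domain of the adjoint if \<open>b\<close> is regular.
\<close>

definition boundary_value ::
  "ereal \<Rightarrow> (real \<Rightarrow> real^'n^'n) \<Rightarrow> (real \<Rightarrow> real^'n^'n) \<Rightarrow> (real \<Rightarrow> real^'n) \<Rightarrow> (real^'n) \<times> (real^'n)" where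
  "boundary_value b P Q z =
     (Lim (at_left (real_of_ereal b)) (quasi_derivative P Q z), Lim (at_left (real_of_ereal b)) z)"

end

theory Submission
  imports Defs "HOL-Probability.Sinc_Integral"
begin

text \<open>
  Two facts about the boundary values at \<open>b\<close> of functions in the domain of the adjoint carry the
  proof.  Both come from Green's formula: if \<open>f\<close> vanishes near \<open>a\<close>, then
  \<open>\<langle>l f, g\<rangle> - \<langle>f, l g\<rangle> = f(b) \<bullet> g\<^sup>[\<^sup>1\<^sup>](b) - f\<^sup>[\<^sup>1\<^sup>](b) \<bullet> g(b)\<close>, and the right-hand side is a nondegenerate form
  in the boundary values.

  First, an element \<open>v\<close> of the kernel of \<open>L\<^sup>*\<close> that is orthogonal to all \<open>L\<^sup>* z\<^sub>i\<close> is zero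
  (\<open>adjoint_kernel_detected\<close>): its boundary form with every \<open>z\<^sub>i\<close> vanishes, so its boundary values
  do, and a solution of \<open>l v = 0\<close> is determined by its values at the regular endpoint.  To apply Green's
  formula to \<open>v\<close> one needs that \<open>v\<close>, which is only known to be orthogonal to \<open>l u\<close> for all test
  functions \<open>u\<close>, is a classical solution.  This regularity (\<open>adjoint_kernel_classical\<close>) is obtained by
  integrating the weak equation twice with the lemma of du Bois-Reymond.

  Second, no nontrivial combination of the \<open>z\<^sub>i\<close> lies in \<open>D(L)\<close>
  (\<open>boundary_elements_independent\<close>), since the boundary form of an element of \<open>D(L)\<close> with any \<open>z\<^sub>i\<close>
  vanishes by symmetry.

  The rest is operator theory and counting.  A vector orthogonal to the closed subspace \<open>R(L)\<close> and to all
  \<open>L\<^sup>* z\<^sub>i\<close> lies in \<open>ker L\<^sup>*\<close>, hence is zero by the first fact.  So \<open>H\<close> is the sum of \<open>R(L)\<close> and the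
  span of the \<open>L\<^sup>* z\<^sub>i\<close>; therefore \<open>L\<^sup>*\<close> is onto and \<open>D(L\<^sup>*) = D(L) + Z + ker L\<^sup>*\<close>.  As \<open>L\<close> is
  injective and \<open>R(L)\<close> is the orthogonal complement of \<open>ker L\<^sup>*\<close>, the quotient \<open>D(L\<^sup>*) / D(L)\<close> has
  dimension \<open>2 k\<close>.  The \<open>2 n\<close> classes of the \<open>z\<^sub>i\<close> are independent in it and are completed to a basis
  by elements of \<open>Y\<close>, of which \<open>2 k - 2 n\<close> are needed (\<open>complement_of_Domain\<close>).  This number lies
  between \<open>0\<close> and \<open>k\<close>, which gives \<open>n \<le> k \<le> 2 n\<close>.
\<close>

section \<open>Linear algebra modulo a subspace\<close>

text \<open>
  Linear independence of the classes of a family in the quotient by \<open>A\<close>.  With \<open>A = {0}\<close> it is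
  independence of an indexed family, which includes injectivity.
\<close>
definition independent_modulo :: "'v::real_vector set \<Rightarrow> 'i set \<Rightarrow> ('i \<Rightarrow> 'v) \<Rightarrow> bool" where
  "independent_modulo A I w \<longleftrightarrow>
     (\<forall>c. (\<Sum>i\<in>I. c i *\<^sub>R w i) \<in> A \<longrightarrow> (\<forall>i\<in>I. c i = 0))"

lemma independent_modulo_zero:
  assumes "finite I" "independent_modulo {0} I w"
  shows "inj_on w I" "independent (w ` I)"
proof -
  show inj: "inj_on w I"
  proof (rule inj_onI, rule ccontr)
    fix i j assume ij: "i \<in> I" "j \<in> I" "w i = w j" "i \<noteq> j"
    define c where "c l = (if l = i then 1 else if l = j then -1 else 0 :: real)" for l
    have "(\<Sum>l\<in>I. c l *\<^sub>R w l) = (\<Sum>l\<in>{i,j}. c l *\<^sub>R w l)"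
      using assms(1) ij by (intro sum.mono_neutral_right) (auto simp: c_def)
    also have "\<dots> = 0" using ij by (simp add: c_def)
    finally have "c i = 0" using assms(2) ij(1) unfolding independent_modulo_def by blast
    then show False by (simp add: c_def)
  qed
  show "independent (w ` I)"
  proof
    assume "dependent (w ` I)"
    then obtain u where u: "\<exists>v\<in>w ` I. u v \<noteq> 0" "(\<Sum>v\<in>w ` I. u v *\<^sub>R v) = 0"
      using dependent_finite[of "w ` I"] assms(1) by auto
    have "(\<Sum>i\<in>I. u (w i) *\<^sub>R w i) = 0"
      using u(2) by (simp add: sum.reindex[OF inj])
    then have "\<forall>i\<in>I. u (w i) = 0"
      using assms(2)[unfolded independent_modulo_def, rule_format, of "\<lambda>i. u (w i)"] by auto
    then show False using u(1) by blast
  qed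
qed

lemma independent_modulo_zeroI:
  assumes "finite I" "inj_on w I" "independent (w ` I)"
  shows "independent_modulo {0} I w"
  unfolding independent_modulo_def
proof (intro allI impI ballI)
  fix c i assume "(\<Sum>i\<in>I. c i *\<^sub>R w i) \<in> {0}" "i \<in> I"
  then have "(\<Sum>v\<in>w ` I. c (the_inv_into I w v) *\<^sub>R v) = 0"
    by (simp add: sum.reindex[OF assms(2)] the_inv_into_f_f[OF assms(2)])
  then have "c (the_inv_into I w (w i)) = 0"
    using assms(1,3) \<open>i \<in> I\<close> dependent_finite[of "w ` I"] by auto
  then show "c i = 0" using assms(2) \<open>i \<in> I\<close> by (simp add: the_inv_into_f_f)
qed

text \<open>
  Each \<open>w i\<close> differs by an element of \<open>A\<close> from some \<open>s i\<close> in the span of \<open>S\<close>, and the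
  \<open>s i\<close> inherit the independence; so this is the exchange lemma in the quotient by \<open>A\<close>,
  stated without forming that quotient.
\<close>
lemma independent_modulo_card_le:
  assumes "subspace A" "finite I" "finite S" "independent_modulo A I w"
    and "\<And>i. i \<in> I \<Longrightarrow> \<exists>x\<in>A. \<exists>y\<in>span S. w i = x + y"
  shows "card I \<le> card S"
proof -
  obtain x s where xs: "\<And>i. i \<in> I \<Longrightarrow> x i \<in> A \<and> s i \<in> span S \<and> w i = x i + s i"
    using assms(5) by metis
  have "independent_modulo {0} I s"
    unfolding independent_modulo_def
  proof (intro allI impI)
    fix c assume "(\<Sum>i\<in>I. c i *\<^sub>R s i) \<in> {0}"
    then have "(\<Sum>i\<in>I. c i *\<^sub>R w i) = (\<Sum>i\<in>I. c i *\<^sub>R x i)"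
      using xs by (simp add: scaleR_add_right sum.distrib)
    also have "\<dots> \<in> A"
      using xs assms(1) by (intro subspace_sum subspace_scale) auto
    finally show "\<forall>i\<in>I. c i = 0"
      using assms(4) unfolding independent_modulo_def by blast
  qed
  from independent_modulo_zero[OF assms(2) this]
  have "inj_on s I" "independent (s ` I)" .
  moreover have "s ` I \<subseteq> span S" using xs by auto
  ultimately show ?thesis
    using independent_span_bound[OF assms(3), of "s ` I"] by (simp add: card_image)
qed

lemma independent_modulo_mono:
  assumes "independent_modulo A I w" "B \<subseteq> A"
  shows "independent_modulo B I w"
  using assms unfolding independent_modulo_def by blast

lemma independent_modulo_direct_sum:
  assumes "subspace A" "finite I" "independent_modulo A I w"
  shows "A \<inter> span (w ` I) = {0}"
proof -
  have "inj_on w I"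
    using independent_modulo_zero(1)[OF assms(2) independent_modulo_mono[OF assms(3)]]
      subspace_0[OF assms(1)] by simp
  have "x = 0" if x: "x \<in> A" "x \<in> span (w ` I)" for x
  proof -
    obtain u where u: "x = (\<Sum>v\<in>w ` I. u v *\<^sub>R v)"
      using x(2) span_finite[of "w ` I"] assms(2) by auto
    then have "x = (\<Sum>i\<in>I. u (w i) *\<^sub>R w i)"
      by (simp add: sum.reindex[OF \<open>inj_on w I\<close>])
    with x(1) have "\<forall>i\<in>I. u (w i) = 0"
      using assms(3)[unfolded independent_modulo_def, rule_format, of "\<lambda>i. u (w i)"] by auto
    then show "x = 0" using \<open>x = (\<Sum>i\<in>I. u (w i) *\<^sub>R w i)\<close> by simp
  qed
  then show ?thesis using assms(1) subspace_0 span_zero by auto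
qed

text \<open>
  Take \<open>Y'\<close> maximal among the subsets of \<open>Y\<close> that keep the family independent modulo \<open>A\<close>.  In a
  dependence created by a further element \<open>y\<close>, the coefficient of \<open>y\<close> cannot vanish, so \<open>y\<close> is already
  in the sum.
\<close>
lemma exists_complementary_subset:
  assumes "subspace A" "finite I" "finite Y" "independent_modulo A I w"
  obtains Y' where "Y' \<subseteq> Y"
    "independent_modulo A (Inl ` I \<union> Inr ` Y') (case_sum w (\<lambda>y. y))"
    "Y \<subseteq> {x + s |x s. x \<in> A \<and> s \<in> span (w ` I \<union> Y')}"
proof -
  let ?v = "case_sum w (\<lambda>y. y)"
  let ?good = "\<lambda>Y'. Y' \<subseteq> Y \<and> independent_modulo A (Inl ` I \<union> Inr ` Y') ?v"
  have "independent_modulo A (Inl ` I \<union> Inr ` {}) ?v"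
    unfolding independent_modulo_def
  proof (intro allI impI)
    fix c assume "(\<Sum>i\<in>Inl ` I \<union> Inr ` {}. c i *\<^sub>R ?v i) \<in> A"
    then have "(\<Sum>i\<in>I. c (Inl i) *\<^sub>R w i) \<in> A" by (simp add: sum.reindex)
    then show "\<forall>i\<in>Inl ` I \<union> Inr ` {}. c i = 0"
      using assms(4)[unfolded independent_modulo_def, rule_format, of "\<lambda>i. c (Inl i)"] by auto
  qed
  then have "?good {}" by simp
  moreover have "finite {Y'. ?good Y'}" using assms(3) by simp
  ultimately obtain Y' where Y': "?good Y'" and max: "\<And>Y''. ?good Y'' \<Longrightarrow> Y' \<subseteq> Y'' \<Longrightarrow> Y'' = Y'"
    using finite_has_maximal[of "{Y'. ?good Y'}"] by (metis (mono_tags, lifting) empty_iff mem_Collect_eq)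
  have fin: "finite (Inl ` I \<union> Inr ` Y')"
    using assms(2,3) Y' by (auto intro: finite_subset)
  have "y \<in> {x + s |x s. x \<in> A \<and> s \<in> span (w ` I \<union> Y')}" if "y \<in> Y" for y
  proof (cases "y \<in> Y'")
    case True
    then show ?thesis using subspace_0[OF assms(1)] by (force intro: span_base)
  next
    case False
    then have "\<not> ?good (insert y Y')" using max[of "insert y Y'"] by auto
    then have "\<not> independent_modulo A (insert (Inr y) (Inl ` I \<union> Inr ` Y')) ?v"
      using that Y' by simp
    then obtain c i where c: "(\<Sum>i\<in>insert (Inr y) (Inl ` I \<union> Inr ` Y'). c i *\<^sub>R ?v i) \<in> A"
      and i: "i \<in> insert (Inr y) (Inl ` I \<union> Inr ` Y')" "c i \<noteq> 0"
      unfolding independent_modulo_def by blast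
    define s where "s = (\<Sum>i\<in>Inl ` I \<union> Inr ` Y'. c i *\<^sub>R ?v i)"
    have sum: "c (Inr y) *\<^sub>R y + s \<in> A"
      using c fin False by (subst (asm) sum.insert) (auto simp: s_def)
    have s: "s \<in> span (w ` I \<union> Y')"
      unfolding s_def by (intro span_sum span_scale span_base) auto
    have "c (Inr y) \<noteq> 0"
    proof
      assume "c (Inr y) = 0"
      with sum have "s \<in> A" by simp
      then have "\<forall>i\<in>Inl ` I \<union> Inr ` Y'. c i = 0"
        using Y' unfolding independent_modulo_def s_def by blast
      with i \<open>c (Inr y) = 0\<close> show False by auto
    qed
    then have "y = (1 / c (Inr y)) *\<^sub>R (c (Inr y) *\<^sub>R y + s) + (- 1 / c (Inr y)) *\<^sub>R s"
      by (simp add: scaleR_add_right)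
    moreover have "(1 / c (Inr y)) *\<^sub>R (c (Inr y) *\<^sub>R y + s) \<in> A"
      using sum assms(1) subspace_scale by blast
    moreover have "(- 1 / c (Inr y)) *\<^sub>R s \<in> span (w ` I \<union> Y')"
      using s span_scale by blast
    ultimately show ?thesis by blast
  qed
  then show ?thesis using Y' by (intro that[of Y']) auto
qed

section \<open>Orthogonal projections\<close>

text \<open>
  What completeness of a subspace is needed for; in this form it passes by pure algebra to extensions of
  the subspace by finitely many vectors.
\<close>
definition has_projections :: "'h::real_inner set \<Rightarrow> bool" where
  "has_projections M \<longleftrightarrow> (\<forall>h. \<exists>m\<in>M. \<forall>x\<in>M. (h - m) \<bullet> x = 0)"

text \<open>
  Minimise the distance from \<open>h\<close>.  By the parallelogram law a minimising sequence is Cauchy, and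
  the first variation at its limit vanishes.
\<close>
lemma has_projections_complete:
  fixes M :: "'h::real_inner set"
  assumes M: "subspace M" "complete M"
  shows "has_projections M"
  unfolding has_projections_def
proof
  fix h :: 'h
  define d where "d = (INF m\<in>M. (norm (h - m))\<^sup>2)"
  have ne: "M \<noteq> {}" using subspace_0[OF M(1)] by auto
  have bdd: "bdd_below ((\<lambda>m. (norm (h - m))\<^sup>2) ` M)" by (intro bdd_belowI2[of _ 0]) simp
  have d_le: "d \<le> (norm (h - m))\<^sup>2" if "m \<in> M" for m
    unfolding d_def using bdd that by (rule cINF_lower)
  have "\<exists>m\<in>M. (norm (h - m))\<^sup>2 < d + e" if "0 < e" for e
    using cINF_less_iff[OF ne bdd, of "d + e"] that unfolding d_def by auto
  then have "\<forall>i. \<exists>m\<in>M. (norm (h - m))\<^sup>2 < d + 1 / real (Suc i)" by simp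
  then obtain m where m: "\<And>i. m i \<in> M" "\<And>i. (norm (h - m i))\<^sup>2 < d + 1 / real (Suc i)"
    by metis
  have par: "(norm (m i - m j))\<^sup>2 \<le> 2 / real (Suc i) + 2 / real (Suc j)" for i j
  proof -
    have "(1/2) *\<^sub>R (m i + m j) \<in> M" using M(1) m(1) subspace_add subspace_scale by blast
    from d_le[OF this] have "4 * d \<le> 4 * (norm (h - (1/2) *\<^sub>R (m i + m j)))\<^sup>2" by simp
    also have "\<dots> = (norm ((h - m i) + (h - m j)))\<^sup>2"
    proof -
      have "(h - m i) + (h - m j) = 2 *\<^sub>R (h - (1/2) *\<^sub>R (m i + m j))"
        by (simp add: algebra_simps scaleR_2)
      then show ?thesis by (simp only: norm_scaleR power_mult_distrib) simp
    qed
    also have "\<dots> = 2 * (norm (h - m i))\<^sup>2 + 2 * (norm (h - m j))\<^sup>2 - (norm (m i - m j))\<^sup>2"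
      by (simp add: power2_norm_eq_inner inner_diff_left inner_diff_right inner_add_left
          inner_add_right inner_commute algebra_simps)
    finally show ?thesis using m(2)[of i] m(2)[of j] by simp
  qed
  have "Cauchy m"
  proof (rule metric_CauchyI)
    fix e :: real assume "0 < e"
    then obtain N where N: "inverse (real (Suc N)) < e\<^sup>2 / 4"
      using reals_Archimedean[of "e\<^sup>2 / 4"] by auto
    have "dist (m i) (m j) < e" if "i \<ge> N" "j \<ge> N" for i j
    proof -
      have "1 / real (Suc i) \<le> inverse (real (Suc N))" "1 / real (Suc j) \<le> inverse (real (Suc N))"
        using that by (auto simp: divide_simps)
      then have "(norm (m i - m j))\<^sup>2 < e\<^sup>2" using par[of i j] N by simp
      then show ?thesis using \<open>0 < e\<close> by (simp add: dist_norm power2_less_imp_less)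
    qed
    then show "\<exists>N. \<forall>i\<ge>N. \<forall>j\<ge>N. dist (m i) (m j) < e" by blast
  qed
  then obtain p where p: "p \<in> M" "m \<longlonglongrightarrow> p"
    using M(2) m(1) unfolding complete_def by blast
  have "(\<lambda>i. (norm (h - m i))\<^sup>2) \<longlonglongrightarrow> (norm (h - p))\<^sup>2"
    by (intro tendsto_intros p)
  moreover have "(\<lambda>i. d + 1 / real (Suc i)) \<longlonglongrightarrow> d + 0"
    by (intro tendsto_intros LIMSEQ_Suc[OF lim_1_over_n])
  ultimately have "(norm (h - p))\<^sup>2 \<le> d + 0"
    using m(2) by (intro LIMSEQ_le) (auto intro: less_imp_le)
  have "(h - p) \<bullet> x = 0" if "x \<in> M" for x
  proof (rule ccontr)
    assume nz: "(h - p) \<bullet> x \<noteq> 0"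
    then have x: "x \<bullet> x > 0" by (auto simp: inner_gt_zero_iff)
    define t where "t = (h - p) \<bullet> x / (x \<bullet> x)"
    have "p + t *\<^sub>R x \<in> M" using M(1) p(1) that subspace_add subspace_scale by blast
    from d_le[OF this] have "d \<le> (h - p - t *\<^sub>R x) \<bullet> (h - p - t *\<^sub>R x)"
      by (simp add: power2_norm_eq_inner diff_diff_add)
    also have "\<dots> = (h - p) \<bullet> (h - p) - 2 * t * ((h - p) \<bullet> x) + t * t * (x \<bullet> x)"
      by (simp add: inner_diff_left inner_diff_right inner_commute algebra_simps)
    also have "\<dots> = (norm (h - p))\<^sup>2 - ((h - p) \<bullet> x)\<^sup>2 / (x \<bullet> x)"
      using x by (simp add: t_def power2_norm_eq_inner[of "h - p"] power2_eq_square[of "(h - p) \<bullet> x"] field_simps)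
    also have "\<dots> < (norm (h - p))\<^sup>2" using nz x by simp
    finally show False using \<open>(norm (h - p))\<^sup>2 \<le> d + 0\<close> by simp
  qed
  with p(1) show "\<exists>m\<in>M. \<forall>x\<in>M. (h - m) \<bullet> x = 0" by blast
qed

text \<open>
  One Gram--Schmidt step: the component \<open>e\<close> of \<open>x\<close> orthogonal to \<open>M\<close> contributes the projection onto
  its line.
\<close>
lemma has_projections_insert:
  fixes M :: "'h::real_inner set"
  assumes M: "subspace M" "has_projections M"
  shows "has_projections (span (insert x M))"
  unfolding has_projections_def
proof
  fix h :: 'h
  obtain m where m: "m \<in> M" "\<And>y. y \<in> M \<Longrightarrow> (x - m) \<bullet> y = 0"
    using M(2) unfolding has_projections_def by blast
  obtain p where p: "p \<in> M" "\<And>y. y \<in> M \<Longrightarrow> (h - p) \<bullet> y = 0"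
    using M(2) unfolding has_projections_def by blast
  (* c is 0 by division by zero if x already lies in M *)
  define e where "e = x - m"
  define c where "c = (h - p) \<bullet> e / (e \<bullet> e)"
  have "p + c *\<^sub>R e \<in> span (insert x M)"
    unfolding e_def using p(1) m(1) by (intro span_add span_scale span_diff span_base) auto
  moreover have "(h - (p + c *\<^sub>R e)) \<bullet> y = 0" if "y \<in> span (insert x M)" for y
  proof -
    have "\<exists>a. y - a *\<^sub>R x \<in> span M" using that span_breakdown_eq[of y x M] by blast
    moreover have "span M = M" using M(1) by (rule span_eq_iff[THEN iffD2])
    ultimately obtain a where a: "y - a *\<^sub>R x \<in> M" by auto
    define y' where "y' = y - a *\<^sub>R x + a *\<^sub>R m"
    have y': "y' \<in> M" unfolding y'_def using a m(1) M(1) subspace_add subspace_scale by blast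
    have y: "y = y' + a *\<^sub>R e" by (simp add: y'_def e_def algebra_simps)
    have "e \<bullet> y' = 0" "(h - p) \<bullet> y' = 0" using m(2)[OF y'] p(2)[OF y'] by (auto simp: e_def)
    moreover have "(h - p) \<bullet> e - c * (e \<bullet> e) = 0" by (cases "e = 0") (auto simp: c_def)
    moreover have "(h - (p + c *\<^sub>R e)) \<bullet> y =
        (h - p) \<bullet> y' - c * (e \<bullet> y') + a * ((h - p) \<bullet> e - c * (e \<bullet> e))"
      unfolding y by (simp add: inner_diff_left inner_add_left inner_add_right algebra_simps)
    ultimately show ?thesis by simp
  qed
  ultimately show "\<exists>m\<in>span (insert x M). \<forall>y\<in>span (insert x M). (h - m) \<bullet> y = 0" by blast
qed

lemma has_projections_span_Un:
  fixes M :: "'h::real_inner set"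
  assumes "subspace M" "has_projections M" "finite B"
  shows "has_projections (span (M \<union> B))"
  using assms(3)
proof induction
  case empty
  then show ?case using assms by (simp add: span_eq_iff[THEN iffD2])
next
  case (insert x B)
  have "span (insert x (span (M \<union> B))) = span (M \<union> insert x B)"
  proof
    have "insert x (span (M \<union> B)) \<subseteq> span (M \<union> insert x B)"
      using span_mono[of "M \<union> B" "M \<union> insert x B"] span_base[of x "M \<union> insert x B"] by auto
    then show "span (insert x (span (M \<union> B))) \<subseteq> span (M \<union> insert x B)"
      by (rule span_minimal) simp
    show "span (M \<union> insert x B) \<subseteq> span (insert x (span (M \<union> B)))"
      using span_superset[of "M \<union> B"] by (intro span_mono) auto
  qed
  then show ?case using has_projections_insert[OF subspace_span insert(3), of x] by simp
qed

section \<open>Completeness of the space of square integrable functions\<close>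

lemma l2_cases:
  obtains f where "square_integrable f" "x = abs_l2 f"
proof
  show "square_integrable (rep_l2 x)"
    using Quotient_rep_reflp[OF Quotient_l2, of x] by (simp add: l2_rel_def)
  show "x = abs_l2 (rep_l2 x)"
    by (rule Quotient_abs_rep[OF Quotient_l2, symmetric])
qed

lemma abs_l2_eq_iff:
  assumes "square_integrable f" "square_integrable g"
  shows "abs_l2 f = abs_l2 g \<longleftrightarrow> (AE t in lborel. f t = g t)"
  using Quotient_rel[OF Quotient_l2, of f g] assms by (auto simp: l2_rel_def)

lemma inner_abs_l2:
  assumes "square_integrable f" "square_integrable g"
  shows "abs_l2 f \<bullet> abs_l2 g = (LBINT t. f t \<bullet> g t)"
  using assms by (intro inner_l2.abs_eq) (auto simp: l2_rel_def)

lemma square_integrable_diff: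
  assumes "square_integrable f" "square_integrable g"
  shows "square_integrable (\<lambda>t. f t - g t)"
  using square_integrable_add[OF assms(1) square_integrable_scaleR[OF assms(2), of "-1"]] by simp

lemma diff_abs_l2:
  assumes "square_integrable f" "square_integrable g"
  shows "abs_l2 f - abs_l2 g = abs_l2 (\<lambda>t. f t - g t)"
proof -
  have "- abs_l2 g = abs_l2 (\<lambda>t. - g t)"
    using assms by (intro uminus_l2.abs_eq) (auto simp: l2_rel_def)
  moreover have "abs_l2 f + abs_l2 (\<lambda>t. - g t) = abs_l2 (\<lambda>t. f t + - g t)"
    using assms square_integrable_scaleR[OF assms(2), of "-1"]
    by (intro plus_l2.abs_eq) (auto simp: l2_rel_def)
  ultimately show ?thesis by (simp add: minus_l2_def)
qed

lemma norm_abs_l2_power2: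
  assumes "square_integrable f"
  shows "(norm (abs_l2 f))\<^sup>2 = (LBINT t. (norm (f t))\<^sup>2)"
  using inner_abs_l2[OF assms assms] by (simp add: power2_norm_eq_inner)

lemma square_integrable_norm:
  "square_integrable f \<Longrightarrow> square_integrable (\<lambda>t. norm (f t))"
  by (auto simp: square_integrable_def)

lemma norm_abs_l2_norm:
  assumes "square_integrable f"
  shows "norm (abs_l2 (\<lambda>t. norm (f t))) = norm (abs_l2 f)"
proof (rule power2_eq_imp_eq)
  show "(norm (abs_l2 (\<lambda>t. norm (f t))))\<^sup>2 = (norm (abs_l2 f))\<^sup>2"
    by (simp only: norm_abs_l2_power2[OF assms] norm_abs_l2_power2[OF square_integrable_norm[OF assms]]
        real_norm_def abs_norm_cancel)
qed simp_all

lemma integral_norm_mult_le: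
  assumes "square_integrable f" "square_integrable g"
  shows "(LBINT t. norm (f t) * norm (g t)) \<le> norm (abs_l2 f) * norm (abs_l2 g)"
  using norm_cauchy_schwarz[of "abs_l2 (\<lambda>t. norm (f t))" "abs_l2 (\<lambda>t. norm (g t))"]
  by (simp add: inner_abs_l2 square_integrable_norm assms norm_abs_l2_norm)

lemma square_integrable_inverse_1_plus_square:
  "square_integrable (\<lambda>t::real. inverse (1 + t\<^sup>2))"
proof -
  have int: "integrable lborel (\<lambda>t::real. inverse (1 + t\<^sup>2))"
    using integrable_inverse_1_plus_square by (simp add: set_integrable_def)
  have "(inverse (1 + t\<^sup>2))\<^sup>2 \<le> inverse (1 + t\<^sup>2)" for t :: real
  proof -
    have "inverse (1 + t\<^sup>2) \<le> 1" by (simp add: inverse_le_1_iff)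
    then have "inverse (1 + t\<^sup>2) * inverse (1 + t\<^sup>2) \<le> inverse (1 + t\<^sup>2) * 1"
      by (intro mult_left_mono) auto
    then show ?thesis by (simp add: power2_eq_square)
  qed
  then have "integrable lborel (\<lambda>t::real. (inverse (1 + t\<^sup>2))\<^sup>2)"
    by (intro Bochner_Integration.integrable_bound[OF int]) (auto intro!: AE_I2)
  then show ?thesis by (simp add: square_integrable_def)
qed

text \<open>
  Multiplication by the positive square integrable weight \<open>1 / (1 + t\<^sup>2)\<close> turns \<open>L\<^sup>2\<close>-Cauchy
  sequences into \<open>L\<^sup>1\<close>-Cauchy sequences, so that a subsequence converges almost everywhere.
  By Fatou's lemma its limit is also the limit in \<open>L\<^sup>2\<close>.
\<close>
instance l2 :: (euclidean_space) complete_space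
proof
  fix X :: "nat \<Rightarrow> 'a l2"
  assume X: "Cauchy X"
  have "\<forall>n. \<exists>f. square_integrable f \<and> X n = abs_l2 f" using l2_cases by metis
  then obtain f where f: "\<And>n. square_integrable (f n)" "\<And>n. X n = abs_l2 (f n)" by metis
  have f_meas [measurable]: "f n \<in> borel_measurable lborel" for n
    using f(1) by (auto simp: square_integrable_def)
  define w :: "real \<Rightarrow> real" where "w t = inverse (1 + t\<^sup>2)" for t
  have w: "square_integrable w"
    unfolding w_def[abs_def] by (rule square_integrable_inverse_1_plus_square)
  have [measurable]: "w \<in> borel_measurable lborel" using w by (simp add: square_integrable_def)
  have w_pos: "w t > 0" for t by (simp add: w_def add_pos_nonneg)
  have dist: "norm (abs_l2 (\<lambda>t. f i t - f j t)) = dist (X i) (X j)" for i j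
    by (simp add: f dist_norm diff_abs_l2)
  have int_w: "integrable lborel (\<lambda>t. w t *\<^sub>R f n t)" for n
  proof (rule Bochner_Integration.integrable_bound)
    show "integrable lborel (\<lambda>t. (norm (w t))\<^sup>2 + (norm (f n t))\<^sup>2)"
      using w f(1)[of n] by (intro Bochner_Integration.integrable_add) (auto simp: square_integrable_def)
    have "\<bar>x\<bar> * y \<le> x\<^sup>2 + y\<^sup>2" if "y \<ge> 0" for x y :: real
      using sum_squares_bound[of "\<bar>x\<bar>" y] that mult_nonneg_nonneg[OF abs_ge_zero[of x] that]
      by (simp only: power2_abs mult.assoc)
    from this[OF norm_ge_zero]
    show "AE t in lborel. norm (w t *\<^sub>R f n t) \<le> norm ((norm (w t))\<^sup>2 + (norm (f n t))\<^sup>2)"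
      by (intro AE_I2) (simp only: norm_scaleR real_norm_def power2_abs abs_of_nonneg add_nonneg_nonneg zero_le_power2)
  qed simp
  obtain r where r: "strict_mono r" "AE t in lborel. Cauchy (\<lambda>i. w t *\<^sub>R f (r i) t)"
  proof (rule cauchy_L1_AE_cauchy_subseq[OF int_w])
    fix e :: real assume "0 < e"
    define C where "C = norm (abs_l2 w) + 1"
    have "C > 0" by (simp add: C_def add_nonneg_pos)
    obtain N where N: "\<And>i j. i \<ge> N \<Longrightarrow> j \<ge> N \<Longrightarrow> dist (X i) (X j) < e / C"
      using metric_CauchyD[OF X, of "e / C"] \<open>0 < e\<close> \<open>C > 0\<close> by auto
    have "(LBINT t. norm (w t *\<^sub>R f i t - w t *\<^sub>R f j t)) < e" if "i \<ge> N" "j \<ge> N" for i j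
    proof -
      have "(LBINT t. norm (w t *\<^sub>R f i t - w t *\<^sub>R f j t))
          = (LBINT t. norm (w t) * norm (f i t - f j t))"
        by (simp flip: scaleR_diff_right)
      also have "\<dots> \<le> norm (abs_l2 w) * dist (X i) (X j)"
        using integral_norm_mult_le[OF w square_integrable_diff[OF f(1)[of i] f(1)[of j]]]
        by (simp only: dist)
      also have "\<dots> \<le> C * dist (X i) (X j)" by (intro mult_right_mono) (auto simp: C_def)
      also have "\<dots> < C * (e / C)" using N[OF that] \<open>C > 0\<close> by (intro mult_strict_left_mono)
      finally show ?thesis using \<open>C > 0\<close> by simp
    qed
    then show "\<exists>N. \<forall>i\<ge>N. \<forall>j\<ge>N. (LBINT t. norm (w t *\<^sub>R f i t - w t *\<^sub>R f j t)) < e" by blast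
  qed blast
  define g where "g t = lim (\<lambda>i. f (r i) t)" for t
  have g_meas [measurable]: "g \<in> borel_measurable lborel"
    unfolding g_def[abs_def] by (intro borel_measurable_lim_metric) simp
  have lim: "AE t in lborel. (\<lambda>i. f (r i) t) \<longlonglongrightarrow> g t"
    using r(2)
  proof eventually_elim
    case (elim t)
    then have "convergent (\<lambda>i. w t *\<^sub>R f (r i) t)" by (simp add: Cauchy_convergent_iff)
    then obtain l where "(\<lambda>i. w t *\<^sub>R f (r i) t) \<longlonglongrightarrow> l" by (auto simp: convergent_def)
    then have "(\<lambda>i. inverse (w t) *\<^sub>R w t *\<^sub>R f (r i) t) \<longlonglongrightarrow> inverse (w t) *\<^sub>R l"
      by (intro tendsto_intros)
    then have "(\<lambda>i. f (r i) t) \<longlonglongrightarrow> inverse (w t) *\<^sub>R l" using w_pos[of t] by simp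
    then show ?case unfolding g_def by (simp add: limI)
  qed
  have close: "\<exists>N. \<forall>n\<ge>N. (\<integral>\<^sup>+t. ennreal ((norm (f n t - g t))\<^sup>2) \<partial>lborel) \<le> ennreal (e\<^sup>2)"
    if e: "e > 0" for e
  proof -
    obtain N where N: "\<And>i j. i \<ge> N \<Longrightarrow> j \<ge> N \<Longrightarrow> dist (X i) (X j) < e"
      using metric_CauchyD[OF X e] by auto
    have "(\<integral>\<^sup>+t. ennreal ((norm (f n t - g t))\<^sup>2) \<partial>lborel) \<le> ennreal (e\<^sup>2)" if "n \<ge> N" for n
    proof -
      have "(\<integral>\<^sup>+t. ennreal ((norm (f n t - g t))\<^sup>2) \<partial>lborel)
          = (\<integral>\<^sup>+t. liminf (\<lambda>i. ennreal ((norm (f n t - f (r i) t))\<^sup>2)) \<partial>lborel)"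
      proof (rule nn_integral_cong_AE)
        show "AE t in lborel. ennreal ((norm (f n t - g t))\<^sup>2)
            = liminf (\<lambda>i. ennreal ((norm (f n t - f (r i) t))\<^sup>2))"
          using lim
        proof eventually_elim
          case (elim t)
          then have "(\<lambda>i. ennreal ((norm (f n t - f (r i) t))\<^sup>2)) \<longlonglongrightarrow> ennreal ((norm (f n t - g t))\<^sup>2)"
            by (intro tendsto_intros) auto
          then show ?case using lim_imp_Liminf[OF sequentially_bot] by metis
        qed
      qed
      also have "\<dots> \<le> liminf (\<lambda>i. \<integral>\<^sup>+t. ennreal ((norm (f n t - f (r i) t))\<^sup>2) \<partial>lborel)"
        by (intro nn_integral_liminf) simp
      also have "\<dots> \<le> liminf (\<lambda>i::nat. ennreal (e\<^sup>2))"
      proof (rule Liminf_mono)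
        show "\<forall>\<^sub>F i in sequentially. (\<integral>\<^sup>+t. ennreal ((norm (f n t - f (r i) t))\<^sup>2) \<partial>lborel) \<le> ennreal (e\<^sup>2)"
          using eventually_ge_at_top[of N]
        proof eventually_elim
          case (elim i)
          then have "r i \<ge> N" using seq_suble[OF r(1), of i] by simp
          have sq: "square_integrable (\<lambda>t. f n t - f (r i) t)"
            by (intro square_integrable_diff f)
          then have "(\<integral>\<^sup>+t. ennreal ((norm (f n t - f (r i) t))\<^sup>2) \<partial>lborel)
              = ennreal ((dist (X n) (X (r i)))\<^sup>2)"
            using norm_abs_l2_power2[OF sq]
            by (subst nn_integral_eq_integral) (auto simp: square_integrable_def dist)
          also have "\<dots> \<le> ennreal (e\<^sup>2)"
            using N[OF that \<open>r i \<ge> N\<close>] by (intro ennreal_leI power_mono) auto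
          finally show ?case .
        qed
      qed
      also have "\<dots> = ennreal (e\<^sup>2)" by (simp add: Liminf_const)
      finally show ?thesis .
    qed
    then show ?thesis by blast
  qed
  have sq_diff: "square_integrable (\<lambda>t. f n t - g t)"
    if "(\<integral>\<^sup>+t. ennreal ((norm (f n t - g t))\<^sup>2) \<partial>lborel) \<le> ennreal c" for n c
    using that unfolding square_integrable_def
    by (auto intro!: integrableI_bounded simp: less_top[symmetric] top_unique)
  obtain N1 where "(\<integral>\<^sup>+t. ennreal ((norm (f N1 t - g t))\<^sup>2) \<partial>lborel) \<le> ennreal (1\<^sup>2)"
    using close[of 1] by auto
  from square_integrable_diff[OF f(1)[of N1] sq_diff[OF this]]
  have g: "square_integrable g" by simp
  have "X \<longlonglongrightarrow> abs_l2 g"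
  proof (rule metric_LIMSEQ_I)
    fix e :: real assume "0 < e"
    obtain N where N: "\<And>n. n \<ge> N \<Longrightarrow>
        (\<integral>\<^sup>+t. ennreal ((norm (f n t - g t))\<^sup>2) \<partial>lborel) \<le> ennreal ((e / 2)\<^sup>2)"
      using close[of "e / 2"] \<open>0 < e\<close> by auto
    have "dist (X n) (abs_l2 g) < e" if "n \<ge> N" for n
    proof -
      have sq: "square_integrable (\<lambda>t. f n t - g t)" by (intro square_integrable_diff f g)
      have "ennreal ((dist (X n) (abs_l2 g))\<^sup>2) = (\<integral>\<^sup>+t. ennreal ((norm (f n t - g t))\<^sup>2) \<partial>lborel)"
        using sq norm_abs_l2_power2[OF sq] diff_abs_l2[OF f(1)[of n] g]
        by (subst nn_integral_eq_integral) (auto simp: square_integrable_def f(2) dist_norm)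
      then have "(dist (X n) (abs_l2 g))\<^sup>2 \<le> (e / 2)\<^sup>2" using N[OF that]
        by (metis ennreal_le_iff zero_le_power2)
      then have "dist (X n) (abs_l2 g) \<le> e / 2"
        by (rule power2_le_imp_le) (use \<open>0 < e\<close> in simp)
      then show ?thesis using \<open>0 < e\<close> by simp
    qed
    then show "\<exists>N. \<forall>n\<ge>N. dist (X n) (abs_l2 g) < e" by blast
  qed
  then show "convergent X" by (auto simp: convergent_def)
qed

section \<open>Square integrable functions on a subset of the line\<close>

lemma square_integrable_on_set_integrable:
  assumes "square_integrable_on I f"
  shows "set_integrable lborel I (\<lambda>t. (norm (f t))\<^sup>2)"
proof -
  have "integrable lborel (\<lambda>t. (norm (indicator I t *\<^sub>R f t))\<^sup>2)"
    using assms by (simp add: square_integrable_on_def square_integrable_def)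
  moreover have "(norm (indicator I t *\<^sub>R f t))\<^sup>2 = indicator I t *\<^sub>R (norm (f t))\<^sup>2" for t
    by (simp add: indicator_def)
  ultimately show ?thesis by (simp add: set_integrable_def)
qed

lemma inner_L2_class:
  assumes "square_integrable_on I f" "square_integrable_on I g"
  shows "L2_class I f \<bullet> L2_class I g = (LBINT t:I. f t \<bullet> g t)"
proof -
  have "(indicator I t *\<^sub>R f t) \<bullet> (indicator I t *\<^sub>R g t) = indicator I t *\<^sub>R (f t \<bullet> g t)" for t
    by (simp add: indicator_def)
  then show ?thesis
    using assms by (simp only: L2_class_def inner_abs_l2 square_integrable_on_def set_lebesgue_integral_def)
qed

lemma set_integrable_inner_L2:
  assumes "square_integrable_on I f" "square_integrable_on I g"
  shows "set_integrable lborel I (\<lambda>t. f t \<bullet> g t)"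
proof -
  have "(indicator I t *\<^sub>R f t) \<bullet> (indicator I t *\<^sub>R g t) = indicator I t *\<^sub>R (f t \<bullet> g t)" for t
    by (simp add: indicator_def)
  then show ?thesis
    using square_integrable_inner[OF assms[unfolded square_integrable_on_def]]
    by (simp only: set_integrable_def)
qed

lemma L2_class_eq_iff:
  assumes "square_integrable_on I f" "square_integrable_on I g"
  shows "L2_class I f = L2_class I g \<longleftrightarrow> (AE t in lborel. t \<in> I \<longrightarrow> f t = g t)"
proof -
  have "indicator I t *\<^sub>R f t = indicator I t *\<^sub>R g t \<longleftrightarrow> (t \<in> I \<longrightarrow> f t = g t)" for t
    by (cases "t \<in> I") auto
  then show ?thesis
    using assms by (simp only: L2_class_def abs_l2_eq_iff square_integrable_on_def)
qed

lemma square_integrable_on_cong_AE: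
  assumes "square_integrable_on I f" "(\<lambda>t. indicator I t *\<^sub>R g t) \<in> borel_measurable lborel"
    "AE t in lborel. t \<in> I \<longrightarrow> f t = g t"
  shows "square_integrable_on I g"
  unfolding square_integrable_on_def square_integrable_def
proof
  have f: "integrable lborel (\<lambda>t. (norm (indicator I t *\<^sub>R f t))\<^sup>2)"
    "(\<lambda>t. indicator I t *\<^sub>R f t) \<in> borel_measurable lborel"
    using assms(1) by (auto simp: square_integrable_on_def square_integrable_def)
  have "AE t in lborel. (norm (indicator I t *\<^sub>R f t))\<^sup>2 = (norm (indicator I t *\<^sub>R g t))\<^sup>2"
    using assms(3) by eventually_elim (auto simp: indicator_def)
  then show "integrable lborel (\<lambda>t. (norm (indicator I t *\<^sub>R g t))\<^sup>2)"
  proof (rule integrable_cong_AE_imp[OF f(1), rotated])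
    show "(\<lambda>t. (norm (indicator I t *\<^sub>R g t))\<^sup>2) \<in> borel_measurable lborel"
      by (rule measurable_compose[OF assms(2)]) simp
  qed
qed (use assms in simp)

lemma mem_L2_iff: "x \<in> L2 I \<longleftrightarrow> (\<exists>f. square_integrable_on I f \<and> x = L2_class I f)"
  by (auto simp: L2_def)

lemma subspace_L2: "subspace (L2 S :: 'a::euclidean_space l2 set)"
proof (rule subspaceI)
  have "square_integrable_on S (\<lambda>t. 0 :: 'a)"
    by (simp add: square_integrable_on_def square_integrable_zero)
  moreover have "L2_class S (\<lambda>t. 0 :: 'a) = 0" by (simp add: L2_class_def zero_l2_def)
  ultimately show "(0 :: 'a l2) \<in> L2 S" unfolding mem_L2_iff by metis
  fix x y :: "'a l2" and c :: real
  assume "x \<in> L2 S"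
  then obtain f where f: "square_integrable_on S f" "x = L2_class S f" by (auto simp: mem_L2_iff)
  have "square_integrable_on S (\<lambda>t. c *\<^sub>R f t)"
    using square_integrable_scaleR[OF f(1)[unfolded square_integrable_on_def], of c]
    by (simp add: square_integrable_on_def mult.commute)
  moreover have "c *\<^sub>R x = L2_class S (\<lambda>t. c *\<^sub>R f t)"
    unfolding f(2) L2_class_def using f(1)
    by (subst scaleR_l2.abs_eq) (auto simp: l2_rel_def square_integrable_on_def mult.commute)
  ultimately show "c *\<^sub>R x \<in> L2 S" unfolding mem_L2_iff by metis
  assume "y \<in> L2 S"
  then obtain g where g: "square_integrable_on S g" "y = L2_class S g" by (auto simp: mem_L2_iff)
  have "square_integrable_on S (\<lambda>t. f t + g t)"
    using square_integrable_add[OF f(1)[unfolded square_integrable_on_def] g(1)[unfolded square_integrable_on_def]]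
    by (simp add: square_integrable_on_def scaleR_add_right)
  moreover have "x + y = L2_class S (\<lambda>t. f t + g t)"
    unfolding f(2) g(2) L2_class_def using f(1) g(1)
    by (subst plus_l2.abs_eq) (auto simp: l2_rel_def square_integrable_on_def scaleR_add_right)
  ultimately show "x + y \<in> L2 S" unfolding mem_L2_iff by metis
qed

section \<open>Smooth functions of compact support\<close>

text \<open>
  Smoothness is shown by placing a function in a class that is closed under differentiation; the
  derivatives of all orders are then found by iterating one choice of derivatives in the class.
\<close>
lemma smooth_on_closedI:
  assumes "f \<in> F"
    and "\<And>g. g \<in> F \<Longrightarrow> \<exists>g'\<in>F. \<forall>t\<in>S. (g has_vector_derivative g' t) (at t)"
  shows "smooth_on S f"
proof -
  obtain d where d: "\<And>g. g \<in> F \<Longrightarrow> d g \<in> F \<and> (\<forall>t\<in>S. (g has_vector_derivative d g t) (at t))"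
    using assms(2) by metis
  have mem: "(d ^^ k) f \<in> F" for k
    by (induction k) (use assms(1) d in auto)
  show ?thesis
    unfolding smooth_on_def
    by (intro exI[of _ "\<lambda>k. (d ^^ k) f"]) (use d mem in auto)
qed

lemma smooth_on_derivative:
  assumes "smooth_on S f"
  obtains f' where "smooth_on S f'" "\<And>t. t \<in> S \<Longrightarrow> (f has_vector_derivative f' t) (at t)"
proof -
  obtain D where D: "D 0 = f" "\<And>k t. t \<in> S \<Longrightarrow> (D k has_vector_derivative D (Suc k) t) (at t)"
    using assms unfolding smooth_on_def by blast
  have "smooth_on S (D 1)"
    unfolding smooth_on_def by (intro exI[of _ "\<lambda>k. D (Suc k)"]) (use D in auto)
  then show ?thesis using D(2)[of _ 0] by (intro that[of "D 1"]) (auto simp: D(1))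
qed

lemma smooth_on_derivative_ex:
  "smooth_on S f \<Longrightarrow> \<exists>f'. smooth_on S f' \<and> (\<forall>t\<in>S. (f has_vector_derivative f' t) (at t))"
  using smooth_on_derivative by metis

lemma smooth_on_antiderivative:
  assumes "smooth_on S f'" "\<And>t. t \<in> S \<Longrightarrow> (f has_vector_derivative f' t) (at t)"
  shows "smooth_on S f"
proof (rule smooth_on_closedI[of _ "insert f {g. smooth_on S g}"])
  fix g assume "g \<in> insert f {g. smooth_on S g}"
  then show "\<exists>g'\<in>insert f {g. smooth_on S g}. \<forall>t\<in>S. (g has_vector_derivative g' t) (at t)"
    using assms smooth_on_derivative_ex[of S g] by blast
qed simp

lemma smooth_on_add:
  assumes "smooth_on S f" "smooth_on S g"
  shows "smooth_on S (\<lambda>t. f t + g t)"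
proof (rule smooth_on_closedI[of _ "{\<lambda>t. f t + g t |f g. smooth_on S f \<and> smooth_on S g}"])
  fix h assume "h \<in> {\<lambda>t. f t + g t |f g. smooth_on S f \<and> smooth_on S g}"
  then obtain f g where h: "h = (\<lambda>t. f t + g t)" "smooth_on S f" "smooth_on S g" by blast
  obtain f' where "smooth_on S f'" "\<And>t. t \<in> S \<Longrightarrow> (f has_vector_derivative f' t) (at t)"
    using smooth_on_derivative[OF h(2)] by blast
  moreover obtain g' where "smooth_on S g'" "\<And>t. t \<in> S \<Longrightarrow> (g has_vector_derivative g' t) (at t)"
    using smooth_on_derivative[OF h(3)] by blast
  ultimately show "\<exists>h'\<in>{\<lambda>t. f t + g t |f g. smooth_on S f \<and> smooth_on S g}.
      \<forall>t\<in>S. (h has_vector_derivative h' t) (at t)"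
    by (intro bexI[of _ "\<lambda>t. f' t + g' t"]) (auto simp: h(1) intro!: has_vector_derivative_add)
qed (use assms in blast)

lemma sum_lessThan_add:
  "(\<Sum>i<n + m. h i) = (\<Sum>i<n. h i) + (\<Sum>i<m. h (n + i :: nat) :: 'a::comm_monoid_add)"
  by (induction m) (simp_all add: add.assoc)

text \<open>Sums of products are closed under differentiation, by the Leibniz rule.\<close>

lemma smooth_on_scaleR:
  assumes "smooth_on S f" "smooth_on S g"
  shows "smooth_on S (\<lambda>t. f t *\<^sub>R g t)"
proof (rule smooth_on_closedI)
  let ?F = "{\<lambda>t. \<Sum>i<n. f i t *\<^sub>R g i t |n f g.
    (\<forall>i<n::nat. smooth_on S (f i :: real \<Rightarrow> real)) \<and> (\<forall>i<n. smooth_on S (g i :: real \<Rightarrow> 'a))}"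
  show "(\<lambda>t. f t *\<^sub>R g t) \<in> ?F"
    by (rule CollectI, rule exI[of _ 1], rule exI[of _ "\<lambda>_. f"], rule exI[of _ "\<lambda>_. g"])
      (use assms in auto)
  fix h assume "h \<in> ?F"
  then obtain n :: nat and f :: "nat \<Rightarrow> real \<Rightarrow> real" and g :: "nat \<Rightarrow> real \<Rightarrow> 'a"
    where h: "h = (\<lambda>t. \<Sum>i<n. f i t *\<^sub>R g i t)"
      "\<And>i. i < n \<Longrightarrow> smooth_on S (f i)" "\<And>i. i < n \<Longrightarrow> smooth_on S (g i)"
    by blast
  obtain f' where f': "\<And>i. i < n \<Longrightarrow> smooth_on S (f' i)"
    "\<And>i t. i < n \<Longrightarrow> t \<in> S \<Longrightarrow> (f i has_vector_derivative f' i t) (at t)"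
    using smooth_on_derivative_ex[OF h(2)] by metis
  obtain g' where g': "\<And>i. i < n \<Longrightarrow> smooth_on S (g' i)"
    "\<And>i t. i < n \<Longrightarrow> t \<in> S \<Longrightarrow> (g i has_vector_derivative g' i t) (at t)"
    using smooth_on_derivative_ex[OF h(3)] by metis
  define F where "F i = (if i < n then f i else f' (i - n))" for i
  define G where "G i = (if i < n then g' i else g (i - n))" for i
  have "(\<Sum>i<n + n. F i t *\<^sub>R G i t) = (\<Sum>i<n. f i t *\<^sub>R g' i t + f' i t *\<^sub>R g i t)" for t
  proof -
    have "(\<Sum>i<n + n. F i t *\<^sub>R G i t) = (\<Sum>i<n. F i t *\<^sub>R G i t) + (\<Sum>i<n. F (n + i) t *\<^sub>R G (n + i) t)"
      using sum_lessThan_add .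
    then show ?thesis by (simp add: F_def G_def sum.distrib)
  qed
  then have der: "(h has_vector_derivative (\<Sum>i<n + n. F i t *\<^sub>R G i t)) (at t)" if "t \<in> S" for t
    unfolding h(1) using f' g' that
    by (auto intro!: derivative_eq_intros has_vector_derivative_sum has_vector_derivative_scaleR
        simp: has_real_derivative_iff_has_vector_derivative)
  have "(\<lambda>t. \<Sum>i<n + n. F i t *\<^sub>R G i t) \<in> ?F"
    by (rule CollectI, rule exI[of _ "n + n"], rule exI[of _ F], rule exI[of _ G])
      (use f' g' h in \<open>auto simp: F_def G_def\<close>)
  then show "\<exists>h'\<in>?F. \<forall>t\<in>S. (h has_vector_derivative h' t) (at t)"
    by (rule bexI[rotated]) (use der in simp)
qed

lemma smooth_on_const: "smooth_on S (\<lambda>t. c)"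
  unfolding smooth_on_def
proof (intro exI[of _ "\<lambda>k t. if k = 0 then c else 0"] conjI allI ballI)
  fix k :: nat and t
  show "((\<lambda>t. if k = 0 then c else 0) has_vector_derivative (if Suc k = 0 then c else 0)) (at t)"
    using has_vector_derivative_const by auto
qed auto

lemma smooth_on_affine_reparam:
  assumes "smooth_on UNIV f"
  shows "smooth_on UNIV (\<lambda>t. f (m * t + c))"
proof (rule smooth_on_closedI)
  let ?F = "{\<lambda>t. r *\<^sub>R f (m * t + c) |r f. smooth_on UNIV (f :: real \<Rightarrow> 'a)}"
  show "(\<lambda>t. f (m * t + c)) \<in> ?F"
    by (rule CollectI, rule exI[of _ 1], rule exI[of _ f]) (use assms in auto)
  fix h assume "h \<in> ?F"
  then obtain r f where h: "h = (\<lambda>t. r *\<^sub>R f (m * t + c))" "smooth_on UNIV (f :: real \<Rightarrow> 'a)" by blast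
  obtain f' where f': "smooth_on UNIV f'" "\<And>t. (f has_vector_derivative f' t) (at t)"
    using smooth_on_derivative_ex[OF h(2)] by auto
  have "(h has_vector_derivative (r * m) *\<^sub>R f' (m * t + c)) (at t)" for t
  proof -
    have "((\<lambda>t. m * t + c) has_vector_derivative m) (at t)"
      by (auto intro!: derivative_eq_intros simp: has_real_derivative_iff_has_vector_derivative[symmetric])
    from vector_diff_chain_at[OF this f'(2)]
    have "((\<lambda>t. f (m * t + c)) has_vector_derivative m *\<^sub>R f' (m * t + c)) (at t)"
      by (simp add: o_def)
    from bounded_linear.has_vector_derivative[OF bounded_linear_scaleR_right this, of r]
    show ?thesis by (simp add: h(1))
  qed
  then show "\<exists>h'\<in>?F. \<forall>t\<in>UNIV. (h has_vector_derivative h' t) (at t)"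
    using f'(1) by (intro bexI[of _ "\<lambda>t. (r * m) *\<^sub>R f' (m * t + c)"]) auto
qed

text \<open>
  The standard smooth function that vanishes on a half line.  It tends to \<open>1\<close> at infinity, so its
  dilations \<open>exp_step (i t)\<close> tend to the Heaviside function.
\<close>
definition exp_step :: "real \<Rightarrow> real" where
  "exp_step t = (if t > 0 then exp (- (1 / t)) else 0)"

text \<open>
  On the right half line every derivative of \<open>exp_step\<close> has the form \<open>p (1 / t) * exp (- 1 / t)\<close>
  with a polynomial \<open>p\<close>; such a function is extended differentiably by zero, since the
  exponential dominates all powers of \<open>1 / t\<close>.
\<close>
lemma smooth_on_exp_step: "smooth_on UNIV exp_step"
proof (rule smooth_on_closedI)
  let ?F = "{\<lambda>t. if t > 0 then poly p (1 / t) * exp (- (1 / t)) else 0 |p :: real poly. True}"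
  show "exp_step \<in> ?F"
    by (rule CollectI, rule exI[of _ 1]) (auto simp: exp_step_def)
  fix g assume "g \<in> ?F"
  then obtain p :: "real poly" where g: "g = (\<lambda>t. if t > 0 then poly p (1 / t) * exp (- (1 / t)) else 0)"
    by blast
  define q where "q = [:0, 0, 1:] * (p - pderiv p)"
  have lim: "((\<lambda>x. poly r x * exp (- x)) \<longlongrightarrow> 0) at_top" for r :: "real poly"
  proof -
    have "((\<lambda>x. \<Sum>i\<le>degree r. coeff r i * (x ^ i / exp x)) \<longlongrightarrow> (\<Sum>i\<le>degree r. coeff r i * 0)) at_top"
      by (intro tendsto_intros tendsto_power_div_exp_0)
    then show ?thesis
      by (simp add: poly_altdef sum_distrib_right exp_minus divide_inverse mult.assoc)
  qed
  have "(g has_real_derivative (if t > 0 then poly q (1 / t) * exp (- (1 / t)) else 0)) (at t)" for t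
  proof (cases t "0 :: real" rule: linorder_cases)
    case greater
    have "((\<lambda>t. poly p (1 / t) * exp (- (1 / t))) has_real_derivative
        poly q (1 / t) * exp (- (1 / t))) (at t)"
      using greater by (auto intro!: derivative_eq_intros poly_DERIV[THEN DERIV_chain2]
          simp: q_def field_simps power2_eq_square)
    moreover have "\<forall>\<^sub>F s in nhds t. g s = poly p (1 / s) * exp (- (1 / s))"
      using eventually_nhds_in_open[of "{0<..}" t] greater by (auto simp: g elim!: eventually_mono)
    ultimately show ?thesis using greater DERIV_cong_ev[OF refl _ refl] by fastforce
  next
    case less
    have "\<forall>\<^sub>F s in nhds t. g s = 0"
      using eventually_nhds_in_open[of "{..<0}" t] less by (auto simp: g elim!: eventually_mono)
    then show ?thesis using less DERIV_cong_ev[OF refl, of g "\<lambda>_. 0" t 0 0] by auto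
  next
    case equal
    have "((\<lambda>h. g h / h) \<longlongrightarrow> 0) (at_right 0)"
    proof -
      have "((\<lambda>h. poly (pCons 0 p) (inverse h) * exp (- inverse h)) \<longlongrightarrow> 0) (at_right 0)"
        by (rule filterlim_compose[OF lim filterlim_inverse_at_top_right])
      moreover have "\<forall>\<^sub>F h in at_right 0. poly (pCons 0 p) (inverse h) * exp (- inverse h) = g h / h"
        using eventually_at_right_less[of "0::real"]
        by eventually_elim (simp add: g field_simps inverse_eq_divide)
      ultimately show ?thesis by (simp add: filterlim_cong[OF refl refl])
    qed
    moreover have "((\<lambda>h. g h / h) \<longlongrightarrow> 0) (at_left 0)"
      using eventually_at_left_real[of "-1" "0::real"]
      by (intro tendsto_eventually) (auto simp: g elim!: eventually_mono)
    ultimately have "((\<lambda>h. g h / h) \<longlongrightarrow> 0) (at 0)" by (simp add: filterlim_split_at)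
    then show ?thesis using equal by (simp add: DERIV_def) (simp add: g)
  qed
  then show "\<exists>g'\<in>?F. \<forall>t\<in>UNIV. (g has_vector_derivative g' t) (at t)"
    by (intro bexI[of _ "\<lambda>t. if t > 0 then poly q (1 / t) * exp (- (1 / t)) else 0"])
      (auto simp: has_real_derivative_iff_has_vector_derivative)
qed

lemma exp_step_bounds: "0 \<le> exp_step t" "exp_step t \<le> 1"
  by (auto simp: exp_step_def)

lemma exp_step_scaled_tendsto:
  "(\<lambda>i. exp_step (real i * t)) \<longlonglongrightarrow> (if t > 0 then 1 else 0)"
proof (cases "t > 0")
  case True
  have "(\<lambda>i. exp (- (inverse t * inverse (real i)))) \<longlonglongrightarrow> exp (- (inverse t * 0))"
    by (intro tendsto_intros lim_inverse_n)
  moreover have "\<forall>\<^sub>F i in sequentially. exp (- (inverse t * inverse (real i))) = exp_step (real i * t)"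
    using eventually_gt_at_top[of 0]
    by eventually_elim (use True in \<open>simp add: exp_step_def inverse_eq_divide mult.commute\<close>)
  ultimately show ?thesis using True by (simp add: filterlim_cong[OF refl refl])
next
  case False
  then have "exp_step (real i * t) = 0" for i
    by (simp add: exp_step_def not_less mult_le_0_iff zero_less_mult_iff)
  then show ?thesis using False by simp
qed

text \<open>
  The support lies in the interior of a compact interval contained in \<open>I\<close>, so that the function and its
  derivatives vanish at both ends of that interval.
\<close>
definition smooth_compact :: "real set \<Rightarrow> (real \<Rightarrow> real) set" where
  "smooth_compact I = {\<phi>. smooth_on UNIV \<phi> \<and>
     (\<exists>c d. c < d \<and> {c..d} \<subseteq> I \<and> (\<forall>t. t \<notin> {c<..<d} \<longrightarrow> \<phi> t = 0))}"

lemma smooth_compactE: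
  assumes "\<phi> \<in> smooth_compact I"
  obtains c d where "smooth_on UNIV \<phi>" "c < d" "{c..d} \<subseteq> I" "\<And>t. t \<notin> {c<..<d} \<Longrightarrow> \<phi> t = 0"
  using assms unfolding smooth_compact_def by blast

text \<open>
  Bounded by \<open>1\<close>, supported between \<open>x\<close> and \<open>y\<close> and convergent to the indicator function of the open
  interval as \<open>i\<close> tends to infinity.
\<close>
definition bump :: "real \<Rightarrow> real \<Rightarrow> nat \<Rightarrow> real \<Rightarrow> real" where
  "bump x y i t = exp_step (real i * (t - x)) * exp_step (real i * (y - t))"

lemma smooth_on_bump: "smooth_on UNIV (bump x y i)"
proof -
  have "smooth_on UNIV (\<lambda>t. exp_step (real i * t + - (real i * x)) *\<^sub>R exp_step ((- real i) * t + real i * y))"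
    by (intro smooth_on_scaleR smooth_on_affine_reparam smooth_on_exp_step)
  then show ?thesis by (simp add: bump_def[abs_def] algebra_simps)
qed

lemma bump_support: "t \<notin> {x<..<y} \<Longrightarrow> bump x y i t = 0"
  by (auto simp: bump_def exp_step_def zero_less_mult_iff)

lemma bump_in_smooth_compact:
  assumes "x < y" "{x..y} \<subseteq> I"
  shows "bump x y i \<in> smooth_compact I"
  unfolding smooth_compact_def using assms smooth_on_bump bump_support by blast

lemma bump_bounds: "0 \<le> bump x y i t" "bump x y i t \<le> 1"
  by (auto simp: bump_def exp_step_bounds mult_le_one)

lemma bump_tendsto: "(\<lambda>i. bump x y i t) \<longlonglongrightarrow> indicator {x<..<y} t"
proof -
  have "(\<lambda>i. bump x y i t) \<longlonglongrightarrow> (if t - x > 0 then 1 else 0) * (if y - t > 0 then 1 else 0)"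
    unfolding bump_def by (intro tendsto_mult exp_step_scaled_tendsto)
  then show ?thesis by (simp add: indicator_def split: if_splits)
qed

section \<open>Weak derivatives on an open interval\<close>

definition locally_integrable_on :: "real set \<Rightarrow> (real \<Rightarrow> 'a::euclidean_space) \<Rightarrow> bool" where
  "locally_integrable_on I f \<longleftrightarrow> (\<forall>c d. {c..d} \<subseteq> I \<longrightarrow> set_integrable lborel {c..d} f)"

lemma locally_integrable_on_continuous:
  "continuous_on I f \<Longrightarrow> locally_integrable_on I f"
  unfolding locally_integrable_on_def
  by (auto intro!: borel_integrable_atLeastAtMost' elim: continuous_on_subset)

lemma locally_integrable_on_subset:
  "locally_integrable_on I f \<Longrightarrow> {c..d} \<subseteq> I \<Longrightarrow> S \<subseteq> {c..d} \<Longrightarrow> S \<in> sets borel \<Longrightarrow>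
    set_integrable lborel S f"
  by (rule set_integrable_subset[of _ "{c..d}"]) (auto simp: locally_integrable_on_def)

lemma locally_integrable_on_add:
  "locally_integrable_on I f \<Longrightarrow> locally_integrable_on I g \<Longrightarrow> locally_integrable_on I (\<lambda>t. f t + g t)"
  by (simp add: locally_integrable_on_def)

lemma locally_integrable_on_diff:
  "locally_integrable_on I f \<Longrightarrow> locally_integrable_on I g \<Longrightarrow> locally_integrable_on I (\<lambda>t. f t - g t)"
  by (simp add: locally_integrable_on_def)

text \<open>
  The Borel sets over which \<open>f\<close> integrates to zero are closed under complements and disjoint unions
  and contain the intervals, hence they are all Borel sets.
\<close>
lemma integrable_lborel_AE_zero:
  fixes f :: "real \<Rightarrow> 'a::euclidean_space"
  assumes f: "integrable lborel f"
    and zero: "\<And>x y. x \<le> y \<Longrightarrow> set_lebesgue_integral lborel {x..y} f = 0"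
  shows "AE t in lborel. f t = 0"
proof (rule sigma_finite_measure.density_zero[OF sigma_finite_lborel f])
  have si: "set_integrable lborel A f" if "A \<in> sets borel" for A :: "real set"
    using f that unfolding set_integrable_def by (intro integrable_mult_indicator) auto
  have univ: "set_lebesgue_integral lborel UNIV f = 0"
  proof -
    have "(\<lambda>i. set_lebesgue_integral lborel {- real i..real i} f)
        \<longlonglongrightarrow> set_lebesgue_integral lborel (\<Union>i. {- real i..real i}) f"
      by (intro set_integral_cont_up) (auto simp: incseq_def intro!: si)
    moreover have "(\<Union>i. {- real i..real i}) = UNIV"
    proof -
      have "\<exists>i. - real i \<le> x \<and> x \<le> real i" for x
        using real_arch_simple[of "\<bar>x\<bar>"] by (metis abs_le_iff minus_le_iff) 
      then show ?thesis by auto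
    qed
    ultimately show ?thesis using zero by (simp add: LIMSEQ_const_iff)
  qed
  fix A :: "real set" assume "A \<in> sets lborel"
  then have "A \<in> sets borel" by simp
  then show "set_lebesgue_integral lborel A f = 0"
  proof (induction rule: borel_set_induct)
    case (interval a b)
    then show ?case using zero by simp
  next
    case (compl A)
    have "set_lebesgue_integral lborel (A \<union> - A) f
        = set_lebesgue_integral lborel A f + set_lebesgue_integral lborel (- A) f"
      using compl by (intro set_integral_Un) (auto intro!: si)
    then show ?case using compl univ by simp
  next
    case (union A)
    have "set_lebesgue_integral lborel (\<Union>i. A i) f = (\<Sum>i. set_lebesgue_integral lborel (A i) f)"
      using union by (intro lebesgue_integral_countable_add) (auto simp: disjoint_family_on_def intro!: si)
    then show ?case using union by simp
  qed (simp add: set_lebesgue_integral_def)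
qed

lemma integral_support:
  fixes \<phi> :: "real \<Rightarrow> real" and f :: "real \<Rightarrow> 'a::euclidean_space"
  assumes "\<And>t. t \<notin> {c..d} \<Longrightarrow> \<phi> t = 0"
  shows "(\<lambda>t. \<phi> t *\<^sub>R f t) = (\<lambda>t. \<phi> t *\<^sub>R (indicator {c..d} t *\<^sub>R f t))"
  using assms by (intro ext) (auto simp: indicator_def)

lemma integrable_test_function:
  assumes "locally_integrable_on I f" "continuous_on UNIV \<phi>" "{c..d} \<subseteq> I"
    and "\<And>t. t \<notin> {c..d} \<Longrightarrow> \<phi> t = (0::real)"
  shows "integrable lborel (\<lambda>t. \<phi> t *\<^sub>R f t)"
proof -
  have f: "integrable lborel (\<lambda>t. indicator {c..d} t *\<^sub>R f t)"
    using assms(1,3) by (simp add: locally_integrable_on_def set_integrable_def)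
  obtain C where C: "\<And>t. t \<in> {c..d} \<Longrightarrow> \<bar>\<phi> t\<bar> \<le> C"
  proof -
    have "bounded (\<phi> ` {c..d})"
      using assms(2) by (intro compact_imp_bounded compact_continuous_image) (auto intro: continuous_on_subset)
    then show ?thesis using that by (metis bounded_iff image_eqI real_norm_def)
  qed
  have "integrable lborel (\<lambda>t. \<phi> t *\<^sub>R (indicator {c..d} t *\<^sub>R f t))"
  proof (rule Bochner_Integration.integrable_bound)
    show "integrable lborel (\<lambda>t. C *\<^sub>R (indicator {c..d} t *\<^sub>R f t))"
      by (rule Bochner_Integration.integrable_scaleR_right[OF f])
    have "\<phi> \<in> borel_measurable lborel" using assms(2) by (simp add: borel_measurable_continuous_onI)
    then show "(\<lambda>t. \<phi> t *\<^sub>R (indicator {c..d} t *\<^sub>R f t)) \<in> borel_measurable lborel"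
      by (rule borel_measurable_scaleR[OF _ borel_measurable_integrable[OF f]])
    show "AE t in lborel. norm (\<phi> t *\<^sub>R (indicator {c..d} t *\<^sub>R f t)) \<le> norm (C *\<^sub>R (indicator {c..d} t *\<^sub>R f t))"
      using C by (intro AE_I2) (force simp: indicator_def intro!: mult_right_mono)
  qed
  then show ?thesis by (subst integral_support[OF assms(4)])
qed

lemma smooth_on_UNIV_continuous:
  "smooth_on UNIV f \<Longrightarrow> continuous_on UNIV f"
  by (metis smooth_on_derivative UNIV_I continuous_at_imp_continuous_on has_vector_derivative_continuous)

lemma smooth_compact_integrable:
  assumes "locally_integrable_on I f" "\<phi> \<in> smooth_compact I"
  shows "integrable lborel (\<lambda>t. \<phi> t *\<^sub>R f t)"
proof -
  obtain c d where *: "smooth_on UNIV \<phi>" "c < d" "{c..d} \<subseteq> I" "\<And>t. t \<notin> {c<..<d} \<Longrightarrow> \<phi> t = 0"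
    using smooth_compactE[OF assms(2)] by metis
  show ?thesis
    by (rule integrable_test_function[OF assms(1) smooth_on_UNIV_continuous[OF *(1)] *(3)])
      (use *(4) in auto)
qed

lemma smooth_compact_derivative:
  assumes "\<phi> \<in> smooth_compact I"
  obtains \<phi>' where "\<phi>' \<in> smooth_compact I" "\<And>t. (\<phi> has_vector_derivative \<phi>' t) (at t)"
    "\<And>t. \<phi>' t = vector_derivative \<phi> (at t)"
    "\<And>c d. c < d \<Longrightarrow> (\<And>t. t \<notin> {c<..<d} \<Longrightarrow> \<phi> t = 0) \<Longrightarrow> (\<And>t. t \<notin> {c<..<d} \<Longrightarrow> \<phi>' t = 0)"
proof -
  obtain c d where *: "smooth_on UNIV \<phi>" "c < d" "{c..d} \<subseteq> I" "\<And>t. t \<notin> {c<..<d} \<Longrightarrow> \<phi> t = 0"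
    using smooth_compactE[OF assms] by metis
  obtain \<phi>' where \<phi>': "smooth_on UNIV \<phi>'" "\<And>t. (\<phi> has_vector_derivative \<phi>' t) (at t)"
    using smooth_on_derivative_ex[OF *(1)] by auto
  have supp: "\<phi>' t = 0" if cd: "c < d" and z: "\<And>t. t \<notin> {c<..<d} \<Longrightarrow> \<phi> t = 0" and t: "t \<notin> {c<..<d}"
    for c d t
  proof -
    define x where "x = (if t \<le> c then t - 1 else t)"
    have z': "\<phi> s = 0" if "s \<in> {x..x + 1}" for s
      using that t cd by (intro z) (auto simp: x_def split: if_splits)
    have t: "t \<in> {x..x + 1}" by (simp add: x_def)
    have "(\<phi> has_vector_derivative \<phi>' t) (at t within {x..x + 1})"
      using \<phi>'(2) by (rule has_vector_derivative_at_within)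
    then have "((\<lambda>s. 0) has_vector_derivative \<phi>' t) (at t within {x..x + 1})"
      using has_vector_derivative_transform[OF t, of "\<lambda>s. 0" \<phi>] z' by auto
    then show ?thesis
      using vector_derivative_unique_within_closed_interval[of x "x + 1" t "\<lambda>s. 0" "\<phi>' t" 0] t
        has_vector_derivative_const[of 0 "at t within {x..x + 1}"] by simp
  qed
  have "\<phi>' \<in> smooth_compact I"
    unfolding smooth_compact_def using \<phi>'(1) * supp[OF *(2,4)] by blast
  then show ?thesis
    using \<phi>'(2) supp vector_derivative_at[OF \<phi>'(2)] that by metis
qed

lemma smooth_compact_diff_scale:
  assumes "\<phi> \<in> smooth_compact I" "\<psi> \<in> smooth_compact I" "is_interval I"
  shows "(\<lambda>t. \<phi> t - r * \<psi> t) \<in> smooth_compact I"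
proof -
  obtain c d where 1: "smooth_on UNIV \<phi>" "c < d" "{c..d} \<subseteq> I" "\<And>t. t \<notin> {c<..<d} \<Longrightarrow> \<phi> t = 0"
    using smooth_compactE[OF assms(1)] by metis
  obtain c' d' where 2: "smooth_on UNIV \<psi>" "c' < d'" "{c'..d'} \<subseteq> I" "\<And>t. t \<notin> {c'<..<d'} \<Longrightarrow> \<psi> t = 0"
    using smooth_compactE[OF assms(2)] by metis
  have "smooth_on UNIV (\<lambda>t. \<phi> t + (- r) *\<^sub>R \<psi> t)"
    by (intro smooth_on_add smooth_on_scaleR smooth_on_const 1 2)
  moreover have "{min c c'..max d d'} \<subseteq> I"
  proof
    fix t assume t: "t \<in> {min c c'..max d d'}"
    have "min c c' \<in> I" "max d d' \<in> I" using 1 2 by (auto simp: min_def max_def)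
    then show "t \<in> I" by (rule mem_is_interval_1_I[OF assms(3)]) (use t in auto)
  qed
  moreover have "min c c' < max d d'" using 1 by auto
  moreover have "\<phi> t - r * \<psi> t = 0" if "t \<notin> {min c c'<..<max d d'}" for t
    using 1(4)[of t] 2(4)[of t] that by (auto simp: min_less_iff_conj less_max_iff_disj min_def max_def split: if_splits)
  ultimately show ?thesis unfolding smooth_compact_def by simp blast
qed

text \<open>
  The bumps tend boundedly to the indicator function of an interval, so by dominated convergence
  the integral of \<open>f\<close> over every interval vanishes.
\<close>
lemma fundamental_lemma:
  assumes f: "locally_integrable_on I f" and I: "open I"
    and zero: "\<And>\<phi>. \<phi> \<in> smooth_compact I \<Longrightarrow> (LBINT t. \<phi> t *\<^sub>R f t) = 0"
  shows "AE t in lborel. t \<in> I \<longrightarrow> f t = 0"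
proof -
  have meas: "(\<lambda>t. indicator S t *\<^sub>R f t) \<in> borel_measurable lborel"
    if "{x..y} \<subseteq> I" "S \<subseteq> {x..y}" "S \<in> sets borel" for x y S
    using locally_integrable_on_subset[OF f that] unfolding set_integrable_def
    by (rule borel_measurable_integrable)
  have open_zero: "(LBINT t. indicator {x<..<y} t *\<^sub>R f t) = 0" if xy: "x < y" "{x..y} \<subseteq> I" for x y
  proof -
    have "(\<lambda>i. LBINT t. bump x y i t *\<^sub>R f t) \<longlonglongrightarrow> (LBINT t. indicator {x<..<y} t *\<^sub>R f t)"
    proof (rule integral_dominated_convergence[where w = "\<lambda>t. norm (indicator {x..y} t *\<^sub>R f t)"])
      have fi: "integrable lborel (\<lambda>t. indicator {x..y} t *\<^sub>R f t)"
        using f xy by (simp add: locally_integrable_on_def set_integrable_def)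
      show "integrable lborel (\<lambda>t. norm (indicator {x..y} t *\<^sub>R f t))"
        by (rule integrable_norm[OF fi])
      show "(\<lambda>t. bump x y i t *\<^sub>R f t) \<in> borel_measurable lborel" for i
        using smooth_compact_integrable[OF f bump_in_smooth_compact[OF xy]] by auto
      show "(\<lambda>t. indicator {x<..<y} t *\<^sub>R f t) \<in> borel_measurable lborel"
        by (rule meas[OF xy(2)]) auto
      show "AE t in lborel. (\<lambda>i. bump x y i t *\<^sub>R f t) \<longlonglongrightarrow> indicator {x<..<y} t *\<^sub>R f t"
        by (intro AE_I2 tendsto_intros bump_tendsto)
      show "AE t in lborel. norm (bump x y i t *\<^sub>R f t) \<le> norm (indicator {x..y} t *\<^sub>R f t)" for i
      proof (intro AE_I2)
        fix t
        show "norm (bump x y i t *\<^sub>R f t) \<le> norm (indicator {x..y} t *\<^sub>R f t)"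
          using bump_bounds[of x y i t] bump_support[of t x y i]
          by (cases "t \<in> {x..y}") (auto intro: mult_left_le_one_le)
      qed
    qed
    moreover have "(LBINT t. bump x y i t *\<^sub>R f t) = 0" for i
      by (rule zero[OF bump_in_smooth_compact[OF xy]])
    ultimately show ?thesis by (simp add: LIMSEQ_const_iff)
  qed
  have closed_zero: "(LBINT t. indicator {x..y} t *\<^sub>R f t) = 0" if xy: "{x..y} \<subseteq> I" for x y
  proof (cases "x < y")
    case True
    have "(LBINT t. indicator {x..y} t *\<^sub>R f t) = (LBINT t. indicator {x<..<y} t *\<^sub>R f t)"
    proof (rule integral_cong_AE)
      show "(\<lambda>t. indicator {x..y} t *\<^sub>R f t) \<in> borel_measurable lborel"
        "(\<lambda>t. indicator {x<..<y} t *\<^sub>R f t) \<in> borel_measurable lborel"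
        by (rule meas[OF xy]; auto)+
      show "AE t in lborel. indicator {x..y} t *\<^sub>R f t = indicator {x<..<y} t *\<^sub>R f t"
        using AE_lborel_singleton[of x] AE_lborel_singleton[of y]
        by eventually_elim (auto simp: indicator_def)
    qed
    then show ?thesis using open_zero[OF True xy] by simp
  next
    case False
    have "(LBINT t. indicator {x..y} t *\<^sub>R f t) = integral\<^sup>L lborel (\<lambda>t::real. 0)"
    proof (rule integral_cong_AE)
      show "(\<lambda>t. indicator {x..y} t *\<^sub>R f t) \<in> borel_measurable lborel"
        by (rule meas[OF xy]) auto
      show "AE t in lborel. indicator {x..y} t *\<^sub>R f t = 0"
        using AE_lborel_singleton[of x] by eventually_elim (use False in \<open>auto simp: indicator_def\<close>)
    qed simp
    then show ?thesis by simp
  qed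
  have cell: "AE t in lborel. t \<in> {x..y} \<longrightarrow> f t = 0" if xy: "{x..y} \<subseteq> I" for x y
  proof -
    have "AE t in lborel. indicator {x..y} t *\<^sub>R f t = 0"
    proof (rule integrable_lborel_AE_zero)
      show "integrable lborel (\<lambda>t. indicator {x..y} t *\<^sub>R f t)"
        using f xy by (simp add: locally_integrable_on_def set_integrable_def)
      fix u v :: real
      have "indicator {u..v} t *\<^sub>R indicator {x..y} t *\<^sub>R f t = indicator {max u x..min v y} t *\<^sub>R f t" for t
        by (auto simp: indicator_def)
      moreover have "{max u x..min v y} \<subseteq> I" using xy by auto
      ultimately show "set_lebesgue_integral lborel {u..v} (\<lambda>t. indicator {x..y} t *\<^sub>R f t) = 0"
        unfolding set_lebesgue_integral_def by (simp only: closed_zero)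
    qed
    then show ?thesis by eventually_elim (auto simp: indicator_def)
  qed
  have "AE t in lborel. \<forall>p\<in>{p::rat \<times> rat. {of_rat (fst p)..of_rat (snd p)} \<subseteq> I}.
      t \<in> {of_rat (fst p)..of_rat (snd p)} \<longrightarrow> f t = 0"
    by (subst AE_ball_countable) (use cell in blast)+
  then show ?thesis
  proof eventually_elim
    case (elim t)
    show ?case
    proof
      assume "t \<in> I"
      then obtain e where e: "e > 0" "ball t e \<subseteq> I" using I by (auto simp: open_contains_ball)
      obtain p where p: "t - e < of_rat p" "of_rat p < t" using of_rat_dense[of "t - e" t] e by auto
      obtain q where q: "t < of_rat q" "of_rat q < t + e" using of_rat_dense[of t "t + e"] e by auto
      have "{of_rat p..of_rat q} \<subseteq> ball t e" using p q by (auto simp: dist_real_def)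
      then have "(p, q) \<in> {p. {of_rat (fst p)..of_rat (snd p)} \<subseteq> I}" using e by auto
      then show "f t = 0" using elim p q by force
    qed
  qed
qed

text \<open>
  Absolutely continuous functions with almost everywhere derivative \<open>f\<close>, described by differences so
  that no base point enters.
\<close>
definition primitive_on :: "real set \<Rightarrow> (real \<Rightarrow> 'a::euclidean_space) \<Rightarrow> (real \<Rightarrow> 'a) \<Rightarrow> bool" where
  "primitive_on I F f \<longleftrightarrow> continuous_on I F \<and>
     (\<forall>x y. x \<le> y \<longrightarrow> {x..y} \<subseteq> I \<longrightarrow> F y - F x = (LBINT t:{x..y}. f t))"

lemma primitive_onD:
  "primitive_on I F f \<Longrightarrow> x \<le> y \<Longrightarrow> {x..y} \<subseteq> I \<Longrightarrow> F y - F x = (LBINT t:{x..y}. f t)"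
  by (simp add: primitive_on_def)

lemma exists_primitive:
  assumes f: "locally_integrable_on I f" and I: "open I" "is_interval I"
  obtains F where "primitive_on I F f"
proof (cases "I = {}")
  case True
  then show ?thesis by (intro that[of f]) (auto simp: primitive_on_def)
next
  case False
  then obtain c where c: "c \<in> I" by auto
  define F where "F s = (LBINT t=c..s. f t)" for s :: real
  have sub: "{x..y} \<subseteq> I" if "x \<in> I" "y \<in> I" for x y
    using that mem_is_interval_1_I[OF I(2), of x y] by auto
  have F: "F y - F x = (LBINT t:{x..y}. f t)" if "x \<le> y" "x \<in> I" "y \<in> I" for x y
  proof -
    have "{min c x..max c y} \<subseteq> I" using that c by (intro sub) (auto simp: min_def max_def)
    then have "set_integrable lborel {min c x<..<max c y} f"
      by (intro locally_integrable_on_subset[OF f, of "min c x" "max c y"]) auto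
    moreover have "min c (min x y) = min c x" "max c (max x y) = max c y" using that by auto
    moreover have "min c x \<le> max c y" by auto
    ultimately have "interval_lebesgue_integrable lborel
        (min (ereal c) (min (ereal x) (ereal y))) (max (ereal c) (max (ereal x) (ereal y))) f"
      by (simp add: interval_lebesgue_integrable_def flip: ereal_min ereal_max)
    from interval_integral_sum[OF this] show ?thesis
      using interval_integral_Icc[OF \<open>x \<le> y\<close>, of f] by (simp add: F_def algebra_simps)
  qed
  have "isCont F t" if "t \<in> I" for t
  proof -
    obtain e where e: "e > 0" "cball t e \<subseteq> I" using I(1) \<open>t \<in> I\<close> by (auto simp: open_contains_cball)
    then have te: "{t - e..t + e} \<subseteq> I" "t - e \<in> I" by (auto simp: cball_eq_atLeastAtMost)
    have int: "f integrable_on {t - e..t + e}"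
      using f te(1) by (auto simp: locally_integrable_on_def intro: set_borel_integral_eq_integral)
    have eq: "F s = F (t - e) + integral {t - e..s} f" if s: "s \<in> {t - e..t + e}" for s
    proof -
      have "set_integrable lborel {t - e..s} f"
        using s te(1) by (intro locally_integrable_on_subset[OF f te(1)]) auto
      then show ?thesis
        using F[of "t - e" s] s te by (auto simp: set_borel_integral_eq_integral(2) algebra_simps)
    qed
    have "continuous_on {t - e..t + e} (\<lambda>s. F (t - e) + integral {t - e..s} f)"
      by (intro continuous_intros indefinite_integral_continuous_1 int)
    then have "continuous_on {t - e..t + e} F" by (rule continuous_on_eq) (rule eq[symmetric])
    then show ?thesis
      using e(1) by (intro continuous_on_interior) auto
  qed
  then have "continuous_on I F" by (intro continuous_at_imp_continuous_on) auto
  moreover have "x \<in> I \<and> y \<in> I" if "x \<le> y" "{x..y} \<subseteq> I" for x y using that by auto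
  ultimately show ?thesis using F by (intro that[of F]) (simp add: primitive_on_def)
qed

lemma primitive_on_has_vector_derivative:
  assumes F: "primitive_on I F f" and f: "continuous_on I f" and I: "open I" and t: "t \<in> I"
  shows "(F has_vector_derivative f t) (at t)"
proof -
  obtain e where e: "e > 0" "cball t e \<subseteq> I" using I t by (auto simp: open_contains_cball)
  then have te: "{t - e..t + e} \<subseteq> I" by (auto simp: cball_eq_atLeastAtMost)
  have cont: "continuous_on {t - e..t + e} f" using f te by (rule continuous_on_subset)
  have eq: "F s = F (t - e) + integral {t - e..s} f" if s: "s \<in> {t - e..t + e}" for s
  proof -
    have "set_integrable lborel {t - e..s} f"
      using s by (intro borel_integrable_atLeastAtMost' continuous_on_subset[OF cont]) auto
    moreover have "{t - e..s} \<subseteq> I" using s te by auto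
    ultimately show ?thesis
      using primitive_onD[OF F, of "t - e" s] s
      by (auto simp: set_borel_integral_eq_integral(2) algebra_simps)
  qed
  have "((\<lambda>s. integral {t - e..s} f) has_vector_derivative f t) (at t within {t - e..t + e})"
    using cont e(1) by (intro integral_has_vector_derivative) auto
  then have "((\<lambda>s. F (t - e) + integral {t - e..s} f) has_vector_derivative 0 + f t) (at t within {t - e..t + e})"
    by (intro has_vector_derivative_add has_vector_derivative_const)
  then have "(F has_vector_derivative 0 + f t) (at t within {t - e..t + e})"
    by (rule has_vector_derivative_transform[rotated 2]) (use e(1) in simp, rule eq)
  moreover have "at t within {t - e..t + e} = at t"
    using e(1) by (intro at_within_interior) auto
  ultimately show ?thesis by simp
qed

lemma primitive_on_add:
  assumes "primitive_on I F f" "primitive_on I G g" "locally_integrable_on I f" "locally_integrable_on I g"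
  shows "primitive_on I (\<lambda>t. F t + G t) (\<lambda>t. f t + g t)"
proof -
  have "F y + G y - (F x + G x) = (LBINT t:{x..y}. f t + g t)"
    if "x \<le> y" "{x..y} \<subseteq> I" for x y
    using primitive_onD[OF assms(1) that] primitive_onD[OF assms(2) that] assms(3,4) that
    by (simp add: set_integral_add locally_integrable_on_def algebra_simps)
  then show ?thesis using assms(1,2) by (auto simp: primitive_on_def intro!: continuous_intros)
qed

lemma primitive_on_FTC:
  assumes "\<And>t. t \<in> I \<Longrightarrow> (F has_vector_derivative f t) (at t)" "continuous_on I f"
  shows "primitive_on I F f"
proof -
  have "F y - F x = (LBINT t:{x..y}. f t)" if "x \<le> y" "{x..y} \<subseteq> I" for x y
  proof -
    have "(LBINT t. indicator {x..y} t *\<^sub>R f t) = F y - F x"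
      using that assms
      by (intro integral_FTC_Icc)
        (auto intro: has_vector_derivative_at_within continuous_on_subset simp: subset_eq)
    then show ?thesis by (simp add: set_lebesgue_integral_def)
  qed
  moreover have "continuous_on I F"
    using assms(1) by (intro continuous_at_imp_continuous_on) (blast intro: has_vector_derivative_continuous)
  ultimately show ?thesis by (simp add: primitive_on_def)
qed

lemma integral_derivative_compact_support:
  fixes F :: "real \<Rightarrow> 'a::euclidean_space"
  assumes "\<And>t. (F has_vector_derivative f t) (at t)" "continuous_on UNIV f"
    and "c \<le> d" "\<And>t. t \<notin> {c<..<d} \<Longrightarrow> F t = 0" "\<And>t. t \<notin> {c<..<d} \<Longrightarrow> f t = 0"
  shows "(LBINT t. f t) = 0"
proof -
  have "primitive_on UNIV F f" by (rule primitive_on_FTC) (use assms in auto)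
  from primitive_onD[OF this \<open>c \<le> d\<close>] have "(LBINT t:{c..d}. f t) = 0"
    using assms(4)[of c] assms(4)[of d] by simp
  moreover have "indicator {c..d} t *\<^sub>R f t = f t" for t
    using assms(5)[of t] by (auto simp: indicator_def)
  ultimately show ?thesis by (simp add: set_lebesgue_integral_def)
qed

text \<open>
  Integration by parts for a merely absolutely continuous \<open>F\<close>: write the test function as minus
  the integral of its derivative over a right half line and exchange the order of integration.
\<close>
lemma primitive_integration_by_parts:
  fixes f :: "real \<Rightarrow> 'a::euclidean_space"
  assumes f: "locally_integrable_on I f" and F: "primitive_on I F f"
    and \<phi>: "\<phi> \<in> smooth_compact I" "\<And>t. (\<phi> has_vector_derivative \<phi>' t) (at t)"
  shows "(LBINT t. \<phi> t *\<^sub>R f t) = - (LBINT t. \<phi>' t *\<^sub>R F t)"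
proof -
  obtain c d where *: "smooth_on UNIV \<phi>" "c < d" "{c..d} \<subseteq> I" "\<And>t. t \<notin> {c<..<d} \<Longrightarrow> \<phi> t = 0"
    using smooth_compactE[OF \<phi>(1)] by metis
  have \<phi>'_eq: "\<phi>' t = vector_derivative \<phi> (at t)" for t
    using vector_derivative_at[OF \<phi>(2)] by simp
  obtain \<phi>2 where "\<phi>2 \<in> smooth_compact I" "\<And>t. \<phi>2 t = vector_derivative \<phi> (at t)"
    "\<And>t. t \<notin> {c<..<d} \<Longrightarrow> \<phi>2 t = 0"
    using smooth_compact_derivative[OF \<phi>(1)] *(2,4) by metis
  moreover from this have "\<phi>2 = \<phi>'" using \<phi>'_eq by auto
  ultimately have \<phi>': "\<phi>' \<in> smooth_compact I" "\<And>t. t \<notin> {c<..<d} \<Longrightarrow> \<phi>' t = 0" by auto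
  have cont: "continuous_on UNIV \<phi>'"
    using smooth_compactE[OF \<phi>'(1)] smooth_on_UNIV_continuous by metis
  have [measurable]: "\<phi>' \<in> borel_measurable borel" using cont by (simp add: borel_measurable_continuous_onI)
  define g where "g t = indicator {c..d} t *\<^sub>R f t" for t
  have g: "integrable lborel g"
    using f *(3) by (simp add: g_def[abs_def] locally_integrable_on_def set_integrable_def)
  have [measurable]: "g \<in> borel_measurable borel" using borel_measurable_integrable[OF g] by simp
  have int_\<phi>': "integrable lborel \<phi>'"
    using smooth_compact_integrable[OF locally_integrable_on_continuous[of I "\<lambda>_. 1 :: real"] \<phi>'(1)] by simp
  (* integrating h over s gives - \<phi> f, integrating it over t gives \<phi>' (F - F c) *)
  define h where "h t s = (if t \<le> s then \<phi>' s *\<^sub>R g t else 0)" for t s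
  have int_h: "integrable (lborel \<Otimes>\<^sub>M lborel) (\<lambda>(t, s). h t s)"
  proof (rule Bochner_Integration.integrable_bound)
    show "integrable (lborel \<Otimes>\<^sub>M lborel) (\<lambda>(t, s). \<phi>' s *\<^sub>R g t)"
    proof (rule lborel_pair.Fubini_integrable)
      show "(\<lambda>(t, s). \<phi>' s *\<^sub>R g t) \<in> borel_measurable (lborel \<Otimes>\<^sub>M lborel)" by measurable
      have "integrable lborel (\<lambda>t. norm (g t) * (LBINT s. \<bar>\<phi>' s\<bar>))"
        using g by (intro integrable_mult_left integrable_norm)
      then show "integrable lborel (\<lambda>t. LBINT s. norm (case (t, s) of (t, s) \<Rightarrow> \<phi>' s *\<^sub>R g t))"
        by (simp add: mult.commute)
      show "AE t in lborel. integrable lborel (\<lambda>s. case (t, s) of (t, s) \<Rightarrow> \<phi>' s *\<^sub>R g t)"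
        using int_\<phi>' by (intro AE_I2) simp
    qed
    show "(\<lambda>(t, s). h t s) \<in> borel_measurable (lborel \<Otimes>\<^sub>M lborel)"
      unfolding h_def by measurable
    show "AE p in lborel \<Otimes>\<^sub>M lborel. norm (case p of (t, s) \<Rightarrow> h t s) \<le> norm (case p of (t, s) \<Rightarrow> \<phi>' s *\<^sub>R g t)"
      by (intro AE_I2) (auto simp: h_def)
  qed
  have prim_\<phi>: "primitive_on UNIV \<phi> \<phi>'"
    using \<phi>(2) cont by (intro primitive_on_FTC) auto
  have inner_s: "(LBINT s. h t s) = - (\<phi> t *\<^sub>R f t)" for t
  proof (cases "t \<in> {c..d}")
    case True
    have "(LBINT s. h t s) = (LBINT s. (indicator {t..d} s * \<phi>' s) *\<^sub>R g t)"
    proof (intro Bochner_Integration.integral_cong refl)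
      fix s
      have "\<phi>' s = 0" if "\<not> s \<le> d" using that by (intro \<phi>'(2)) auto
      then show "h t s = (indicator {t..d} s * \<phi>' s) *\<^sub>R g t"
        by (auto simp: h_def indicator_def)
    qed
    also have "\<dots> = (LBINT s:{t..d}. \<phi>' s) *\<^sub>R g t"
      using set_integrable_subset[of lborel UNIV \<phi>' "{t..d}"] int_\<phi>'
      by (subst integral_scaleR_left) (auto simp: set_lebesgue_integral_def set_integrable_def)
    also have "(LBINT s:{t..d}. \<phi>' s) = \<phi> d - \<phi> t"
      using primitive_onD[OF prim_\<phi>, of t d] True by simp
    finally show ?thesis using True *(4)[of d] by (simp add: g_def)
  next
    case False
    then have "\<phi> t = 0" by (intro *(4)) auto
    moreover have "h t s = 0" for s using False by (simp add: h_def g_def)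
    ultimately show ?thesis by simp
  qed
  have inner_t: "(LBINT t. h t s) = \<phi>' s *\<^sub>R F s - \<phi>' s *\<^sub>R F c" for s
  proof (cases "s \<in> {c..d}")
    case True
    have "(LBINT t. h t s) = (LBINT t. \<phi>' s *\<^sub>R (indicator {c..s} t *\<^sub>R f t))"
      using True by (intro Bochner_Integration.integral_cong) (auto simp: h_def g_def indicator_def)
    also have "\<dots> = \<phi>' s *\<^sub>R (LBINT t:{c..s}. f t)"
      by (simp only: integral_scaleR_right set_lebesgue_integral_def)
    also have "(LBINT t:{c..s}. f t) = F s - F c"
    proof -
      have "{c..s} \<subseteq> I" using True *(3) by auto
      then show ?thesis using primitive_onD[OF F, of c s] True by simp
    qed
    finally show ?thesis by (simp add: scaleR_diff_right)
  next
    case False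
    then have "\<phi>' s = 0" by (intro \<phi>'(2)) auto
    moreover from this have "h t s = 0" for t by (simp add: h_def)
    ultimately show ?thesis by simp
  qed
  have "locally_integrable_on I F"
    using F by (intro locally_integrable_on_continuous) (auto simp: primitive_on_def)
  note int_F = smooth_compact_integrable[OF this \<phi>'(1)]
  have "(LBINT s. \<phi>' s) = 0"
    by (rule integral_derivative_compact_support[OF \<phi>(2) cont less_imp_le[OF *(2)] *(4) \<phi>'(2)])
  then have "(LBINT s. \<phi>' s *\<^sub>R F c) = 0" using int_\<phi>' by (subst integral_scaleR_left) auto
  then have "(LBINT s. LBINT t. h t s) = (LBINT s. \<phi>' s *\<^sub>R F s)"
    unfolding inner_t using int_F int_\<phi>' by (subst Bochner_Integration.integral_diff) auto
  moreover have "(LBINT t. LBINT s. h t s) = - (LBINT t. \<phi> t *\<^sub>R f t)"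
    unfolding inner_s by simp
  moreover have "(LBINT s. LBINT t. h t s) = (LBINT t. LBINT s. h t s)"
    by (rule lborel_pair.Fubini_integral[OF int_h])
  ultimately have "(LBINT t. \<phi>' t *\<^sub>R F t) = - (LBINT t. \<phi> t *\<^sub>R f t)"
    by (simp only:)
  then show ?thesis by simp
qed


lemma smooth_compact_antiderivative:
  assumes \<eta>: "\<eta> \<in> smooth_compact I" "(LBINT t. \<eta> t) = 0"
  shows "\<exists>\<phi>\<in>smooth_compact I. \<forall>t. (\<phi> has_vector_derivative \<eta> t) (at t)"
proof -
  obtain c d where *: "smooth_on UNIV \<eta>" "c < d" "{c..d} \<subseteq> I" "\<And>t. t \<notin> {c<..<d} \<Longrightarrow> \<eta> t = 0"
    using smooth_compactE[OF \<eta>(1)] by metis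
  have cont: "continuous_on UNIV \<eta>" using *(1) by (rule smooth_on_UNIV_continuous)
  have "\<exists>F. \<forall>x::real. -\<infinity> < ereal x \<longrightarrow> ereal x < \<infinity> \<longrightarrow> (F has_vector_derivative \<eta> x) (at x)"
    using cont by (intro einterval_antiderivative) (auto simp: continuous_on_eq_continuous_at)
  then obtain F where F: "\<And>x. (F has_vector_derivative \<eta> x) (at x)" by auto
  have prim: "primitive_on UNIV F \<eta>" using F cont by (intro primitive_on_FTC) auto
  define \<phi> where "\<phi> t = F t - F c" for t
  have der: "(\<phi> has_vector_derivative \<eta> t) (at t)" for t
    using has_vector_derivative_diff[OF F has_vector_derivative_const[of "F c"]]
    by (simp add: \<phi>_def[abs_def])
  have "\<phi> t = 0" if "t \<notin> {c<..<d}" for t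
  proof (cases "t \<le> c")
    case True
    have "indicator {t..c} s *\<^sub>R \<eta> s = 0" for s
      using *(4)[of s] by (auto simp: indicator_def)
    then have "(LBINT s:{t..c}. \<eta> s) = 0"
      unfolding set_lebesgue_integral_def by (simp only: integral_zero)
    then have "F c - F t = 0" using primitive_onD[OF prim True] by simp
    then show ?thesis by (simp add: \<phi>_def)
  next
    case False
    then have "c \<le> t" "d \<le> t" using that by auto
    then have "indicator {c..t} s *\<^sub>R \<eta> s = \<eta> s" for s
      by (cases "s \<in> {c<..<d}") (auto simp: indicator_def *(4))
    then have "(LBINT s:{c..t}. \<eta> s) = 0"
      unfolding set_lebesgue_integral_def by (simp only: \<eta>(2))
    then have "F t - F c = 0" using primitive_onD[OF prim \<open>c \<le> t\<close>] by simp
    then show ?thesis by (simp add: \<phi>_def)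
  qed
  moreover have "smooth_on UNIV \<phi>" by (rule smooth_on_antiderivative[OF *(1)]) (rule der)
  ultimately have "\<phi> \<in> smooth_compact I" unfolding smooth_compact_def using *(2,3) by blast
  then show ?thesis using der by blast
qed

lemma exists_smooth_compact_integral_one:
  assumes "open I" "I \<noteq> {}" "is_interval I"
  obtains \<rho> where "\<rho> \<in> smooth_compact I" "(LBINT t. \<rho> t) = 1"
proof -
  have loc: "locally_integrable_on I (\<lambda>_. 1 :: real)"
    by (intro locally_integrable_on_continuous continuous_on_const)
  obtain x where "x \<in> I" using assms(2) by auto
  then obtain e where e: "e > 0" "cball x e \<subseteq> I" using assms(1) by (auto simp: open_contains_cball)
  obtain \<psi> where \<psi>: "\<psi> \<in> smooth_compact I" "(LBINT t. \<psi> t) \<noteq> 0"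
  proof (rule ccontr)
    assume "\<not> thesis"
    then have "(LBINT t. \<psi> t *\<^sub>R (1::real)) = 0" if "\<psi> \<in> smooth_compact I" for \<psi>
      using that \<open>\<And>\<psi>. \<psi> \<in> smooth_compact I \<Longrightarrow> (LBINT t. \<psi> t) \<noteq> 0 \<Longrightarrow> thesis\<close> by auto
    from fundamental_lemma[OF loc assms(1) this]
    have ae: "AE t in lborel. t \<notin> I" by simp
    have "{x..x + e} \<subseteq> I" using e by (auto simp: cball_eq_atLeastAtMost)
    then have "AE t in lborel. t \<notin> {x..x + e}" using ae by (blast intro: eventually_mono)
    then have "{x..x + e} \<in> null_sets lborel" by (simp add: AE_iff_null_sets)
    then show False using e(1) by (simp add: null_sets_def)
  qed
  define r where "r = (LBINT t. \<psi> t)"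
  (* psi / r in the form covered by smooth_compact_diff_scale *)
  have "(\<lambda>t. \<psi> t - (1 - 1 / r) * \<psi> t) \<in> smooth_compact I"
    by (rule smooth_compact_diff_scale[OF \<psi>(1) \<psi>(1) assms(3)])
  moreover have "\<psi> t - (1 - 1 / r) * \<psi> t = \<psi> t / r" for t by (simp add: algebra_simps)
  ultimately have "(\<lambda>t. \<psi> t / r) \<in> smooth_compact I" by simp
  moreover have "(LBINT t. \<psi> t / r) = 1" using \<psi>(2) by (simp add: r_def)
  ultimately show ?thesis by (rule that)
qed

text \<open>
  Every test function is the derivative of a test function plus a multiple of a fixed test function
  \<open>\<rho>\<close> of integral one; this reduces the claim to the fundamental lemma.
\<close>
lemma du_bois_reymond:
  fixes f :: "real \<Rightarrow> 'a::euclidean_space"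
  assumes f: "locally_integrable_on I f" and I: "open I" "is_interval I"
    and zero: "\<And>\<phi> \<phi>'. \<phi> \<in> smooth_compact I \<Longrightarrow> \<phi>' \<in> smooth_compact I \<Longrightarrow>
      (\<And>t. (\<phi> has_vector_derivative \<phi>' t) (at t)) \<Longrightarrow> (LBINT t. \<phi>' t *\<^sub>R f t) = 0"
  obtains \<kappa> where "AE t in lborel. t \<in> I \<longrightarrow> f t = \<kappa>"
proof (cases "I = {}")
  case True
  then show ?thesis by (intro that) auto
next
  case False
  obtain \<rho> where \<rho>: "\<rho> \<in> smooth_compact I" "(LBINT t. \<rho> t) = 1"
    using exists_smooth_compact_integral_one[OF I(1) False I(2)] by metis
  define \<kappa> where "\<kappa> = (LBINT t. \<rho> t *\<^sub>R f t)"
  have const: "locally_integrable_on I (\<lambda>_. x)" for x :: "'c::euclidean_space"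
    by (intro locally_integrable_on_continuous continuous_on_const)
  have int1: "integrable lborel \<psi>" if "\<psi> \<in> smooth_compact I" for \<psi>
    using smooth_compact_integrable[OF const[of "1::real"] that] by simp
  have "AE t in lborel. t \<in> I \<longrightarrow> f t - \<kappa> = 0"
  proof (rule fundamental_lemma[OF locally_integrable_on_diff[OF f const] I(1)])
    fix \<psi> assume \<psi>: "\<psi> \<in> smooth_compact I"
    define r where "r = (LBINT t. \<psi> t)"
    have \<eta>: "(\<lambda>t. \<psi> t - r * \<rho> t) \<in> smooth_compact I"
      by (rule smooth_compact_diff_scale[OF \<psi> \<rho>(1) I(2)])
    have int0: "(LBINT t. \<psi> t - r * \<rho> t) = 0"
      using int1[OF \<psi>] int1[OF \<rho>(1)] \<rho>(2) by (simp add: r_def)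
    obtain \<phi> where "\<phi> \<in> smooth_compact I"
      "\<And>t. (\<phi> has_vector_derivative (\<psi> t - r * \<rho> t)) (at t)"
      using smooth_compact_antiderivative[OF \<eta> int0] by blast
    from zero[OF this(1) \<eta> this(2)] have "(LBINT t. (\<psi> t - r * \<rho> t) *\<^sub>R f t) = 0" .
    moreover have "(LBINT t. (\<psi> t - r * \<rho> t) *\<^sub>R f t) = (LBINT t. \<psi> t *\<^sub>R f t - r *\<^sub>R (\<rho> t *\<^sub>R f t))"
      by (simp add: scaleR_diff_left)
    ultimately have "(LBINT t. \<psi> t *\<^sub>R f t) = r *\<^sub>R \<kappa>"
      using smooth_compact_integrable[OF f \<psi>] smooth_compact_integrable[OF f \<rho>(1)]
      by (simp add: \<kappa>_def del: scaleR_scaleR)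
    moreover have "(LBINT t. \<psi> t *\<^sub>R \<kappa>) = r *\<^sub>R \<kappa>"
      unfolding r_def using int1[OF \<psi>] by (intro integral_scaleR_left) auto
    ultimately show "(LBINT t. \<psi> t *\<^sub>R (f t - \<kappa>)) = 0"
      using smooth_compact_integrable[OF f \<psi>] smooth_compact_integrable[OF const \<psi>, of \<kappa>]
      by (simp add: scaleR_diff_right)
  qed
  then show ?thesis by (intro that[of \<kappa>]) simp
qed

text \<open>
  For a test function \<open>\<phi>\<close> of integral \<open>r\<close>, the function \<open>\<phi> - r \<rho>\<close> is the derivative of a test
  function \<open>u\<close>.  The hypothesis for \<open>u\<close> expresses the integral of \<open>\<phi>' f\<close> as \<open>r\<close> times a constant \<open>\<beta>\<close>,
  which is also minus the integral of \<open>\<phi>' t \<beta>\<close>.  Hence \<open>f + t \<beta>\<close> satisfies the first order condition.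
\<close>
lemma du_bois_reymond_second_order:
  fixes f :: "real \<Rightarrow> 'a::euclidean_space"
  assumes f: "locally_integrable_on I f" and I: "open I" "is_interval I"
    and zero: "\<And>\<phi> \<phi>' \<phi>''. \<phi> \<in> smooth_compact I \<Longrightarrow> \<phi>' \<in> smooth_compact I \<Longrightarrow> \<phi>'' \<in> smooth_compact I \<Longrightarrow>
      (\<And>t. (\<phi> has_vector_derivative \<phi>' t) (at t)) \<Longrightarrow>
      (\<And>t. (\<phi>' has_vector_derivative \<phi>'' t) (at t)) \<Longrightarrow> (LBINT t. \<phi>'' t *\<^sub>R f t) = 0"
  obtains \<alpha> \<beta> where "AE t in lborel. t \<in> I \<longrightarrow> f t = \<alpha> + t *\<^sub>R \<beta>"
proof (cases "I = {}")
  case True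
  then show ?thesis by (intro that) auto
next
  case False
  obtain \<rho> where \<rho>: "\<rho> \<in> smooth_compact I" "(LBINT t. \<rho> t) = 1"
    using exists_smooth_compact_integral_one[OF I(1) False I(2)] by metis
  obtain \<rho>' where \<rho>': "\<rho>' \<in> smooth_compact I" "\<And>t. (\<rho> has_vector_derivative \<rho>' t) (at t)"
    using smooth_compact_derivative[OF \<rho>(1)] by metis
  define \<beta> where "\<beta> = (LBINT t. \<rho>' t *\<^sub>R f t)"
  have const: "locally_integrable_on I (\<lambda>_. x)" for x :: "'c::euclidean_space"
    by (intro locally_integrable_on_continuous continuous_on_const)
  have lin: "locally_integrable_on I (\<lambda>t. t *\<^sub>R \<beta>)"
    by (intro locally_integrable_on_continuous continuous_intros)
  have int1: "integrable lborel \<psi>" if "\<psi> \<in> smooth_compact I" for \<psi>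
    using smooth_compact_integrable[OF const[of "1::real"] that] by simp
  obtain \<kappa> where "AE t in lborel. t \<in> I \<longrightarrow> f t + t *\<^sub>R \<beta> = \<kappa>"
  proof (rule du_bois_reymond[OF locally_integrable_on_add[OF f lin] I])
    fix \<phi> \<phi>' assume \<phi>: "\<phi> \<in> smooth_compact I" "\<phi>' \<in> smooth_compact I"
      "\<And>t. (\<phi> has_vector_derivative \<phi>' t) (at t)"
    define r where "r = (LBINT t. \<phi> t)"
    have \<eta>: "(\<lambda>t. \<phi> t - r * \<rho> t) \<in> smooth_compact I"
      by (rule smooth_compact_diff_scale[OF \<phi>(1) \<rho>(1) I(2)])
    have int0: "(LBINT t. \<phi> t - r * \<rho> t) = 0"
      using int1[OF \<phi>(1)] int1[OF \<rho>(1)] \<rho>(2) by (simp add: r_def)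
    obtain u where u: "u \<in> smooth_compact I"
      "\<And>t. (u has_vector_derivative (\<phi> t - r * \<rho> t)) (at t)"
      using smooth_compact_antiderivative[OF \<eta> int0] by blast
    have "(\<lambda>t. \<phi>' t - r * \<rho>' t) \<in> smooth_compact I"
      by (rule smooth_compact_diff_scale[OF \<phi>(2) \<rho>'(1) I(2)])
    moreover have "((\<lambda>t. \<phi> t - r * \<rho> t) has_vector_derivative (\<phi>' t - r * \<rho>' t)) (at t)" for t
      by (intro has_vector_derivative_diff has_vector_derivative_mult_right \<phi> \<rho>')
    ultimately have "(LBINT t. (\<phi>' t - r * \<rho>' t) *\<^sub>R f t) = 0"
      using zero[OF u(1) \<eta>, of "\<lambda>t. \<phi>' t - r * \<rho>' t"] u(2) by blast
    moreover have "(LBINT t. (\<phi>' t - r * \<rho>' t) *\<^sub>R f t) = (LBINT t. \<phi>' t *\<^sub>R f t - r *\<^sub>R (\<rho>' t *\<^sub>R f t))"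
      by (simp add: scaleR_diff_left)
    ultimately have 1: "(LBINT t. \<phi>' t *\<^sub>R f t) = r *\<^sub>R \<beta>"
      using smooth_compact_integrable[OF f \<phi>(2)] smooth_compact_integrable[OF f \<rho>'(1)]
      by (simp add: \<beta>_def del: scaleR_scaleR)
    have "primitive_on I (\<lambda>t. t *\<^sub>R \<beta>) (\<lambda>t. \<beta>)"
      by (rule primitive_on_FTC) (auto intro!: derivative_eq_intros)
    from primitive_integration_by_parts[OF const this \<phi>(1,3)]
    have "(LBINT t. \<phi>' t *\<^sub>R t *\<^sub>R \<beta>) = - (LBINT t. \<phi> t *\<^sub>R \<beta>)" by simp
    also have "(LBINT t. \<phi> t *\<^sub>R \<beta>) = r *\<^sub>R \<beta>"
      unfolding r_def using int1[OF \<phi>(1)] by (intro integral_scaleR_left) auto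
    finally show "(LBINT t. \<phi>' t *\<^sub>R (f t + t *\<^sub>R \<beta>)) = 0"
      using 1 smooth_compact_integrable[OF f \<phi>(2)] smooth_compact_integrable[OF lin \<phi>(2)]
      by (simp add: scaleR_add_right del: scaleR_scaleR)
  qed blast
  then have "AE t in lborel. t \<in> I \<longrightarrow> f t = \<kappa> + t *\<^sub>R (- \<beta>)"
    by (auto simp: algebra_simps elim!: eventually_mono)
  then show ?thesis by (rule that)
qed

text \<open>
  The hypothesis says that \<open>A'' - B' + C = 0\<close> in the sense of distributions.  With a
  primitive \<open>c\<close> of \<open>C\<close> and a primitive \<open>g\<close> of \<open>B - c\<close> it becomes \<open>(A - g)'' = 0\<close>, so that \<open>A - g\<close> is
  affine; its two constants are absorbed in the choice of the primitives.
\<close>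
lemma weak_equation_integrated:
  fixes A B C :: "real \<Rightarrow> 'a::euclidean_space"
  assumes A: "locally_integrable_on I A" and B: "locally_integrable_on I B"
    and C: "locally_integrable_on I C" and I: "open I" "is_interval I"
    and zero: "\<And>\<phi> \<phi>' \<phi>''. \<phi> \<in> smooth_compact I \<Longrightarrow> \<phi>' \<in> smooth_compact I \<Longrightarrow> \<phi>'' \<in> smooth_compact I \<Longrightarrow>
      (\<And>t. (\<phi> has_vector_derivative \<phi>' t) (at t)) \<Longrightarrow>
      (\<And>t. (\<phi>' has_vector_derivative \<phi>'' t) (at t)) \<Longrightarrow>
      (LBINT t. \<phi>'' t *\<^sub>R A t + \<phi>' t *\<^sub>R B t + \<phi> t *\<^sub>R C t) = 0"
  obtains C1 D1 where "primitive_on I C1 C" "primitive_on I D1 (\<lambda>t. B t - C1 t)"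
    "AE t in lborel. t \<in> I \<longrightarrow> A t = D1 t"
proof -
  obtain c where c: "primitive_on I c C" using exists_primitive[OF C I] by metis
  have c': "locally_integrable_on I c"
    using c by (intro locally_integrable_on_continuous) (auto simp: primitive_on_def)
  note Bc = locally_integrable_on_diff[OF B c']
  obtain g where g: "primitive_on I g (\<lambda>t. B t - c t)" using exists_primitive[OF Bc I] by metis
  have g': "locally_integrable_on I g"
    using g by (intro locally_integrable_on_continuous) (auto simp: primitive_on_def)
  obtain \<alpha> \<beta> where \<alpha>\<beta>: "AE t in lborel. t \<in> I \<longrightarrow> A t - g t = \<alpha> + t *\<^sub>R \<beta>"
  proof (rule du_bois_reymond_second_order[OF locally_integrable_on_diff[OF A g'] I])
    fix \<phi> \<phi>' \<phi>''
    assume \<phi>: "\<phi> \<in> smooth_compact I" "\<phi>' \<in> smooth_compact I" "\<phi>'' \<in> smooth_compact I"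
      "\<And>t. (\<phi> has_vector_derivative \<phi>' t) (at t)" "\<And>t. (\<phi>' has_vector_derivative \<phi>'' t) (at t)"
    note int = smooth_compact_integrable[OF A \<phi>(3)] smooth_compact_integrable[OF B \<phi>(2)]
      smooth_compact_integrable[OF C \<phi>(1)] smooth_compact_integrable[OF c' \<phi>(2)]
      smooth_compact_integrable[OF g' \<phi>(3)]
    have 1: "(LBINT t. \<phi> t *\<^sub>R C t) = - (LBINT t. \<phi>' t *\<^sub>R c t)"
      by (rule primitive_integration_by_parts[OF C c \<phi>(1,4)])
    have "(LBINT t. \<phi>' t *\<^sub>R (B t - c t)) = - (LBINT t. \<phi>'' t *\<^sub>R g t)"
      by (rule primitive_integration_by_parts[OF Bc g \<phi>(2,5)])
    then have 2: "(LBINT t. \<phi>' t *\<^sub>R B t) - (LBINT t. \<phi>' t *\<^sub>R c t) = - (LBINT t. \<phi>'' t *\<^sub>R g t)"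
      using int by (simp add: scaleR_diff_right)
    have "(LBINT t. \<phi>'' t *\<^sub>R A t) + (LBINT t. \<phi>' t *\<^sub>R B t) + (LBINT t. \<phi> t *\<^sub>R C t) = 0"
      using zero[OF \<phi>] int by simp
    then show "(LBINT t. \<phi>'' t *\<^sub>R (A t - g t)) = 0"
      using 1 2 int by (simp add: scaleR_diff_right algebra_simps)
  qed blast
  have const: "primitive_on I (\<lambda>t. x) (\<lambda>t. 0)" for x :: 'a
    by (rule primitive_on_FTC) (auto intro!: derivative_eq_intros)
  have lin: "primitive_on I (\<lambda>t. \<alpha> + t *\<^sub>R \<beta>) (\<lambda>t. \<beta>)"
    by (rule primitive_on_FTC) (auto intro!: derivative_eq_intros)
  have loc: "locally_integrable_on I (\<lambda>_. x)" for x :: 'a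
    by (intro locally_integrable_on_continuous continuous_on_const)
  show ?thesis
  proof (rule that)
    show "primitive_on I (\<lambda>t. c t + - \<beta>) C"
      using primitive_on_add[OF c const[of "- \<beta>"] C loc] by simp
    show "primitive_on I (\<lambda>t. g t + (\<alpha> + t *\<^sub>R \<beta>)) (\<lambda>t. B t - (c t + - \<beta>))"
      using primitive_on_add[OF g lin Bc loc] by (simp add: algebra_simps)
    show "AE t in lborel. t \<in> I \<longrightarrow> A t = g t + (\<alpha> + t *\<^sub>R \<beta>)"
      using \<alpha>\<beta> by (auto simp: algebra_simps elim!: eventually_mono)
  qed
qed

section \<open>Calculus of matrix-valued functions\<close>

lemma bounded_bilinear_matrix_vector_mult:
  "bounded_bilinear ((*v) :: real^'n^'m \<Rightarrow> real^'n \<Rightarrow> real^'m)"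
proof (subst bilinear_conv_bounded_bilinear[symmetric], unfold bilinear_def, intro conjI allI)
  show "linear (\<lambda>x. A *v x)" for A :: "real^'n^'m" by simp
  show "linear (\<lambda>A :: real^'n^'m. A *v x)" for x
    by (rule linearI) (auto simp: matrix_vector_mult_add_rdistrib scaleR_matrix_vector_assoc)
qed

lemma bounded_bilinear_matrix_matrix_mult:
  "bounded_bilinear ((**) :: real^'n^'m \<Rightarrow> real^'k^'n \<Rightarrow> real^'k^'m)"
proof (subst bilinear_conv_bounded_bilinear[symmetric], unfold bilinear_def, intro conjI allI)
  show "linear (\<lambda>B. A ** B)" for A :: "real^'n^'m"
    by (rule linearI) (auto simp: matrix_add_ldistrib matrix_scalar_ac scalar_matrix_assoc)
  show "linear (\<lambda>A :: real^'n^'m. A ** B)" for B :: "real^'k^'n"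
    by (rule linearI) (auto simp: matrix_matrix_mult_def vec_eq_iff sum.distrib sum_distrib_left algebra_simps)
qed

lemmas continuous_on_matrix_vector_mult =
  bounded_bilinear.continuous_on[OF bounded_bilinear_matrix_vector_mult]
lemmas has_vector_derivative_matrix_vector_mult =
  bounded_bilinear.has_vector_derivative[OF bounded_bilinear_matrix_vector_mult]
lemmas tendsto_matrix_matrix_mult =
  bounded_bilinear.tendsto[OF bounded_bilinear_matrix_matrix_mult]
lemmas continuous_on_matrix_matrix_mult =
  bounded_bilinear.continuous_on[OF bounded_bilinear_matrix_matrix_mult]

lemma bounded_linear_transpose: "bounded_linear (transpose :: real^'n^'m \<Rightarrow> real^'m^'n)"
  by (simp add: linear_conv_bounded_linear[symmetric] linearI transpose_def vec_eq_iff)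

lemma inner_matrix_left:
  fixes A :: "real^'n^'m"
  shows "(A *v x) \<bullet> y = x \<bullet> (transpose A *v y)"
  by (metis dot_lmul_matrix inner_commute transpose_transpose vector_transpose_matrix)

lemma matrix_inv_mult:
  fixes A :: "real^'n^'n"
  assumes "invertible A"
  shows "A ** matrix_inv A = mat 1" "matrix_inv A ** A = mat 1"
proof -
  have "\<exists>B. A ** B = mat 1 \<and> B ** A = mat 1" using assms by (simp add: invertible_def)
  from someI_ex[OF this] show "A ** matrix_inv A = mat 1" "matrix_inv A ** A = mat 1"
    by (simp_all add: matrix_inv_def)
qed

lemma matrix_inv_vector_mult:
  fixes A :: "real^'n^'n"
  assumes "invertible A"
  shows "A *v (matrix_inv A *v x) = x" "matrix_inv A *v (A *v x) = x"
  by (simp_all add: matrix_vector_mul_assoc matrix_inv_mult[OF assms])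

lemma symmetric_matrix_inverse:
  fixes A :: "real^'n^'n"
  assumes "invertible A" "transpose (matrix_inv A) = matrix_inv A"
  shows "transpose A = A"
proof -
  have "transpose A ** matrix_inv A = mat 1"
    using arg_cong[OF matrix_inv_mult(2)[OF assms(1)], of transpose]
    by (simp add: matrix_transpose_mul assms(2))
  then have "transpose A ** (matrix_inv A ** A) = A"
    by (simp add: matrix_mul_assoc)
  then show ?thesis by (simp add: matrix_inv_mult(2)[OF assms(1)])
qed

lemma tendsto_det:
  fixes A :: "'a \<Rightarrow> real^'n^'n"
  assumes "(A \<longlongrightarrow> B) F"
  shows "((\<lambda>x. det (A x)) \<longlongrightarrow> det B) F"
  unfolding det_def by (intro tendsto_intros tendsto_vec_nth assms)

text \<open>By Cramer's rule the entries of the inverse are quotients of determinants.\<close>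
lemma matrix_inv_entry:
  fixes A :: "real^'n^'n"
  assumes "invertible A"
  shows "matrix_inv A $ k $ l =
    det (\<chi> i j. if j = k then axis l 1 $ i else A $ i $ j) / det A"
proof -
  have "det A \<noteq> 0" using assms by (simp add: invertible_det_nz)
  from cramer[OF this, of "matrix_inv A *v axis l 1" "axis l 1"]
  have "matrix_inv A *v axis l 1 = (\<chi> k. det (\<chi> i j. if j = k then axis l 1 $ i else A $ i $ j) / det A)"
    by (simp add: matrix_inv_vector_mult[OF assms])
  then have "(matrix_inv A *v axis l 1) $ k = det (\<chi> i j. if j = k then axis l 1 $ i else A $ i $ j) / det A"
    by simp
  moreover have "(matrix_inv A *v axis l 1) $ k = matrix_inv A $ k $ l"
    by (simp add: matrix_vector_mult_def axis_def if_distrib cong: if_cong)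
  ultimately show ?thesis by simp
qed

lemma tendsto_matrix_inv:
  fixes A :: "'a \<Rightarrow> real^'n^'n"
  assumes A: "(A \<longlongrightarrow> B) F" and B: "invertible B" and inv: "eventually (\<lambda>x. invertible (A x)) F"
  shows "((\<lambda>x. matrix_inv (A x)) \<longlongrightarrow> matrix_inv B) F"
proof (intro vec_tendstoI)
  fix k l
  have det: "((\<lambda>x. det (\<chi> i j. if j = k then axis l 1 $ i else A x $ i $ j) / det (A x)) \<longlongrightarrow>
      det (\<chi> i j. if j = k then axis l 1 $ i else B $ i $ j) / det B) F"
  proof (intro tendsto_divide tendsto_det A)
    show "((\<lambda>x. \<chi> i j. if j = k then axis l 1 $ i else A x $ i $ j) \<longlongrightarrow>
        (\<chi> i j. if j = k then axis l 1 $ i else B $ i $ j)) F"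
    proof (intro vec_tendstoI)
      fix i j
      show "((\<lambda>x. (\<chi> i j. if j = k then axis l 1 $ i else A x $ i $ j) $ i $ j) \<longlongrightarrow>
          (\<chi> i j. if j = k then axis l 1 $ i else B $ i $ j) $ i $ j) F"
        using tendsto_vec_nth[OF tendsto_vec_nth[OF A], of i j] by (cases "j = k") auto
    qed
    show "det B \<noteq> 0" using B by (simp add: invertible_det_nz)
  qed
  show "((\<lambda>x. matrix_inv (A x) $ k $ l) \<longlongrightarrow> matrix_inv B $ k $ l) F"
    unfolding matrix_inv_entry[OF B]
    by (rule Lim_transform_eventually[OF det])
      (use inv in eventually_elim, simp add: matrix_inv_entry)
qed

lemma has_vector_derivative_iff_tendsto:
  "(f has_vector_derivative y) (at t) \<longleftrightarrow> ((\<lambda>s. (1 / (s - t)) *\<^sub>R (f s - f t)) \<longlongrightarrow> y) (at t)"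
proof -
  have "norm (f s - f t - (s - t) *\<^sub>R y) / norm (s - t) = norm ((1 / (s - t)) *\<^sub>R (f s - f t) - y)"
    if "s \<noteq> t" for s
  proof -
    have "(1 / (s - t)) *\<^sub>R (f s - f t) - y = (1 / (s - t)) *\<^sub>R (f s - f t - (s - t) *\<^sub>R y)"
      using that by (simp add: scaleR_diff_right)
    then show ?thesis by simp
  qed
  then have "((\<lambda>s. norm (f s - f t - (s - t) *\<^sub>R y) / norm (s - t)) \<longlongrightarrow> 0) (at t) \<longleftrightarrow>
      ((\<lambda>s. norm ((1 / (s - t)) *\<^sub>R (f s - f t) - y)) \<longlongrightarrow> 0) (at t)"
    by (intro filterlim_cong refl) (auto simp: eventually_at_filter)
  also have "\<dots> \<longleftrightarrow> ((\<lambda>s. (1 / (s - t)) *\<^sub>R (f s - f t) - y) \<longlongrightarrow> 0) (at t)"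
    by (rule tendsto_norm_zero_iff)
  also have "\<dots> \<longleftrightarrow> ((\<lambda>s. (1 / (s - t)) *\<^sub>R (f s - f t)) \<longlongrightarrow> y) (at t)"
    by (rule LIM_zero_iff)
  finally show ?thesis
    by (simp add: has_vector_derivative_def has_derivative_iff_norm bounded_linear_scaleR_left)
qed

text \<open>\<open>P(s) - P(t) = - P(s) (M(s) - M(t)) P(t)\<close> for mutually inverse \<open>P\<close> and \<open>M\<close>.\<close>
lemma C1_differentiable_on_matrix_inverse:
  fixes P M :: "real \<Rightarrow> real^'n^'n"
  assumes M: "M C1_differentiable_on S" and S: "open S"
    and inv: "\<And>t. t \<in> S \<Longrightarrow> P t ** M t = mat 1" "\<And>t. t \<in> S \<Longrightarrow> M t ** P t = mat 1"
  shows "P C1_differentiable_on S"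
proof -
  obtain M' where M': "\<And>t. t \<in> S \<Longrightarrow> (M has_vector_derivative M' t) (at t)" "continuous_on S M'"
    using M unfolding C1_differentiable_on_def by blast
  have inv_M: "invertible (M t)" "matrix_inv (M t) = P t" if "t \<in> S" for t
  proof -
    show iM: "invertible (M t)" using inv[OF that] by (auto simp: invertible_def)
    have "(P t ** M t) ** matrix_inv (M t) = P t"
      by (simp add: matrix_inv_mult[OF iM] flip: matrix_mul_assoc)
    then show "matrix_inv (M t) = P t" by (simp add: inv[OF that])
  qed
  have lim_P: "(P \<longlongrightarrow> P t) (at t)" if t: "t \<in> S" for t
  proof -
    have ev: "\<forall>\<^sub>F s in at t. s \<in> S" using S t by (simp add: eventually_at_in_open')
    have "(M \<longlongrightarrow> M t) (at t)"
      using has_vector_derivative_continuous[OF M'(1)[OF t]] by (simp add: continuous_at)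
    then have "((\<lambda>s. matrix_inv (M s)) \<longlongrightarrow> matrix_inv (M t)) (at t)"
      by (rule tendsto_matrix_inv[OF _ inv_M(1)[OF t]])
        (use ev inv_M(1) in \<open>auto elim: eventually_mono\<close>)
    then have "((\<lambda>s. matrix_inv (M s)) \<longlongrightarrow> P t) (at t)" by (simp add: inv_M t)
    then show ?thesis
      by (rule Lim_transform_eventually) (use ev inv_M(2) in \<open>auto elim: eventually_mono\<close>)
  qed
  then have cont_P: "continuous_on S P"
    by (intro continuous_at_imp_continuous_on) (auto simp: continuous_at)
  have "(P has_vector_derivative - (P t ** (M' t ** P t))) (at t)" if t: "t \<in> S" for t
  proof -
    have ev: "\<forall>\<^sub>F s in at t. s \<in> S" using S t by (simp add: eventually_at_in_open')
    have "((\<lambda>s. (1 / (s - t)) *\<^sub>R (M s - M t)) \<longlongrightarrow> M' t) (at t)"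
      using M'(1)[OF t] by (simp add: has_vector_derivative_iff_tendsto)
    then have "((\<lambda>s. - (P s ** (((1 / (s - t)) *\<^sub>R (M s - M t)) ** P t))) \<longlongrightarrow>
        - (P t ** (M' t ** P t))) (at t)"
      by (intro tendsto_minus tendsto_matrix_matrix_mult lim_P t tendsto_const)
    moreover have "\<forall>\<^sub>F s in at t. - (P s ** (((1 / (s - t)) *\<^sub>R (M s - M t)) ** P t)) =
        (1 / (s - t)) *\<^sub>R (P s - P t)"
      using ev
    proof eventually_elim
      case (elim s)
      have "P s ** ((M s - M t) ** P t) = P t - P s"
      proof -
        have "P s ** ((M s - M t) ** P t) = (P s ** M s) ** P t - P s ** (M t ** P t)"
          by (simp add: bounded_bilinear.diff_left[OF bounded_bilinear_matrix_matrix_mult]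
              bounded_bilinear.diff_right[OF bounded_bilinear_matrix_matrix_mult] matrix_mul_assoc)
        then show ?thesis by (simp add: inv elim t)
      qed
      then have "- (P s ** (((1 / (s - t)) *\<^sub>R (M s - M t)) ** P t)) = - ((1 / (s - t)) *\<^sub>R (P t - P s))"
        by (simp only: bounded_bilinear.scaleR_left[OF bounded_bilinear_matrix_matrix_mult]
            bounded_bilinear.scaleR_right[OF bounded_bilinear_matrix_matrix_mult])
      then show ?case by (simp flip: scaleR_minus_right)
    qed
    ultimately have "((\<lambda>s. (1 / (s - t)) *\<^sub>R (P s - P t)) \<longlongrightarrow> - (P t ** (M' t ** P t))) (at t)"
      by (rule Lim_transform_eventually)
    then show ?thesis by (simp add: has_vector_derivative_iff_tendsto)
  qed
  moreover have "continuous_on S (\<lambda>t. - (P t ** (M' t ** P t)))"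
    by (intro continuous_intros continuous_on_matrix_matrix_mult cont_P M'(2))
  ultimately show ?thesis
    unfolding C1_differentiable_on_def by (intro exI[of _ "\<lambda>t. - (P t ** (M' t ** P t))"]) simp
qed

section \<open>Linear differential inequalities up to a finite endpoint\<close>

lemma exp_norm_square_derivative:
  fixes x :: "real \<Rightarrow> 'a::real_inner"
  assumes "(x has_vector_derivative x') (at t)"
  shows "((\<lambda>t. exp (k * t) * (x t \<bullet> x t)) has_real_derivative
    exp (k * t) * (2 * (x t \<bullet> x') + k * (x t \<bullet> x t))) (at t)"
proof -
  have "((\<lambda>t. x t \<bullet> x t) has_vector_derivative (x t \<bullet> x' + x' \<bullet> x t)) (at t)"
    by (rule bounded_bilinear.has_vector_derivative[OF bounded_bilinear_inner assms assms])
  then have "((\<lambda>t. x t \<bullet> x t) has_real_derivative 2 * (x t \<bullet> x')) (at t)"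
    by (simp add: has_real_derivative_iff_has_vector_derivative inner_commute)
  then show ?thesis by (auto intro!: derivative_eq_intros simp: algebra_simps)
qed

text \<open>
  With \<open>k = 2 K + 1\<close> the function \<open>exp (- k t) (norm (x t))\<^sup>2\<close> has a derivative of at most
  \<open>exp (- k t) (h t)\<^sup>2\<close>; so \<open>x\<close> is bounded, its derivative is integrable and \<open>x\<close> has a limit.
\<close>
lemma limit_at_endpoint:
  fixes x :: "real \<Rightarrow> 'a::euclidean_space"
  assumes I: "open I" "{c..<\<beta>} \<subseteq> I" "c < \<beta>"
    and x: "\<And>t. t \<in> I \<Longrightarrow> (x has_vector_derivative x' t) (at t)" "continuous_on I x'"
    and h: "continuous_on I h" "set_integrable lborel {c..<\<beta>} (\<lambda>t. (h t)\<^sup>2)"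
    and K: "K \<ge> 0" "\<And>t. t \<in> {c..<\<beta>} \<Longrightarrow> norm (x' t) \<le> K * norm (x t) + \<bar>h t\<bar>"
  shows "\<exists>l. (x \<longlongrightarrow> l) (at_left \<beta>)"
proof -
  (* 2 (x \<bullet> x') is at most 2 K |x|^2 + 2 |x| |h|, hence at most k |x|^2 + h^2 *)
  define k where "k = 2 * K + 1"
  have k: "k > 0" using K(1) by (simp add: k_def)
  define E where "E t = exp (- k * t) * (x t \<bullet> x t)" for t
  define E' where "E' t = exp (- k * t) * (2 * (x t \<bullet> x' t) + - k * (x t \<bullet> x t))" for t
  have cont_x: "continuous_on I x"
    using x(1) by (intro continuous_at_imp_continuous_on) (blast intro: has_vector_derivative_continuous)
  have dE: "(E has_vector_derivative E' t) (at t)" if "t \<in> I" for t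
    unfolding E_def[abs_def] E'_def has_real_derivative_iff_has_vector_derivative[symmetric]
    by (rule exp_norm_square_derivative[OF x(1)[OF that]])
  have cont_E': "continuous_on I E'"
    unfolding E'_def[abs_def] by (intro continuous_intros cont_x x(2))
  define C where "C = exp (- (k * c)) * (LBINT t:{c..<\<beta>}. (h t)\<^sup>2)"
  have E_le: "E t \<le> E c + C" if t: "t \<in> {c..<\<beta>}" for t
  proof -
    have sub: "{c..t} \<subseteq> I" "{c..t} \<subseteq> {c..<\<beta>}" using t I(2) by auto
    have int_h: "set_integrable lborel {c..t} (\<lambda>t. (h t)\<^sup>2)"
      by (rule set_integrable_subset[OF h(2)]) (use sub in auto)
    have "E t - E c = (LBINT s:{c..t}. E' s)"
      using primitive_onD[OF primitive_on_FTC[OF dE cont_E'], of c t] t sub by simp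
    also have "\<dots> \<le> (LBINT s:{c..t}. exp (- (k * c)) * (h s)\<^sup>2)"
    proof (rule set_integral_mono)
      show "set_integrable lborel {c..t} E'"
        by (intro borel_integrable_atLeastAtMost' continuous_on_subset[OF cont_E' sub(1)])
      show "set_integrable lborel {c..t} (\<lambda>s. exp (- (k * c)) * (h s)\<^sup>2)"
        using int_h by simp
      fix s assume s: "s \<in> {c..t}"
      have "x s \<bullet> x' s \<le> norm (x s) * norm (x' s)" by (rule norm_cauchy_schwarz)
      also have "\<dots> \<le> norm (x s) * (K * norm (x s) + \<bar>h s\<bar>)"
        using s sub by (intro mult_left_mono K(2)) auto
      finally have "2 * (x s \<bullet> x' s) \<le> 2 * K * (x s \<bullet> x s) + 2 * norm (x s) * \<bar>h s\<bar>"
        by (simp add: algebra_simps power2_eq_square flip: power2_norm_eq_inner)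
      also have "2 * norm (x s) * \<bar>h s\<bar> \<le> x s \<bullet> x s + (h s)\<^sup>2"
        using sum_squares_bound[of "norm (x s)" "\<bar>h s\<bar>"] by (simp add: power2_norm_eq_inner)
      finally have "2 * (x s \<bullet> x' s) - k * (x s \<bullet> x s) \<le> (h s)\<^sup>2"
        by (simp add: k_def algebra_simps)
      then have "E' s \<le> exp (- k * s) * (h s)\<^sup>2"
        unfolding E'_def by (intro mult_left_mono) auto
      also have "\<dots> \<le> exp (- (k * c)) * (h s)\<^sup>2"
        using s k by (intro mult_right_mono) auto
      finally show "E' s \<le> exp (- (k * c)) * (h s)\<^sup>2" .
    qed
    also have "\<dots> = exp (- (k * c)) * (LBINT s:{c..t}. (h s)\<^sup>2)"
      by (rule set_integral_mult_right)
    also have "\<dots> \<le> C"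
      unfolding C_def
    proof (intro mult_left_mono)
      show "(LBINT s:{c..t}. (h s)\<^sup>2) \<le> (LBINT s:{c..<\<beta>}. (h s)\<^sup>2)"
        unfolding set_lebesgue_integral_def
        using int_h h(2) sub(2)
        by (intro integral_mono) (auto simp: set_integrable_def indicator_def)
    qed simp
    finally show ?thesis by simp
  qed
  define X where "X = sqrt (exp (k * \<beta>) * (E c + C))"
  have x_le: "norm (x t) \<le> X" if t: "t \<in> {c..<\<beta>}" for t
  proof -
    have E0: "0 \<le> E t" by (simp add: E_def)
    have "(norm (x t))\<^sup>2 = exp (k * t) * E t"
      by (simp add: E_def power2_norm_eq_inner exp_minus field_simps)
    also have "\<dots> \<le> exp (k * \<beta>) * (E c + C)"
      using t k E0 E_le[OF t] by (intro mult_mono) auto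
    finally show ?thesis unfolding X_def by (simp add: real_le_rsqrt)
  qed
  have int_x': "set_integrable lborel {c..<\<beta>} x'"
  proof (rule set_integrable_bound)
    show "set_integrable lborel {c..<\<beta>} (\<lambda>t. K * X + 1 + (h t)\<^sup>2)"
    proof (rule set_integral_add(1)[OF _ h(2)])
      show "set_integrable lborel {c..<\<beta>} (\<lambda>t. K * X + 1)"
        by (rule set_integrable_subset[of _ "{c..\<beta>}"])
          (auto intro!: borel_integrable_atLeastAtMost' continuous_intros)
    qed
    have "(\<lambda>t. indicator {c..<\<beta>} t *\<^sub>R x' t) \<in> borel_measurable borel"
      by (rule borel_measurable_continuous_on_indicator[OF _ continuous_on_subset[OF x(2) I(2)]]) simp
    then show "set_borel_measurable lborel {c..<\<beta>} x'" by (simp add: set_borel_measurable_def)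
    have "norm (x' t) \<le> norm (K * X + 1 + (h t)\<^sup>2)" if t: "t \<in> {c..<\<beta>}" for t
    proof -
      have "norm (x' t) \<le> K * norm (x t) + \<bar>h t\<bar>" by (rule K(2)[OF t])
      also have "K * norm (x t) \<le> K * X" using x_le[OF t] K(1) by (rule mult_left_mono)
      also have "\<bar>h t\<bar> \<le> 1 + (h t)\<^sup>2"
        using sum_squares_bound[of "\<bar>h t\<bar>" 1] by (simp add: power2_eq_square)
      finally show ?thesis by simp
    qed
    then show "AE t in lborel. t \<in> {c..<\<beta>} \<longrightarrow> norm (x' t) \<le> norm (K * X + 1 + (h t)\<^sup>2)" by simp
  qed
  have "((\<lambda>t. x c + (LBINT s:{c..t}. x' s)) \<longlongrightarrow> x c + (LBINT s:{c..<\<beta>}. x' s)) (at_left \<beta>)"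
    by (intro tendsto_intros tendsto_set_lebesgue_integral_at_left[OF I(3) _ int_x']) simp
  moreover have "\<forall>\<^sub>F t in at_left \<beta>. x c + (LBINT s:{c..t}. x' s) = x t"
    using eventually_at_left_real[OF I(3)]
  proof eventually_elim
    case (elim t)
    then have "{c..t} \<subseteq> I" using I(2) by auto
    then show ?case
      using primitive_onD[OF primitive_on_FTC[OF x], of c t] elim by (simp add: diff_eq_eq add.commute)
  qed
  ultimately have "(x \<longlongrightarrow> x c + (LBINT s:{c..<\<beta>}. x' s)) (at_left \<beta>)"
    by (rule Lim_transform_eventually)
  then show ?thesis by blast
qed

text \<open>\<open>exp (2 K t) (norm (x t))\<^sup>2\<close> is nondecreasing and tends to zero.\<close>
lemma zero_at_endpoint_imp_zero:
  fixes x :: "real \<Rightarrow> 'a::euclidean_space"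
  assumes x: "\<And>t. t \<in> {c..<\<beta>} \<Longrightarrow> (x has_vector_derivative x' t) (at t)"
    and K: "\<And>t. t \<in> {c..<\<beta>} \<Longrightarrow> norm (x' t) \<le> K * norm (x t)"
    and lim: "(x \<longlongrightarrow> 0) (at_left \<beta>)" and t: "t \<in> {c..<\<beta>}"
  shows "x t = 0"
proof -
  define E where "E t = exp (2 * K * t) * (x t \<bullet> x t)" for t
  have dE: "(E has_real_derivative exp (2 * K * t) * (2 * (x t \<bullet> x' t) + 2 * K * (x t \<bullet> x t))) (at t)"
    if "t \<in> {c..<\<beta>}" for t
    unfolding E_def[abs_def] by (rule exp_norm_square_derivative[OF x[OF that]])
  have nonneg: "0 \<le> exp (2 * K * t) * (2 * (x t \<bullet> x' t) + 2 * K * (x t \<bullet> x t))"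
    if "t \<in> {c..<\<beta>}" for t
  proof -
    have "- (x t \<bullet> x' t) \<le> norm (x t) * norm (x' t)"
      using Cauchy_Schwarz_ineq2[of "x t" "x' t"] by simp
    also have "\<dots> \<le> norm (x t) * (K * norm (x t))" by (intro mult_left_mono K that) auto
    finally have "0 \<le> 2 * (x t \<bullet> x' t) + 2 * K * (x t \<bullet> x t)"
      by (simp add: power2_eq_square mult_ac flip: power2_norm_eq_inner)
    then show ?thesis by simp
  qed
  have "E t \<le> E s" if ts: "t \<le> s" "s < \<beta>" for s
  proof (rule DERIV_nonneg_imp_nondecreasing[OF ts(1)])
    fix r assume "t \<le> r" "r \<le> s"
    then have "r \<in> {c..<\<beta>}" using t ts by auto
    from dE[OF this] nonneg[OF this] show "\<exists>y. (E has_real_derivative y) (at r) \<and> 0 \<le> y" by blast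
  qed
  then have "\<forall>\<^sub>F s in at_left \<beta>. E t \<le> E s"
    using eventually_at_left_real[of t \<beta>] t by (auto elim!: eventually_mono)
  moreover have "(E \<longlongrightarrow> exp (2 * K * \<beta>) * (0 \<bullet> (0::'a))) (at_left \<beta>)"
    unfolding E_def[abs_def] by (intro tendsto_intros lim)
  ultimately have "E t \<le> exp (2 * K * \<beta>) * (0 \<bullet> (0::'a))"
    by (intro tendsto_lowerbound) auto
  then have "x t \<bullet> x t \<le> 0" by (simp add: E_def mult_le_0_iff not_less)
  then show ?thesis by (metis inner_eq_zero_iff inner_ge_zero antisym)
qed

section \<open>Local integrability of products and square integrable functions\<close>

lemma locally_integrable_on_matrix_vector_mult:
  fixes G :: "real \<Rightarrow> real^'n^'m"
  assumes G: "continuous_on I G" and g: "locally_integrable_on I g"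
  shows "locally_integrable_on I (\<lambda>t. G t *v g t)"
  unfolding locally_integrable_on_def
proof (intro allI impI)
  fix c d assume cd: "{c..d} \<subseteq> I"
  obtain k where k: "\<And>A x. norm ((A :: real^'n^'m) *v x) \<le> norm A * norm x * k"
    using bounded_bilinear.bounded[OF bounded_bilinear_matrix_vector_mult] by blast
  have cont: "continuous_on {c..d} G" using G cd by (rule continuous_on_subset)
  then have "bounded (G ` {c..d})" by (intro compact_imp_bounded compact_continuous_image) auto
  then obtain K where K: "\<And>t. t \<in> {c..d} \<Longrightarrow> norm (G t) \<le> K" unfolding bounded_iff by blast
  have gi: "integrable lborel (\<lambda>t. indicator {c..d} t *\<^sub>R g t)"
    using g cd by (simp add: locally_integrable_on_def set_integrable_def)
  have eq: "indicator {c..d} t *\<^sub>R (G t *v g t) =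
      (indicator {c..d} t *\<^sub>R G t) *v (indicator {c..d} t *\<^sub>R g t)" for t
    by (cases "t \<in> {c..d}") auto
  have G_meas: "(\<lambda>t. indicator {c..d} t *\<^sub>R G t) \<in> borel_measurable borel"
    by (rule borel_measurable_continuous_on_indicator[OF _ cont]) simp
  have "(\<lambda>t. (indicator {c..d} t *\<^sub>R G t) *v (indicator {c..d} t *\<^sub>R g t)) \<in> borel_measurable borel"
  proof (rule borel_measurable_continuous_Pair[OF G_meas, where H = "(*v)"])
    show "(\<lambda>t. indicator {c..d} t *\<^sub>R g t) \<in> borel_measurable borel"
      using borel_measurable_integrable[OF gi] by simp
    show "continuous_on UNIV (\<lambda>x :: (real^'n^'m) \<times> (real^'n). fst x *v snd x)"
      by (intro continuous_on_matrix_vector_mult continuous_intros)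
  qed
  then have meas: "(\<lambda>t. indicator {c..d} t *\<^sub>R (G t *v g t)) \<in> borel_measurable lborel"
    by (simp only: eq measurable_lborel2)
  show "set_integrable lborel {c..d} (\<lambda>t. G t *v g t)"
    unfolding set_integrable_def
  proof (rule Bochner_Integration.integrable_bound[OF _ meas])
    show "integrable lborel (\<lambda>t. (K * \<bar>k\<bar>) *\<^sub>R (indicator {c..d} t *\<^sub>R g t))"
      by (rule Bochner_Integration.integrable_scaleR_right[OF gi])
    have "norm (G t *v g t) \<le> \<bar>K * \<bar>k\<bar>\<bar> * norm (g t)" if t: "t \<in> {c..d}" for t
    proof -
      have "norm (G t *v g t) \<le> norm (G t) * norm (g t) * k" by (rule k)
      also have "\<dots> \<le> norm (G t) * norm (g t) * \<bar>k\<bar>" by (intro mult_left_mono) auto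
      also have "\<dots> \<le> K * norm (g t) * \<bar>k\<bar>" using K[OF t] by (intro mult_right_mono) auto
      finally show ?thesis
        using order_trans[OF norm_ge_zero K[OF t]] by (simp add: mult_ac abs_mult)
    qed
    then show "AE t in lborel. norm (indicator {c..d} t *\<^sub>R (G t *v g t)) \<le>
        norm ((K * \<bar>k\<bar>) *\<^sub>R (indicator {c..d} t *\<^sub>R g t))"
      by (intro AE_I2) (auto simp: indicator_def)
  qed
qed

lemma locally_integrable_on_square_integrable:
  assumes "square_integrable_on I g"
  shows "locally_integrable_on I g"
  unfolding locally_integrable_on_def
proof (intro allI impI)
  fix c d :: real assume cd: "{c..d} \<subseteq> I"
  let ?g = "\<lambda>t. indicator I t *\<^sub>R g t"
  have g: "?g \<in> borel_measurable lborel" "integrable lborel (\<lambda>t. (norm (?g t))\<^sup>2)"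
    using assms by (auto simp: square_integrable_on_def square_integrable_def)
  have "set_integrable lborel {c..d} ?g"
    unfolding set_integrable_def
  proof (rule Bochner_Integration.integrable_bound)
    have "set_integrable lborel {c..d} (\<lambda>t. 1 :: real)"
      by (intro borel_integrable_atLeastAtMost' continuous_on_const)
    then show "integrable lborel (\<lambda>t. indicator {c..d} t *\<^sub>R (1::real) + (norm (?g t))\<^sup>2)"
      using g(2) by (intro Bochner_Integration.integrable_add) (auto simp: set_integrable_def)
    show "(\<lambda>t. indicator {c..d} t *\<^sub>R ?g t) \<in> borel_measurable lborel"
      by (rule borel_measurable_scaleR[OF _ g(1)]) simp
    have "norm x \<le> 1 + (norm x)\<^sup>2" for x :: 'a
      using sum_squares_bound[of "norm x" 1] norm_ge_zero[of x]
      by (simp only: power_one mult_1_right)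
    then show "AE t in lborel. norm (indicator {c..d} t *\<^sub>R ?g t) \<le>
        norm (indicator {c..d} t *\<^sub>R (1::real) + (norm (?g t))\<^sup>2)"
      by (intro AE_I2) (auto simp: indicator_def)
  qed
  moreover have "indicator {c..d} t *\<^sub>R ?g t = indicator {c..d} t *\<^sub>R g t" for t
    using cd by (auto simp: indicator_def)
  ultimately show "set_integrable lborel {c..d} g" by (simp only: set_integrable_def)
qed

lemma square_integrable_on_compact_support:
  fixes f :: "real \<Rightarrow> 'a::euclidean_space"
  assumes f: "continuous_on I f" "{c..d} \<subseteq> I" "\<And>t. t \<in> I \<Longrightarrow> t \<notin> {c..d} \<Longrightarrow> f t = 0"
  shows "square_integrable_on I f"
proof -
  have cont: "continuous_on {c..d} f" using f(1,2) by (rule continuous_on_subset)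
  have eq: "indicator I t *\<^sub>R f t = indicator {c..d} t *\<^sub>R f t" for t
    using f(2,3) by (auto simp: indicator_def)
  have eq2: "(norm (indicator {c..d} t *\<^sub>R f t))\<^sup>2 = indicator {c..d} t *\<^sub>R (norm (f t))\<^sup>2" for t
    by (auto simp: indicator_def)
  have "(\<lambda>t. indicator {c..d} t *\<^sub>R f t) \<in> borel_measurable borel"
    by (rule borel_measurable_continuous_on_indicator[OF _ cont]) simp
  moreover have "set_integrable lborel {c..d} (\<lambda>t. (norm (f t))\<^sup>2)"
    by (intro borel_integrable_atLeastAtMost' continuous_intros cont)
  ultimately show ?thesis
    unfolding square_integrable_on_def square_integrable_def eq eq2 set_integrable_def
    by (simp only: measurable_lborel2 simp_thms)
qed

lemma primitive_on_cong_AE: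
  assumes F: "primitive_on I F f" and f: "locally_integrable_on I f" "locally_integrable_on I g"
    and ae: "AE t in lborel. t \<in> I \<longrightarrow> f t = g t"
  shows "primitive_on I F g"
proof -
  have "(LBINT t:{x..y}. f t) = (LBINT t:{x..y}. g t)" if "{x..y} \<subseteq> I" for x y
    unfolding set_lebesgue_integral_def
  proof (rule integral_cong_AE)
    show "(\<lambda>t. indicator {x..y} t *\<^sub>R f t) \<in> borel_measurable lborel"
      "(\<lambda>t. indicator {x..y} t *\<^sub>R g t) \<in> borel_measurable lborel"
      using f that unfolding locally_integrable_on_def set_integrable_def
      by (blast intro: borel_measurable_integrable)+
    show "AE t in lborel. indicator {x..y} t *\<^sub>R f t = indicator {x..y} t *\<^sub>R g t"
      using ae by eventually_elim (use that in \<open>auto simp: indicator_def\<close>)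
  qed
  then show ?thesis using F by (auto simp: primitive_on_def)
qed

section \<open>Regular functions of a Sturm--Liouville expression\<close>

text \<open>The symplectic form on the boundary values \<open>(u\<^sup>[\<^sup>1\<^sup>](b), u(b))\<close> in Green's formula.\<close>
definition boundary_form :: "'a::real_inner \<times> 'a \<Rightarrow> 'a \<times> 'a \<Rightarrow> real" where
  "boundary_form p q = snd p \<bullet> fst q - fst p \<bullet> snd q"

lemma boundary_form_sum_left:
  "boundary_form (\<Sum>i\<in>J. c i *\<^sub>R p i) q = (\<Sum>i\<in>J. c i * boundary_form (p i) q)"
  by (simp add: boundary_form_def fst_sum snd_sum inner_sum_left sum_subtractf right_diff_distrib)

lemma boundary_form_commute: "boundary_form q p = - boundary_form p q"
  by (simp add: boundary_form_def inner_commute)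

text \<open>
  By linearity the form vanishes against every \<open>q\<close>, in particular against \<open>q = (- p\<^sub>2, p\<^sub>1)\<close>, where it is
  the squared norm of \<open>p\<close>.
\<close>
lemma boundary_form_nondegenerate:
  assumes "\<And>q. q \<in> S \<Longrightarrow> boundary_form q p = 0" "span S = UNIV"
  shows "p = 0"
proof -
  have "subspace {q. boundary_form q p = 0}"
    by (auto simp: subspace_def boundary_form_def inner_add_left)
  then have "span S \<subseteq> {q. boundary_form q p = 0}"
    using assms(1) by (intro span_minimal) auto
  then have "boundary_form (- snd p, fst p) p = 0" using assms(2) by auto
  then have "fst p \<bullet> fst p + snd p \<bullet> snd p = 0" by (simp add: boundary_form_def)
  then show ?thesis
    by (metis add_nonneg_eq_0_iff inner_eq_zero_iff inner_ge_zero prod_eqI fst_zero snd_zero)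
qed

locale sturm_liouville =
  fixes a b :: ereal and P Q R :: "real \<Rightarrow> real^'n^'n"
  assumes less: "a < b"
    and coefficients: "sl_coefficients a b P Q R"
    and regular_endpoint: "regular_right_endpoint b P Q R"
begin

abbreviation I :: "real set" where "I \<equiv> einterval a b"
abbreviation \<beta> :: real where "\<beta> \<equiv> real_of_ereal b"
abbreviation M :: "real \<Rightarrow> real^'n^'n" where "M t \<equiv> matrix_inv (P t)"
abbreviation P' :: "real \<Rightarrow> real^'n^'n" where "P' t \<equiv> vector_derivative P (at t)"
abbreviation Q' :: "real \<Rightarrow> real^'n^'n" where "Q' t \<equiv> vector_derivative Q (at t)"
abbreviation l :: "(real \<Rightarrow> real^'n) \<Rightarrow> real \<Rightarrow> real^'n" where "l \<equiv> sl_expression P Q R"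
abbreviation bv :: "(real \<Rightarrow> real^'n) \<Rightarrow> (real^'n) \<times> (real^'n)" where "bv \<equiv> boundary_value b P Q"
abbreviation L0 :: "((real^'n) l2 \<times> (real^'n) l2) set" where "L0 \<equiv> minimal_operator a b P Q R"
abbreviation Lmax :: "((real^'n) l2 \<times> (real^'n) l2) set" where "Lmax \<equiv> operator_adjoint_in (L2 I) L0"
abbreviation qd :: "(real \<Rightarrow> real^'n) \<Rightarrow> real \<Rightarrow> real^'n" where "qd \<equiv> quasi_derivative P Q"

lemma open_I: "open I"
  by (rule open_einterval)

lemma interval_I: "is_interval I"
  unfolding is_interval_1 by (auto simp: einterval_iff) (meson ereal_less_eq(3) less_le_trans le_less_trans)+

lemma b_eq: "b = ereal \<beta>"
  using regular_endpoint by (cases b) (auto simp: regular_right_endpoint_def)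

lemma I_subset: "c \<in> I \<Longrightarrow> {c..<\<beta>} \<subseteq> I"
  using b_eq by (auto simp: einterval_iff) (metis ereal_less_eq(3) less_le_trans, metis ereal_less_ereal_Ex less_ereal.simps(1))

lemma I_less: "c \<in> I \<Longrightarrow> c < \<beta>"
  by (metis b_eq einterval_iff less_ereal.simps(1))

lemma I_nonempty: "I \<noteq> {}"
  using einterval_nonempty[OF less] by (auto simp: einterval_def)

lemma P_invertible: "t \<in> I \<Longrightarrow> invertible (P t)"
  using coefficients by (simp add: sl_coefficients_def)

lemma P_symmetric: "t \<in> I \<Longrightarrow> transpose (P t) = P t"
  using coefficients symmetric_matrix_inverse[OF P_invertible]
  by (simp add: sl_coefficients_def symmetric_matrix_def)

lemma R_symmetric: "t \<in> I \<Longrightarrow> transpose (R t) = R t"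
  using coefficients by (simp add: sl_coefficients_def symmetric_matrix_def)

lemma C1_M: "M C1_differentiable_on I" and C1_Q: "Q C1_differentiable_on I"
  and continuous_R: "continuous_on I R"
  using coefficients by (simp_all add: sl_coefficients_def)

lemma C1_P: "P C1_differentiable_on I"
  using C1_M open_I
  by (rule C1_differentiable_on_matrix_inverse) (simp_all add: matrix_inv_mult P_invertible)

lemma C1_vector_derivative:
  assumes "f C1_differentiable_on I"
  shows "t \<in> I \<Longrightarrow> (f has_vector_derivative vector_derivative f (at t)) (at t)"
    "continuous_on I (\<lambda>t. vector_derivative f (at t))" "continuous_on I f"
  using assms
  by (auto simp: C1_differentiable_on_eq vector_derivative_works
      intro!: continuous_at_imp_continuous_on differentiable_imp_continuous_within)

lemmas P_deriv = C1_vector_derivative[OF C1_P]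
lemmas Q_deriv = C1_vector_derivative[OF C1_Q]
lemmas M_deriv = C1_vector_derivative[OF C1_M]

lemma continuous_transpose: "continuous_on I G \<Longrightarrow> continuous_on I (\<lambda>t. transpose (G t :: real^'n^'n))"
  by (rule bounded_linear.continuous_on[OF bounded_linear_transpose])

lemma P'_symmetric: "t \<in> I \<Longrightarrow> transpose (P' t) = P' t"
proof -
  assume t: "t \<in> I"
  have "((\<lambda>s. transpose (P s)) has_vector_derivative transpose (P' t)) (at t)"
    by (rule bounded_linear.has_vector_derivative[OF bounded_linear_transpose P_deriv(1)[OF t]])
  then have "(P has_vector_derivative transpose (P' t)) (at t)"
    by (rule has_vector_derivative_transform_within_open[OF _ open_I t]) (simp add: P_symmetric)
  then show "transpose (P' t) = P' t"
    using vector_derivative_at by metis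
qed

text \<open>
  The functions on which the expression \<open>l\<close> is classically defined with continuous values.
\<close>
definition sl_regular :: "(real \<Rightarrow> real^'n) \<Rightarrow> bool" where
  "sl_regular f \<longleftrightarrow> f C1_differentiable_on I \<and> qd f C1_differentiable_on I"

lemma sl_regularI:
  assumes f: "\<And>t. t \<in> I \<Longrightarrow> (f has_vector_derivative f' t) (at t)" "continuous_on I f'"
    and g: "\<And>t. t \<in> I \<Longrightarrow> (g has_vector_derivative g' t) (at t)" "continuous_on I g'"
    and eq: "\<And>t. t \<in> I \<Longrightarrow> P t *v f' t + Q t *v f t = g t"
  shows "sl_regular f"
    and "t \<in> I \<Longrightarrow> l f t = - g' t + transpose (Q t) *v f' t + R t *v f t"
proof -
  have f'_eq: "vector_derivative f (at t) = f' t" if "t \<in> I" for t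
    using f(1)[OF that] by (rule vector_derivative_at)
  have qd: "qd f t = g t" if "t \<in> I" for t
    using eq[OF that] by (simp add: quasi_derivative_def f'_eq that)
  have g': "(qd f has_vector_derivative g' t) (at t)" if "t \<in> I" for t
    by (rule has_vector_derivative_transform_within_open[OF g(1)[OF that] open_I that]) (simp add: qd)
  show "sl_regular f"
    unfolding sl_regular_def C1_differentiable_on_def using f g(2) g' by blast
  show "l f t = - g' t + transpose (Q t) *v f' t + R t *v f t" if "t \<in> I"
    using that by (simp add: sl_expression_def f'_eq vector_derivative_at[OF g'])
qed

lemma sl_regular_deriv:
  assumes "sl_regular f" "t \<in> I"
  shows "(f has_vector_derivative M t *v (qd f t - Q t *v f t)) (at t)"
    "(qd f has_vector_derivative
      transpose (Q t) *v (M t *v (qd f t - Q t *v f t)) + R t *v f t - l f t) (at t)"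
proof -
  have f: "(f has_vector_derivative vector_derivative f (at t)) (at t)"
    using assms C1_vector_derivative(1)[of f t] by (simp add: sl_regular_def)
  have q: "(qd f has_vector_derivative vector_derivative (qd f) (at t)) (at t)"
    using assms C1_vector_derivative(1)[of "qd f" t] by (simp add: sl_regular_def)
  have f_eq: "vector_derivative f (at t) = M t *v (qd f t - Q t *v f t)"
    by (simp add: quasi_derivative_def matrix_inv_vector_mult P_invertible assms(2))
  show "(f has_vector_derivative M t *v (qd f t - Q t *v f t)) (at t)"
    using f by (simp only: f_eq)
  have "vector_derivative (qd f) (at t) =
      transpose (Q t) *v (M t *v (qd f t - Q t *v f t)) + R t *v f t - l f t"
    by (simp add: sl_expression_def f_eq)
  then show "(qd f has_vector_derivative
      transpose (Q t) *v (M t *v (qd f t - Q t *v f t)) + R t *v f t - l f t) (at t)"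
    using q by simp
qed

lemma sl_regular_continuous:
  assumes "sl_regular f"
  shows "continuous_on I f" "continuous_on I (qd f)" "continuous_on I (l f)"
proof -
  note C1 = C1_vector_derivative[of f] C1_vector_derivative[of "qd f"]
  show "continuous_on I f" "continuous_on I (qd f)"
    using assms C1 by (auto simp: sl_regular_def)
  have "continuous_on I (\<lambda>t. - vector_derivative (qd f) (at t) +
      transpose (Q t) *v vector_derivative f (at t) + R t *v f t)"
    using assms C1 by (intro continuous_intros continuous_on_matrix_vector_mult continuous_transpose
        continuous_R Q_deriv(3)) (auto simp: sl_regular_def)
  then show "continuous_on I (l f)" by (simp only: sl_expression_def[abs_def])
qed

lemma smooth_on_sl_regular:
  assumes "smooth_on I f"
  shows "sl_regular f"
proof -
  obtain f1 where f1: "smooth_on I f1" "\<And>t. t \<in> I \<Longrightarrow> (f has_vector_derivative f1 t) (at t)"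
    using smooth_on_derivative_ex[OF assms] by auto
  obtain f2 where f2: "smooth_on I f2" "\<And>t. t \<in> I \<Longrightarrow> (f1 has_vector_derivative f2 t) (at t)"
    using smooth_on_derivative_ex[OF f1(1)] by auto
  obtain f3 where f3: "\<And>t. t \<in> I \<Longrightarrow> (f2 has_vector_derivative f3 t) (at t)"
    using smooth_on_derivative_ex[OF f2(1)] by auto
  have cont: "continuous_on I f" "continuous_on I f1" "continuous_on I f2"
    using f1 f2 f3
    by (auto intro!: continuous_at_imp_continuous_on intro: has_vector_derivative_continuous)
  show ?thesis
  proof (rule sl_regularI(1)[where f' = f1 and g = "\<lambda>t. P t *v f1 t + Q t *v f t"
        and g' = "\<lambda>t. P t *v f2 t + P' t *v f1 t + (Q t *v f1 t + Q' t *v f t)"])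
    show "((\<lambda>t. P t *v f1 t + Q t *v f t) has_vector_derivative
      (P t *v f2 t + P' t *v f1 t + (Q t *v f1 t + Q' t *v f t))) (at t)" if "t \<in> I" for t
      by (intro has_vector_derivative_add has_vector_derivative_matrix_vector_mult
          P_deriv Q_deriv f1 f2 that)
    show "continuous_on I (\<lambda>t. P t *v f2 t + P' t *v f1 t + (Q t *v f1 t + Q' t *v f t))"
      by (intro continuous_on_add continuous_on_matrix_vector_mult P_deriv(2,3) Q_deriv(2,3) cont)
  qed (use f1 cont in auto)
qed

section \<open>Green's formula\<close>

text \<open>
  After the product rule, the terms with \<open>P\<close> and \<open>R\<close> cancel by symmetry, and those with \<open>Q\<close> because \<open>l\<close>
  contains both \<open>Q\<close> and its transpose.
\<close>
lemma green_derivative: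
  assumes f: "sl_regular f" and g: "sl_regular g" and t: "t \<in> I"
  shows "((\<lambda>t. f t \<bullet> qd g t - qd f t \<bullet> g t) has_vector_derivative (l f t \<bullet> g t - f t \<bullet> l g t)) (at t)"
proof -
  let ?f' = "M t *v (qd f t - Q t *v f t)" and ?g' = "M t *v (qd g t - Q t *v g t)"
  have Pf: "qd f t = P t *v ?f' + Q t *v f t" and Pg: "qd g t = P t *v ?g' + Q t *v g t"
    by (simp_all add: matrix_inv_vector_mult P_invertible t)
  have "((\<lambda>t. f t \<bullet> qd g t - qd f t \<bullet> g t) has_vector_derivative
      ((f t \<bullet> (transpose (Q t) *v ?g' + R t *v g t - l g t) + ?f' \<bullet> qd g t) -
       (qd f t \<bullet> ?g' + (transpose (Q t) *v ?f' + R t *v f t - l f t) \<bullet> g t))) (at t)"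
    by (intro has_vector_derivative_diff
        bounded_bilinear.has_vector_derivative[OF bounded_bilinear_inner] sl_regular_deriv f g t)
  moreover have "f t \<bullet> (transpose (Q t) *v ?g') = (Q t *v f t) \<bullet> ?g'"
    "(transpose (Q t) *v ?f') \<bullet> g t = ?f' \<bullet> (Q t *v g t)"
    "f t \<bullet> (R t *v g t) = (R t *v f t) \<bullet> g t"
    "?f' \<bullet> (P t *v ?g') = (P t *v ?f') \<bullet> ?g'"
    by (simp_all only: inner_matrix_left transpose_transpose R_symmetric[OF t] P_symmetric[OF t])
  then have "(f t \<bullet> (transpose (Q t) *v ?g' + R t *v g t - l g t) + ?f' \<bullet> qd g t) -
       (qd f t \<bullet> ?g' + (transpose (Q t) *v ?f' + R t *v f t - l f t) \<bullet> g t) = l f t \<bullet> g t - f t \<bullet> l g t"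
    by (subst (2) Pg, subst (2) Pf)
      (simp add: inner_add_left inner_add_right inner_diff_left inner_diff_right)
  ultimately show ?thesis by simp
qed

end

context sturm_liouville
begin

lemma bounded_near_endpoint:
  fixes G :: "real \<Rightarrow> real^'n^'n"
  assumes G: "continuous_on I G" "(G \<longlongrightarrow> G0) (at_left \<beta>)" and c: "c \<in> I"
  obtains k where "k \<ge> 0" "\<And>t x. t \<in> {c..<\<beta>} \<Longrightarrow> norm (G t *v x) \<le> k * norm x"
proof -
  obtain C where C: "C > 0" "\<And>A x. norm ((A :: real^'n^'n) *v x) \<le> norm A * norm x * C"
    using bounded_bilinear.pos_bounded[OF bounded_bilinear_matrix_vector_mult] by blast
  have "\<forall>\<^sub>F t in at_left \<beta>. norm (G t) < norm G0 + 1"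
    using order_tendstoD(2)[OF tendsto_norm[OF G(2)]] by simp
  then obtain d where d: "d < \<beta>" "\<And>t. d < t \<Longrightarrow> t < \<beta> \<Longrightarrow> norm (G t) < norm G0 + 1"
    unfolding eventually_at_left_field by blast
  define e where "e = max c d"
  have e: "e < \<beta>" "c \<le> e" using d(1) I_less[OF c] by (auto simp: e_def)
  have "continuous_on {c..e} G"
    using G(1) by (rule continuous_on_subset) (use I_subset[OF c] e in auto)
  then have "bounded (G ` {c..e})" by (intro compact_imp_bounded compact_continuous_image) auto
  then obtain B where B: "\<And>t. t \<in> {c..e} \<Longrightarrow> norm (G t) \<le> B" unfolding bounded_iff by blast
  define K where "K = max B (norm G0 + 1)"
  have K: "norm (G t) \<le> K" if "t \<in> {c..<\<beta>}" for t
  proof (cases "t \<le> e")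
    case True
    then show ?thesis using B[of t] that by (simp add: K_def)
  next
    case False
    then show ?thesis using d(2)[of t] that by (simp add: K_def e_def le_max_iff_disj)
  qed
  have K0: "K \<ge> 0" using norm_ge_zero[of G0] by (simp add: K_def le_max_iff_disj)
  show ?thesis
  proof (rule that)
    show "K * C \<ge> 0" using K0 C by simp
    show "norm (G t *v x) \<le> K * C * norm x" if "t \<in> {c..<\<beta>}" for t x
    proof -
      have "norm (G t *v x) \<le> norm (G t) * norm x * C" by (rule C)
      also have "\<dots> \<le> K * norm x * C" using K[OF that] C by (intro mult_right_mono) auto
      finally show ?thesis by (simp add: mult_ac)
    qed
  qed
qed

lemma endpoint_limits:
  obtains Mb Qb Rb where "(M \<longlongrightarrow> Mb) (at_left \<beta>)" "(Q \<longlongrightarrow> Qb) (at_left \<beta>)" "(R \<longlongrightarrow> Rb) (at_left \<beta>)"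
proof -
  obtain Pb where Pb: "invertible Pb" "(P \<longlongrightarrow> Pb) (at_left \<beta>)"
    using regular_endpoint by (auto simp: regular_right_endpoint_def)
  obtain c where c: "c \<in> I" using I_nonempty by blast
  have "\<forall>\<^sub>F t in at_left \<beta>. t \<in> {c<..<\<beta>}" by (rule eventually_at_left_real[OF I_less[OF c]])
  then have "\<forall>\<^sub>F t in at_left \<beta>. invertible (P t)"
  proof eventually_elim
    case (elim t)
    then have "t \<in> {c..<\<beta>}" by simp
    then show ?case using I_subset[OF c] P_invertible by blast
  qed
  from tendsto_matrix_inv[OF Pb(2,1) this] show ?thesis
    using regular_endpoint that by (auto simp: regular_right_endpoint_def)
qed

text \<open>
  The equation as a first order system for the pair of quasi-derivative and value; \<open>P\<close> enters only
  through its inverse \<open>M\<close>, so that limits of the coefficients at \<open>b\<close> control the system near \<open>b\<close>.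
\<close>
definition system_rhs :: "(real \<Rightarrow> real^'n) \<Rightarrow> real \<Rightarrow> (real^'n) \<times> (real^'n)" where
  "system_rhs f t =
    (transpose (Q t) *v (M t *v (qd f t - Q t *v f t)) + R t *v f t - l f t, M t *v (qd f t - Q t *v f t))"

text \<open>
  The coefficients \<open>M\<close>, \<open>Q\<close> and \<open>R\<close> are continuous and have limits at the regular endpoint, hence they
  are bounded on \<open>{c..<\<beta>}\<close>.
\<close>
lemma system_bound:
  assumes c: "c \<in> I"
  obtains K where "K \<ge> 0"
    "\<And>f t. t \<in> {c..<\<beta>} \<Longrightarrow>
      norm (system_rhs f t)
      \<le> K * norm (qd f t, f t) + norm (l f t)"
proof -
  obtain Mb Qb Rb where lim: "(M \<longlongrightarrow> Mb) (at_left \<beta>)" "(Q \<longlongrightarrow> Qb) (at_left \<beta>)" "(R \<longlongrightarrow> Rb) (at_left \<beta>)"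
    by (rule endpoint_limits)
  obtain m where m: "m \<ge> 0" "\<And>t x. t \<in> {c..<\<beta>} \<Longrightarrow> norm (M t *v x) \<le> m * norm x"
    by (rule bounded_near_endpoint[OF M_deriv(3) lim(1) c]) blast
  obtain q where q: "q \<ge> 0" "\<And>t x. t \<in> {c..<\<beta>} \<Longrightarrow> norm (Q t *v x) \<le> q * norm x"
    by (rule bounded_near_endpoint[OF Q_deriv(3) lim(2) c]) blast
  obtain q' where q': "q' \<ge> 0" "\<And>t x. t \<in> {c..<\<beta>} \<Longrightarrow> norm (transpose (Q t) *v x) \<le> q' * norm x"
    by (rule bounded_near_endpoint[OF continuous_transpose[OF Q_deriv(3)]
          bounded_linear.tendsto[OF bounded_linear_transpose lim(2)] c]) blast
  obtain r where r: "r \<ge> 0" "\<And>t x. t \<in> {c..<\<beta>} \<Longrightarrow> norm (R t *v x) \<le> r * norm x"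
    by (rule bounded_near_endpoint[OF continuous_R lim(3) c]) blast
  define k where "k = m * (1 + q)"
  have k: "k \<ge> 0" using m q by (simp add: k_def)
  show ?thesis
  proof (rule that)
    show "0 \<le> q' * k + r + k" using q' r k by simp
    fix f t assume t: "t \<in> {c..<\<beta>}"
    let ?x = "norm (qd f t, f t)"
    let ?f' = "M t *v (qd f t - Q t *v f t)"
    have x: "norm (f t) \<le> ?x" "norm (qd f t) \<le> ?x" by (simp_all add: norm_Pair)
    have "norm (qd f t - Q t *v f t) \<le> norm (qd f t) + norm (Q t *v f t)"
      by (rule norm_triangle_ineq4)
    also have "\<dots> \<le> ?x + q * ?x"
      using x q(2)[OF t, of "f t"] mult_left_mono[OF x(1) q(1)] by linarith
    finally have "norm ?f' \<le> m * (?x + q * ?x)"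
      by (rule order_trans[OF m(2)[OF t] mult_left_mono[OF _ m(1)]])
    also have "\<dots> = k * ?x" by (simp add: k_def algebra_simps)
    finally have f': "norm ?f' \<le> k * ?x" .
    have "norm (transpose (Q t) *v ?f' + R t *v f t - l f t)
        \<le> norm (transpose (Q t) *v ?f') + norm (R t *v f t) + norm (l f t)"
      using norm_triangle_ineq4[of "transpose (Q t) *v ?f' + R t *v f t" "l f t"]
        norm_triangle_ineq[of "transpose (Q t) *v ?f'" "R t *v f t"] by linarith
    also have "\<dots> \<le> q' * (k * ?x) + r * ?x + norm (l f t)"
      using q'(2)[OF t, of ?f'] mult_left_mono[OF f' q'(1)] r(2)[OF t, of "f t"] mult_left_mono[OF x(1) r(1)]
      by linarith
    finally have "norm (transpose (Q t) *v ?f' + R t *v f t - l f t) \<le> q' * (k * ?x) + r * ?x + norm (l f t)" .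
    then show "norm (system_rhs f t) \<le> (q' * k + r + k) * ?x + norm (l f t)"
      unfolding system_rhs_def
      using norm_Pair_le[of "transpose (Q t) *v ?f' + R t *v f t - l f t" ?f'] f'
      by (simp add: algebra_simps)
  qed
qed

lemma boundary_pair_derivative:
  assumes "sl_regular f" "t \<in> I"
  shows "((\<lambda>t. (qd f t, f t)) has_vector_derivative system_rhs f t) (at t)"
  unfolding system_rhs_def by (intro has_vector_derivative_Pair sl_regular_deriv assms)

text \<open>
  By the preceding bound the pair of quasi-derivative and value satisfies the differential inequality of
  \<open>limit_at_endpoint\<close> with \<open>h = norm (l f)\<close>, so the limits that define the boundary value exist.
\<close>
lemma boundary_value_limit:
  assumes f: "sl_regular f" and lf: "square_integrable_on I (l f)"
  shows "((\<lambda>t. (qd f t, f t)) \<longlongrightarrow> bv f) (at_left \<beta>)"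
proof -
  obtain c where c: "c \<in> I" using I_nonempty by blast
  obtain K where K: "K \<ge> 0"
    "\<And>f t. t \<in> {c..<\<beta>} \<Longrightarrow>
      norm (system_rhs f t)
      \<le> K * norm (qd f t, f t) + norm (l f t)"
    by (rule system_bound[OF c]) blast
  note cont = sl_regular_continuous[OF f]
  have "\<exists>x. ((\<lambda>t. (qd f t, f t)) \<longlongrightarrow> x) (at_left \<beta>)"
  proof (rule limit_at_endpoint[OF open_I I_subset[OF c] I_less[OF c] boundary_pair_derivative[OF f] _ _ _ K(1)])
    show "continuous_on I (system_rhs f)"
      unfolding system_rhs_def[abs_def]
      by (intro continuous_on_Pair continuous_on_add continuous_on_diff continuous_on_matrix_vector_mult
          continuous_transpose cont M_deriv(3) Q_deriv(3) continuous_R)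
    show "continuous_on I (\<lambda>t. norm (l f t))" by (intro continuous_on_norm cont)
    show "set_integrable lborel {c..<\<beta>} (\<lambda>t. (norm (l f t))\<^sup>2)"
      by (rule set_integrable_subset[OF square_integrable_on_set_integrable[OF lf] _ I_subset[OF c]]) simp
    show "norm (system_rhs f t)
      \<le> K * norm (qd f t, f t) + \<bar>norm (l f t)\<bar>" if "t \<in> {c..<\<beta>}" for t
      using K(2)[OF that, of f] by simp
  qed
  then obtain x where x: "((\<lambda>t. (qd f t, f t)) \<longlongrightarrow> x) (at_left \<beta>)" by blast
  have "Lim (at_left \<beta>) (qd f) = fst x" "Lim (at_left \<beta>) f = snd x"
    using tendsto_fst[OF x] tendsto_snd[OF x] by (auto intro!: tendsto_Lim)
  then show ?thesis using x by (simp add: boundary_value_def)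
qed

text \<open>
  Uniqueness backwards from the endpoint, on \<open>{t..<\<beta>}\<close> for every \<open>t\<close>.
\<close>
lemma zero_boundary_value_imp_zero:
  assumes f: "sl_regular f" and lf: "\<And>t. t \<in> I \<Longrightarrow> l f t = 0"
    and bv: "((\<lambda>t. (qd f t, f t)) \<longlongrightarrow> 0) (at_left \<beta>)" and t: "t \<in> I"
  shows "f t = 0"
proof -
  obtain K where K: "K \<ge> 0"
    "\<And>f s. s \<in> {t..<\<beta>} \<Longrightarrow>
      norm (system_rhs f s)
      \<le> K * norm (qd f s, f s) + norm (l f s)"
    by (rule system_bound[OF t]) blast
  have "(qd f t, f t) = 0"
  proof (rule zero_at_endpoint_imp_zero[OF _ _ bv])
    fix s assume s: "s \<in> {t..<\<beta>}"
    then have "s \<in> I" using I_subset[OF t] by blast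
    from boundary_pair_derivative[OF f this]
    show "((\<lambda>t. (qd f t, f t)) has_vector_derivative
      system_rhs f s) (at s)" .
    show "norm (system_rhs f s) \<le> K * norm (qd f s, f s)"
      using K(2)[OF s, of f] lf[OF \<open>s \<in> I\<close>] by simp
  next
    show "t \<in> {t..<\<beta>}" using I_less[OF t] by simp
  qed
  then show ?thesis by (simp add: zero_prod_def)
qed

text \<open>There is no contribution of the endpoint \<open>a\<close>, since \<open>f\<close> vanishes near it.\<close>
lemma green_formula:
  assumes f: "sl_regular f" "square_integrable_on I f" "square_integrable_on I (l f)"
    and g: "sl_regular g" "square_integrable_on I g" "square_integrable_on I (l g)"
    and van: "vanishes_near_left a b f"
  shows "L2_class I (l f) \<bullet> L2_class I g - L2_class I f \<bullet> L2_class I (l g) =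
    boundary_form (bv f) (bv g)"
proof -
  obtain c where c: "c \<in> I" "\<And>t. t \<in> I \<Longrightarrow> t < c \<Longrightarrow> f t = 0"
    using van by (auto simp: vanishes_near_left_def)
  let ?F = "\<lambda>t. f t \<bullet> qd g t - qd f t \<bullet> g t"
  let ?G = "\<lambda>t. l f t \<bullet> g t - f t \<bullet> l g t"
  have zero: "?F t = 0" if t: "t \<in> I" "t < c" for t
  proof -
    have "((\<lambda>_. 0) has_vector_derivative 0) (at t)" by (rule has_vector_derivative_const)
    then have "(f has_vector_derivative 0) (at t)"
      by (rule has_vector_derivative_transform_within_open[where S = "I \<inter> {..<c}"])
        (use t c(2) open_I in auto)
    then have "vector_derivative f (at t) = 0" by (rule vector_derivative_at)
    then show ?thesis using c(2)[OF t] by (simp add: quasi_derivative_def)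
  qed
  have int: "set_integrable lborel I (\<lambda>t. l f t \<bullet> g t)" "set_integrable lborel I (\<lambda>t. f t \<bullet> l g t)"
    by (intro set_integrable_inner_L2 f g)+
  have "L2_class I (l f) \<bullet> L2_class I g - L2_class I f \<bullet> L2_class I (l g) = (LBINT t:I. ?G t)"
    using int by (simp add: inner_L2_class f g)
  also have "\<dots> = (LBINT t=a..b. ?G t)"
    using less_imp_le[OF less] by (simp add: interval_lebesgue_integral_def)
  also have "\<dots> = boundary_form (bv f) (bv g) - 0"
  proof (rule interval_integral_FTC_integrable[OF less])
    show "(?F has_vector_derivative ?G t) (at t)" if "a < ereal t" "ereal t < b" for t
      by (rule green_derivative[OF f(1) g(1)]) (use that in \<open>simp add: einterval_iff\<close>)
    have "continuous_on I ?G"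
      by (intro continuous_intros sl_regular_continuous f g)
    then show "isCont ?G t" if "a < ereal t" "ereal t < b" for t
      using that open_I by (simp add: continuous_on_eq_continuous_at einterval_iff)
    show "set_integrable lborel I ?G" using int by simp
    have "a < ereal c" using c(1) by (simp add: einterval_iff)
    then have "\<forall>\<^sub>F s in at_right a. s \<in> {a<..<ereal c}" by (intro eventually_at_rightI)
    then have "\<forall>\<^sub>F s in at_right a. (?F \<circ> real_of_ereal) s = 0"
    proof eventually_elim
      case (elim s)
      obtain t where t: "s = ereal t" using elim by (cases s) auto
      have "ereal t < b"
        using less_trans[of "ereal t" "ereal c" b] elim c(1) t by (auto simp: einterval_iff)
      then have "t \<in> I" "t < c" using elim t by (auto simp: einterval_iff)
      then show ?case using zero t by simp
    qed
    then show "((?F \<circ> real_of_ereal) \<longlongrightarrow> 0) (at_right a)" by (rule tendsto_eventually)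
    have "(?F \<longlongrightarrow> snd (bv f) \<bullet> fst (bv g)
        - fst (bv f) \<bullet> snd (bv g)) (at_left \<beta>)"
      using tendsto_fst[OF boundary_value_limit[OF f(1,3)]] tendsto_snd[OF boundary_value_limit[OF f(1,3)]]
        tendsto_fst[OF boundary_value_limit[OF g(1,3)]] tendsto_snd[OF boundary_value_limit[OF g(1,3)]]
      by (intro tendsto_intros) simp_all
    then have "((?F \<circ> real_of_ereal) \<longlongrightarrow>
        boundary_form (bv f) (bv g)) (at_left (ereal \<beta>))"
      by (simp only: ereal_tendsto_simps boundary_form_def)
    then show "((?F \<circ> real_of_ereal) \<longlongrightarrow>
        boundary_form (bv f) (bv g)) (at_left b)"
      by (simp only: b_eq[symmetric])
  qed
  finally show ?thesis by simp
qed

section \<open>The adjoint of the minimal operator\<close>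

lemma test_function_scaleR:
  assumes "\<phi> \<in> smooth_compact I"
  shows "(\<lambda>t. \<phi> t *\<^sub>R e) \<in> test_functions a b"
proof -
  obtain c d where *: "smooth_on UNIV \<phi>" "c < d" "{c..d} \<subseteq> I" "\<And>t. t \<notin> {c<..<d} \<Longrightarrow> \<phi> t = 0"
    using smooth_compactE[OF assms] by metis
  have "smooth_on UNIV (\<lambda>t. \<phi> t *\<^sub>R e)" by (intro smooth_on_scaleR smooth_on_const *)
  moreover have "\<phi> t *\<^sub>R e = 0" if "t \<notin> {c..d}" for t using *(4)[of t] that by auto
  ultimately show ?thesis
    unfolding test_functions_def using *(3) compact_Icc[of c d] by blast
qed

lemma smooth_on_subset: "smooth_on S f \<Longrightarrow> T \<subseteq> S \<Longrightarrow> smooth_on T f"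
  unfolding smooth_on_def by blast

lemma test_function_sl_regular:
  assumes "\<phi> \<in> smooth_compact I"
  shows "sl_regular (\<lambda>t. \<phi> t *\<^sub>R e)"
proof -
  have "smooth_on UNIV (\<lambda>t. \<phi> t *\<^sub>R e)"
    using test_function_scaleR[OF assms, of e] unfolding test_functions_def by blast
  then show ?thesis by (rule smooth_on_sl_regular[OF smooth_on_subset]) simp
qed

lemma sl_expression_test_function:
  assumes \<phi>: "\<And>t. (\<phi> has_vector_derivative \<phi>' t) (at t)" "\<And>t. (\<phi>' has_vector_derivative \<phi>'' t) (at t)"
    and t: "t \<in> I"
  shows "l (\<lambda>t. \<phi> t *\<^sub>R e) t =
    - (\<phi>'' t *\<^sub>R (P t *v e) + \<phi>' t *\<^sub>R (P' t *v e + Q t *v e) + \<phi> t *\<^sub>R (Q' t *v e))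
    + \<phi>' t *\<^sub>R (transpose (Q t) *v e) + \<phi> t *\<^sub>R (R t *v e)"
proof -
  have d: "((\<lambda>t. \<psi> t *\<^sub>R e) has_vector_derivative \<psi>' *\<^sub>R e) (at t)"
    if "(\<psi> has_vector_derivative \<psi>') (at t)" for \<psi> \<psi>' t
    using bounded_linear.has_vector_derivative[OF bounded_linear_scaleR_left that] .
  have f': "vector_derivative (\<lambda>t. \<phi> t *\<^sub>R e) (at t) = \<phi>' t *\<^sub>R e" for t
    by (rule vector_derivative_at[OF d[OF \<phi>(1)]])
  have "qd (\<lambda>t. \<phi> t *\<^sub>R e) = (\<lambda>t. P t *v (\<phi>' t *\<^sub>R e) + Q t *v (\<phi> t *\<^sub>R e))"
    by (simp add: quasi_derivative_def[abs_def] f')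
  moreover have "((\<lambda>t. P t *v (\<phi>' t *\<^sub>R e) + Q t *v (\<phi> t *\<^sub>R e)) has_vector_derivative
      ((P t *v (\<phi>'' t *\<^sub>R e) + P' t *v (\<phi>' t *\<^sub>R e)) + (Q t *v (\<phi>' t *\<^sub>R e) + Q' t *v (\<phi> t *\<^sub>R e)))) (at t)"
    by (intro has_vector_derivative_add has_vector_derivative_matrix_vector_mult d \<phi> P_deriv(1) Q_deriv(1) t)
  ultimately have "vector_derivative (qd (\<lambda>t. \<phi> t *\<^sub>R e)) (at t) =
      (P t *v (\<phi>'' t *\<^sub>R e) + P' t *v (\<phi>' t *\<^sub>R e)) + (Q t *v (\<phi>' t *\<^sub>R e) + Q' t *v (\<phi> t *\<^sub>R e))"
    by (simp add: vector_derivative_at)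
  then show ?thesis
    by (simp add: sl_expression_def f' matrix_vector_mult_scaleR scaleR_add_right)
qed

lemma test_function_support:
  assumes "\<phi> \<in> smooth_compact I"
  obtains c d where "c < d" "{c..d} \<subseteq> I" "\<And>t. t \<notin> {c<..<d} \<Longrightarrow> \<phi> t = 0"
    "\<And>t e. t \<in> I \<Longrightarrow> t \<notin> {c<..<d} \<Longrightarrow> l (\<lambda>t. \<phi> t *\<^sub>R e) t = 0"
    "\<And>t e. t \<notin> {c<..<d} \<Longrightarrow> qd (\<lambda>t. \<phi> t *\<^sub>R e) t = 0"
proof -
  obtain c d where *: "smooth_on UNIV \<phi>" "c < d" "{c..d} \<subseteq> I" "\<And>t. t \<notin> {c<..<d} \<Longrightarrow> \<phi> t = 0"
    using smooth_compactE[OF assms] by metis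
  obtain \<phi>' where \<phi>': "\<phi>' \<in> smooth_compact I" "\<And>t. (\<phi> has_vector_derivative \<phi>' t) (at t)"
    "\<And>t. t \<notin> {c<..<d} \<Longrightarrow> \<phi>' t = 0"
    using smooth_compact_derivative[OF assms] *(2,4) by metis
  obtain \<phi>'' where \<phi>'': "\<phi>'' \<in> smooth_compact I" "\<And>t. (\<phi>' has_vector_derivative \<phi>'' t) (at t)"
    "\<And>t. t \<notin> {c<..<d} \<Longrightarrow> \<phi>'' t = 0"
    using smooth_compact_derivative[OF \<phi>'(1)] *(2) \<phi>'(3) by metis
  show ?thesis
  proof (rule that[OF *(2,3,4)])
    show "l (\<lambda>t. \<phi> t *\<^sub>R e) t = 0" if "t \<in> I" "t \<notin> {c<..<d}" for t e
      using sl_expression_test_function[OF \<phi>'(2) \<phi>''(2) that(1), of e]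
      by (simp add: *(4)[OF that(2)] \<phi>'(3)[OF that(2)] \<phi>''(3)[OF that(2)])
    show "qd (\<lambda>t. \<phi> t *\<^sub>R e) t = 0" if "t \<notin> {c<..<d}" for t e
    proof -
      have "((\<lambda>t. \<phi> t *\<^sub>R e) has_vector_derivative \<phi>' t *\<^sub>R e) (at t)"
        using bounded_linear.has_vector_derivative[OF bounded_linear_scaleR_left \<phi>'(2)] .
      then show ?thesis
        by (simp add: quasi_derivative_def vector_derivative_at *(4)[OF that] \<phi>'(3)[OF that])
    qed
  qed
qed

lemma test_function_square_integrable:
  assumes "\<phi> \<in> smooth_compact I"
  shows "square_integrable_on I (\<lambda>t. \<phi> t *\<^sub>R e)" "square_integrable_on I (l (\<lambda>t. \<phi> t *\<^sub>R e))"
proof -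
  obtain c d where *: "c < d" "{c..d} \<subseteq> I" "\<And>t. t \<notin> {c<..<d} \<Longrightarrow> \<phi> t = 0"
    "\<And>t e. t \<in> I \<Longrightarrow> t \<notin> {c<..<d} \<Longrightarrow> l (\<lambda>t. \<phi> t *\<^sub>R e) t = 0"
    using test_function_support[OF assms] by metis
  note cont = sl_regular_continuous[OF test_function_sl_regular[OF assms]]
  have outside: "t \<notin> {c<..<d}" if "t \<notin> {c..d}" for t using that by auto
  show "square_integrable_on I (\<lambda>t. \<phi> t *\<^sub>R e)"
    by (rule square_integrable_on_compact_support[OF cont(1) *(2)]) (metis *(3) outside scaleR_zero_left)
  show "square_integrable_on I (l (\<lambda>t. \<phi> t *\<^sub>R e))"
    by (rule square_integrable_on_compact_support[OF cont(3) *(2) *(4)[OF _ outside]])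
qed

lemma green_formula_test_function:
  assumes \<phi>: "\<phi> \<in> smooth_compact I" and g: "sl_regular g"
  shows "(LBINT t:I. l (\<lambda>t. \<phi> t *\<^sub>R e) t \<bullet> g t) = (LBINT t:I. (\<phi> t *\<^sub>R e) \<bullet> l g t)"
proof -
  let ?u = "\<lambda>t. \<phi> t *\<^sub>R e"
  obtain c d where *: "c < d" "{c..d} \<subseteq> I" "\<And>t. t \<notin> {c<..<d} \<Longrightarrow> \<phi> t = 0"
    "\<And>t. t \<in> I \<Longrightarrow> t \<notin> {c<..<d} \<Longrightarrow> l ?u t = 0" "\<And>t. t \<notin> {c<..<d} \<Longrightarrow> qd ?u t = 0"
    using test_function_support[OF \<phi>] by metis
  note u = test_function_sl_regular[OF \<phi>, of e]
  note cont = sl_regular_continuous[OF u] sl_regular_continuous[OF g]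
  have cont1: "continuous_on I (\<lambda>t. l ?u t \<bullet> g t)" and cont2: "continuous_on I (\<lambda>t. ?u t \<bullet> l g t)"
    by (intro continuous_on_inner cont)+
  have "primitive_on I (\<lambda>t. ?u t \<bullet> qd g t - qd ?u t \<bullet> g t) (\<lambda>t. l ?u t \<bullet> g t - ?u t \<bullet> l g t)"
    by (intro primitive_on_FTC green_derivative u g continuous_on_diff cont1 cont2)
  from primitive_onD[OF this less_imp_le[OF *(1)] *(2)]
  have "(LBINT t:{c..d}. l ?u t \<bullet> g t - ?u t \<bullet> l g t) = 0"
    using *(3)[of c] *(3)[of d] *(5)[of c] *(5)[of d] by simp
  moreover have "set_integrable lborel {c..d} (\<lambda>t. l ?u t \<bullet> g t)" "set_integrable lborel {c..d} (\<lambda>t. ?u t \<bullet> l g t)"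
    by (intro borel_integrable_atLeastAtMost' continuous_on_subset[OF cont1 *(2)]
        continuous_on_subset[OF cont2 *(2)])+
  ultimately have eq: "(LBINT t:{c..d}. l ?u t \<bullet> g t) = (LBINT t:{c..d}. ?u t \<bullet> l g t)"
    by (simp add: set_integral_diff)
  have "indicator I t *\<^sub>R (l ?u t \<bullet> g t) = indicator {c..d} t *\<^sub>R (l ?u t \<bullet> g t)"
    "indicator I t *\<^sub>R (?u t \<bullet> l g t) = indicator {c..d} t *\<^sub>R (?u t \<bullet> l g t)" for t
    using *(2) *(3,4)[of t] by (cases "t \<in> I"; cases "t \<in> {c..d}"; auto)+
  then show ?thesis using eq unfolding set_lebesgue_integral_def by (simp only:)
qed

lemma minimal_operator_test_function:
  assumes "\<phi> \<in> smooth_compact I"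
  shows "(L2_class I (\<lambda>t. \<phi> t *\<^sub>R e), L2_class I (l (\<lambda>t. \<phi> t *\<^sub>R e))) \<in> L0"
  unfolding minimal_operator_def
  by (rule subsetD[OF closure_subset]) (use test_function_scaleR[OF assms] in blast)

lemma integral_test_function_inner:
  assumes \<phi>: "\<phi> \<in> smooth_compact I" and h: "locally_integrable_on I h"
  shows "(LBINT t:I. (\<phi> t *\<^sub>R e) \<bullet> h t) = e \<bullet> (LBINT t. \<phi> t *\<^sub>R h t)"
proof -
  obtain c d where *: "c < d" "{c..d} \<subseteq> I" "\<And>t. t \<notin> {c<..<d} \<Longrightarrow> \<phi> t = 0"
    using smooth_compactE[OF \<phi>] by metis
  have "indicator I t *\<^sub>R ((\<phi> t *\<^sub>R e) \<bullet> h t) = e \<bullet> (\<phi> t *\<^sub>R h t)" for t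
  proof (cases "t \<in> {c<..<d}")
    case True
    then have "t \<in> I" using *(2) by auto
    then show ?thesis by simp
  next
    case False
    from *(3)[OF this] show ?thesis by simp
  qed
  then show ?thesis
    using smooth_compact_integrable[OF h \<phi>]
    by (simp only: set_lebesgue_integral_def integral_inner_right)
qed

text \<open>Green's formula against all test functions determines the value of the adjoint.\<close>
lemma adjoint_sl_regular:
  assumes f: "sl_regular f" "square_integrable_on I f"
    and adj: "(L2_class I f, y) \<in> Lmax"
  shows "square_integrable_on I (l f)" "y = L2_class I (l f)"
proof -
  obtain g where g: "square_integrable_on I g" "y = L2_class I g"
    using adj by (auto simp: operator_adjoint_in_def mem_L2_iff)
  note cont = sl_regular_continuous[OF f(1)]
  have loc: "locally_integrable_on I g" "locally_integrable_on I (l f)"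
    by (rule locally_integrable_on_square_integrable[OF g(1)])
      (rule locally_integrable_on_continuous[OF cont(3)])
  have "AE t in lborel. t \<in> I \<longrightarrow> g t - l f t = 0"
  proof (rule fundamental_lemma[OF locally_integrable_on_diff[OF loc] open_I])
    fix \<phi> assume \<phi>: "\<phi> \<in> smooth_compact I"
    have "e \<bullet> (LBINT t. \<phi> t *\<^sub>R g t) = e \<bullet> (LBINT t. \<phi> t *\<^sub>R l f t)" for e
    proof -
      let ?u = "\<lambda>t. \<phi> t *\<^sub>R e"
      have "L2_class I (l ?u) \<bullet> L2_class I f = L2_class I ?u \<bullet> y"
        using adj minimal_operator_test_function[OF \<phi>, of e] by (auto simp: operator_adjoint_in_def)
      then have "(LBINT t:I. l ?u t \<bullet> f t) = (LBINT t:I. ?u t \<bullet> g t)"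
        using test_function_square_integrable[OF \<phi>] f(2) g by (simp add: inner_L2_class)
      then show ?thesis
        using green_formula_test_function[OF \<phi> f(1), of e]
        by (simp only: integral_test_function_inner[OF \<phi>] loc)
    qed
    then have "(LBINT t. \<phi> t *\<^sub>R g t) = (LBINT t. \<phi> t *\<^sub>R l f t)"
      by (rule vector_eq_ldot[THEN iffD1, OF allI])
    then show "(LBINT t. \<phi> t *\<^sub>R (g t - l f t)) = 0"
      using smooth_compact_integrable[OF loc(1) \<phi>] smooth_compact_integrable[OF loc(2) \<phi>]
      by (simp add: scaleR_diff_right)
  qed
  then have ae: "AE t in lborel. t \<in> I \<longrightarrow> g t = l f t" by simp
  have "(\<lambda>t. indicator I t *\<^sub>R l f t) \<in> borel_measurable borel"
    by (rule borel_measurable_continuous_on_indicator[OF _ cont(3)]) (use open_I in simp)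
  then show sq: "square_integrable_on I (l f)"
    by (intro square_integrable_on_cong_AE[OF g(1) _ ae]) (simp only: measurable_lborel2)
  show "y = L2_class I (l f)" using ae by (simp add: g(2) L2_class_eq_iff[OF g(1) sq])
qed

end

context sturm_liouville
begin

text \<open>
  Written out, orthogonality to \<open>l u\<close> for all test functions \<open>u\<close> is a weak equation of second order
  for \<open>P g\<close>.  Integrating it twice shows that \<open>P g\<close> is absolutely continuous up to a null set; then
  its derivative is continuous, hence \<open>g\<close> is continuously differentiable, and the first integral of
  the equation says that \<open>g\<^sup>[\<^sup>1\<^sup>]\<close> is continuously differentiable as well.
\<close>
lemma adjoint_kernel_classical:
  assumes g: "square_integrable_on I g"
    and ker: "(L2_class I g, 0) \<in> Lmax"
  obtains w where "sl_regular w" "square_integrable_on I w" "L2_class I w = L2_class I g"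
    "\<And>t. t \<in> I \<Longrightarrow> l w t = 0"
proof -
  note loc_g = locally_integrable_on_square_integrable[OF g]
  note loc = locally_integrable_on_matrix_vector_mult[OF _ loc_g]
  define A where "A t = P t *v g t" for t
  define B where "B x t = transpose (P' t) *v x t + transpose (Q t) *v x t - Q t *v x t"
    for x :: "real \<Rightarrow> real^'n" and t
  define C where "C x t = transpose (Q' t) *v x t - R t *v x t"
    for x :: "real \<Rightarrow> real^'n" and t
  note cont_coeff = P_deriv(2,3) Q_deriv(2,3) continuous_R
    P_deriv(2,3)[THEN continuous_transpose] Q_deriv(2,3)[THEN continuous_transpose]
  have A_loc: "locally_integrable_on I A"
    unfolding A_def[abs_def] by (intro loc cont_coeff)
  have B_loc: "locally_integrable_on I (B g)"
    unfolding B_def[abs_def]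
    by (intro locally_integrable_on_diff locally_integrable_on_add loc cont_coeff)
  have C_loc: "locally_integrable_on I (C g)"
    unfolding C_def[abs_def] by (intro locally_integrable_on_diff loc cont_coeff)
  have weak: "(LBINT t. \<phi>'' t *\<^sub>R A t + \<phi>' t *\<^sub>R B g t + \<phi> t *\<^sub>R C g t) = 0"
    if \<phi>: "\<phi> \<in> smooth_compact I" "\<phi>' \<in> smooth_compact I" "\<phi>'' \<in> smooth_compact I"
      "\<And>t. (\<phi> has_vector_derivative \<phi>' t) (at t)" "\<And>t. (\<phi>' has_vector_derivative \<phi>'' t) (at t)"
    for \<phi> \<phi>' \<phi>''
  proof -
    let ?h = "\<lambda>t. \<phi>'' t *\<^sub>R A t + \<phi>' t *\<^sub>R B g t + \<phi> t *\<^sub>R C g t"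
    have int: "integrable lborel ?h"
      by (intro Bochner_Integration.integrable_add smooth_compact_integrable[OF A_loc \<phi>(3)]
          smooth_compact_integrable[OF B_loc \<phi>(2)] smooth_compact_integrable[OF C_loc \<phi>(1)])
    have orth: "e \<bullet> (LBINT t. ?h t) = 0" for e
    proof -
      let ?u = "\<lambda>t. \<phi> t *\<^sub>R e"
      have "L2_class I (l ?u) \<bullet> L2_class I g = 0"
        using ker minimal_operator_test_function[OF \<phi>(1), of e] by (auto simp: operator_adjoint_in_def)
      then have "(LBINT t:I. l ?u t \<bullet> g t) = 0"
        using test_function_square_integrable[OF \<phi>(1)] g by (simp add: inner_L2_class)
      moreover have "indicator I t *\<^sub>R (l ?u t \<bullet> g t) = - (e \<bullet> ?h t)" for t
      proof (cases "t \<in> I")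
        case True
        have "l ?u t \<bullet> g t = - (e \<bullet> ?h t)"
          unfolding sl_expression_test_function[OF \<phi>(4,5) True] A_def B_def C_def
          by (simp add: inner_add_left inner_add_right inner_diff_left inner_diff_right inner_matrix_left dot_lmul_matrix
              P_symmetric R_symmetric True algebra_simps)
        then show ?thesis using True by simp
      next
        case False
        have "\<psi> t = 0" if \<psi>: "\<psi> \<in> smooth_compact I" for \<psi>
        proof -
          obtain c d where cd: "{c..d} \<subseteq> I" "\<And>t. t \<notin> {c<..<d} \<Longrightarrow> \<psi> t = 0"
            using smooth_compactE[OF \<psi>] by metis
          have "t \<notin> {c..d}" using cd(1) False by blast
          then show ?thesis by (intro cd(2)) auto
        qed
        from this[OF \<phi>(1)] this[OF \<phi>(2)] this[OF \<phi>(3)] show ?thesis using False by simp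
      qed
      ultimately have "(LBINT t. - (e \<bullet> ?h t)) = 0"
        by (simp only: set_lebesgue_integral_def)
      then show ?thesis using int by (simp only: integral_minus integral_inner_right neg_equal_0_iff_equal)
    qed
    from orth[of "LBINT t. ?h t"] show ?thesis by (simp only: inner_eq_zero_iff)
  qed
  obtain c1 d1 where prim: "primitive_on I c1 (C g)" "primitive_on I d1 (\<lambda>t. B g t - c1 t)"
    and ae: "AE t in lborel. t \<in> I \<longrightarrow> A t = d1 t"
  proof (rule weak_equation_integrated[OF A_loc B_loc C_loc open_I interval_I])
    fix \<phi> \<phi>' \<phi>'' :: "real \<Rightarrow> real"
    assume "\<phi> \<in> smooth_compact I" "\<phi>' \<in> smooth_compact I" "\<phi>'' \<in> smooth_compact I"
      "\<And>t. (\<phi> has_vector_derivative \<phi>' t) (at t)" "\<And>t. (\<phi>' has_vector_derivative \<phi>'' t) (at t)"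
    then show "(LBINT t. \<phi>'' t *\<^sub>R A t + \<phi>' t *\<^sub>R B g t + \<phi> t *\<^sub>R C g t) = 0"
      by (rule weak)
  qed blast
  define w where "w t = M t *v d1 t" for t
  have Pw: "P t *v w t = d1 t" if "t \<in> I" for t
    using that by (simp add: w_def matrix_inv_vector_mult P_invertible)
  have cont_c1: "continuous_on I c1" and cont_d1: "continuous_on I d1"
    using prim by (simp_all add: primitive_on_def)
  have cont_w: "continuous_on I w"
    unfolding w_def[abs_def] by (intro continuous_on_matrix_vector_mult M_deriv(3) cont_d1)
  have w_ae: "AE t in lborel. t \<in> I \<longrightarrow> g t = w t"
    using ae
  proof eventually_elim
    case (elim t)
    then show ?case
      using matrix_inv_vector_mult(2)[OF P_invertible, of t "g t"] by (auto simp: w_def A_def)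
  qed
  have cont_B: "continuous_on I (\<lambda>t. B w t - c1 t)"
    unfolding B_def[abs_def]
    by (intro continuous_on_diff continuous_on_add continuous_on_matrix_vector_mult cont_coeff cont_w cont_c1)
  have cont_C: "continuous_on I (C w)"
    unfolding C_def[abs_def]
    by (intro continuous_on_diff continuous_on_matrix_vector_mult cont_coeff cont_w)
  have "AE t in lborel. t \<in> I \<longrightarrow> C g t = C w t"
    using w_ae by eventually_elim (simp add: C_def)
  from primitive_on_cong_AE[OF prim(1) C_loc locally_integrable_on_continuous[OF cont_C] this]
  have c1': "(c1 has_vector_derivative C w t) (at t)" if "t \<in> I" for t
    by (rule primitive_on_has_vector_derivative[OF _ cont_C open_I that])
  have loc_Bc: "locally_integrable_on I (\<lambda>t. B g t - c1 t)"
    by (intro locally_integrable_on_diff B_loc locally_integrable_on_continuous cont_c1)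
  have "AE t in lborel. t \<in> I \<longrightarrow> B g t - c1 t = B w t - c1 t"
    using w_ae by eventually_elim (simp add: B_def)
  from primitive_on_cong_AE[OF prim(2) loc_Bc locally_integrable_on_continuous[OF cont_B] this]
  have d1': "(d1 has_vector_derivative (B w t - c1 t)) (at t)" if "t \<in> I" for t
    by (rule primitive_on_has_vector_derivative[OF _ cont_B open_I that])
  define w' where "w' t = M t *v (B w t - c1 t) + vector_derivative M (at t) *v d1 t" for t
  have w': "(w has_vector_derivative w' t) (at t)" if "t \<in> I" for t
    unfolding w_def[abs_def] w'_def
    by (intro has_vector_derivative_matrix_vector_mult M_deriv(1) d1'[unfolded w_def[abs_def]] that)
  have cont_w': "continuous_on I w'"
    unfolding w'_def[abs_def]
    by (intro continuous_on_add continuous_on_matrix_vector_mult M_deriv(2,3) cont_B cont_d1)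
  have eq: "P t *v w' t + Q t *v w t = transpose (Q t) *v w t - c1 t" if t: "t \<in> I" for t
  proof -
    have "((\<lambda>t. P t *v w t) has_vector_derivative (P t *v w' t + P' t *v w t)) (at t)"
      by (intro has_vector_derivative_matrix_vector_mult P_deriv(1) w' t)
    then have "(d1 has_vector_derivative (P t *v w' t + P' t *v w t)) (at t)"
      by (rule has_vector_derivative_transform_within_open[OF _ open_I t]) (simp add: Pw)
    then have "P t *v w' t + P' t *v w t = B w t - c1 t"
      using d1'[OF t] by (rule vector_derivative_unique_at)
    then show ?thesis by (simp add: B_def P'_symmetric t algebra_simps)
  qed
  have qder: "((\<lambda>t. transpose (Q t) *v w t - c1 t) has_vector_derivative
      (transpose (Q t) *v w' t + transpose (Q' t) *v w t - C w t)) (at t)" if t: "t \<in> I" for t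
    by (intro has_vector_derivative_diff has_vector_derivative_matrix_vector_mult c1' w' t
        bounded_linear.has_vector_derivative[OF bounded_linear_transpose Q_deriv(1)])
  have qcont: "continuous_on I (\<lambda>t. transpose (Q t) *v w' t + transpose (Q' t) *v w t - C w t)"
    by (intro continuous_on_diff continuous_on_add continuous_on_matrix_vector_mult cont_coeff
        cont_w cont_w' cont_C)
  note reg = sl_regularI[OF w' cont_w' qder qcont eq]
  have "(\<lambda>t. indicator I t *\<^sub>R w t) \<in> borel_measurable borel"
    by (rule borel_measurable_continuous_on_indicator[OF _ cont_w]) (use open_I in simp)
  then have sq: "square_integrable_on I w"
    by (intro square_integrable_on_cong_AE[OF g _ w_ae]) (simp only: measurable_lborel2)
  show ?thesis
  proof (rule that)
    show "sl_regular w" by (rule reg(1))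
    show "L2_class I w = L2_class I g" using w_ae by (simp add: L2_class_eq_iff[OF g sq] eq_commute[of "L2_class I w"])
    show "l w t = 0" if "t \<in> I" for t
      using reg(2) that by (simp add: C_def)
  qed (rule sq)
qed

text \<open>
  By Green's formula \<open>y i \<bullet> v\<close> is the boundary form of \<open>z i\<close> and the classical solution representing
  \<open>v\<close>.  Hence this solution has zero boundary values and vanishes.
\<close>
lemma adjoint_kernel_detected:
  assumes z: "\<And>i. i \<in> J \<Longrightarrow> sl_regular (z i)" "\<And>i. i \<in> J \<Longrightarrow> square_integrable_on I (z i)"
      "\<And>i. i \<in> J \<Longrightarrow> vanishes_near_left a b (z i)"
      "\<And>i. i \<in> J \<Longrightarrow> (L2_class I (z i), y i) \<in> Lmax"
    and span: "span ((\<lambda>i. bv (z i)) ` J) = UNIV"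
    and v: "(v, 0) \<in> Lmax"
    and orth: "\<And>i. i \<in> J \<Longrightarrow> y i \<bullet> v = 0"
  shows "v = 0"
proof -
  obtain g where g: "square_integrable_on I g" "v = L2_class I g"
    using v by (auto simp: operator_adjoint_in_def mem_L2_iff)
  obtain w where w: "sl_regular w" "square_integrable_on I w" "L2_class I w = v" "\<And>t. t \<in> I \<Longrightarrow> l w t = 0"
    using adjoint_kernel_classical[OF g(1)] v g(2) by metis
  have lw: "square_integrable_on I (l w)" "0 = L2_class I (l w)"
    using adjoint_sl_regular[OF w(1,2)] v w(3) by auto
  have "boundary_form p (bv w) = 0" if p: "p \<in> (\<lambda>i. bv (z i)) ` J" for p
  proof -
    obtain i where i: "i \<in> J" "p = bv (z i)" using p by blast
    note lz = adjoint_sl_regular[OF z(1,2,4)[OF i(1)]]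
    show ?thesis
      using green_formula[OF z(1,2)[OF i(1)] lz(1) w(1,2) lw(1) z(3)[OF i(1)]] lz(2) orth[OF i(1)]
        lw(2) w(3) i(2) by simp
  qed
  then have "bv w = 0" using span by (rule boundary_form_nondegenerate)
  then have "w t = 0" if "t \<in> I" for t
    using zero_boundary_value_imp_zero[OF w(1,4) _ that] boundary_value_limit[OF w(1) lw(1)] by simp
  then have "indicator I t *\<^sub>R (w t \<bullet> w t) = 0" for t by (simp add: indicator_def)
  then have "(LBINT t:I. w t \<bullet> w t) = 0"
    unfolding set_lebesgue_integral_def by (simp only: integral_zero)
  then have "v \<bullet> v = 0" using inner_L2_class[OF w(2,2)] by (simp only: w(3))
  then show ?thesis by simp
qed

end

section \<open>Extensions of a symmetric operator by finitely many elements\<close>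

lemma subspace_Domain:
  fixes T :: "('h::real_vector \<times> 'h) set"
  assumes "subspace T"
  shows "subspace (Domain T)"
proof (rule subspaceI)
  show "0 \<in> Domain T" using subspace_0[OF assms] by (auto simp: zero_prod_def)
  show "x + x' \<in> Domain T" if "x \<in> Domain T" "x' \<in> Domain T" for x x'
    using that subspace_add[OF assms] by (metis Domain_iff add_Pair)
  show "c *\<^sub>R x \<in> Domain T" if "x \<in> Domain T" for c x
    using that subspace_scale[OF assms] by (metis Domain_iff scaleR_Pair)
qed

lemma subspace_Range:
  fixes T :: "('h::real_vector \<times> 'h) set"
  assumes "subspace T"
  shows "subspace (Range T)"
proof (rule subspaceI)
  show "0 \<in> Range T" using subspace_0[OF assms] by (auto simp: zero_prod_def)
  show "x + x' \<in> Range T" if "x \<in> Range T" "x' \<in> Range T" for x x'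
    using that subspace_add[OF assms] by (metis Range_iff add_Pair)
  show "c *\<^sub>R x \<in> Range T" if "x \<in> Range T" for c x
    using that subspace_scale[OF assms] by (metis Range_iff scaleR_Pair)
qed

lemma span_family_sum:
  fixes \<zeta> :: "'i \<Rightarrow> 'h::real_vector"
  assumes "finite J" "x \<in> span (\<zeta> ` J)"
  shows "\<exists>c. x = (\<Sum>i\<in>J. c i *\<^sub>R \<zeta> i)"
proof -
  have "subspace {x. \<exists>c. x = (\<Sum>i\<in>J. c i *\<^sub>R \<zeta> i)}"
  proof (rule subspaceI; clarsimp)
    show "\<exists>c. (\<Sum>i\<in>J. c i *\<^sub>R \<zeta> i) = 0" by (intro exI[of _ "\<lambda>_. 0"]) simp
    show "\<exists>e. (\<Sum>i\<in>J. c i *\<^sub>R \<zeta> i) + (\<Sum>i\<in>J. d i *\<^sub>R \<zeta> i) = (\<Sum>i\<in>J. e i *\<^sub>R \<zeta> i)" for c d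
      by (intro exI[of _ "\<lambda>i. c i + d i"]) (simp add: scaleR_add_left sum.distrib)
    show "\<exists>e. r *\<^sub>R (\<Sum>i\<in>J. c i *\<^sub>R \<zeta> i) = (\<Sum>i\<in>J. e i *\<^sub>R \<zeta> i)" for r c
      by (intro exI[of _ "\<lambda>i. r * c i"]) (simp add: scaleR_sum_right)
  qed
  moreover have "\<zeta> i \<in> {x. \<exists>c. x = (\<Sum>i\<in>J. c i *\<^sub>R \<zeta> i)}" if "i \<in> J" for i
  proof -
    have "(\<Sum>j\<in>J. (if j = i then 1 else 0) *\<^sub>R \<zeta> j) = (\<Sum>j\<in>J. if j = i then \<zeta> j else 0)"
      by (intro sum.cong) auto
    then have "\<zeta> i = (\<Sum>j\<in>J. (if j = i then 1 else 0) *\<^sub>R \<zeta> j)"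
      using assms(1) that by simp
    then show ?thesis by (intro CollectI exI)
  qed
  ultimately have "span (\<zeta> ` J) \<subseteq> {x. \<exists>c. x = (\<Sum>i\<in>J. c i *\<^sub>R \<zeta> i)}"
    by (intro span_minimal) auto
  then show ?thesis using assms(2) by blast
qed

lemma subspace_operator_sum:
  fixes T :: "('h::real_vector \<times> 'h) set"
  assumes "subspace T" "\<And>i. i \<in> J \<Longrightarrow> (x i, y i) \<in> T"
  shows "(\<Sum>i\<in>J. c i *\<^sub>R x i, \<Sum>i\<in>J. c i *\<^sub>R y i) \<in> T"
proof -
  have "(\<Sum>i\<in>J. c i *\<^sub>R (x i, y i)) \<in> T"
    using assms by (intro subspace_sum subspace_scale)
  then show ?thesis by (simp add: sum_prod)
qed

lemma subspace_operator_adjoint: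
  assumes "subspace H"
  shows "subspace (operator_adjoint_in H T)"
  using assms
  by (auto simp: subspace_def operator_adjoint_in_def zero_prod_def inner_add_right split: prod.splits)

text \<open>
  The difference of two values is orthogonal to the domain and so, by density, to itself.
\<close>
lemma single_valued_operator_adjoint:
  assumes "densely_defined_in H T" "(x, y) \<in> operator_adjoint_in H T" "(x, y') \<in> operator_adjoint_in H T"
    and "subspace H"
  shows "y = y'"
proof -
  have H: "y \<in> H" "y' \<in> H" using assms(2,3) by (auto simp: operator_adjoint_in_def)
  then have "y - y' \<in> closure (Domain T)"
    using assms(1) subspace_diff[OF assms(4)] by (auto simp: densely_defined_in_def)
  moreover have "closed {u. u \<bullet> (y - y') = 0}"
    by (intro closed_Collect_eq continuous_intros)
  moreover have "Domain T \<subseteq> {u. u \<bullet> (y - y') = 0}"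
    using assms(2,3) by (fastforce simp: operator_adjoint_in_def inner_diff_right)
  ultimately have "(y - y') \<bullet> (y - y') = 0" using closure_minimal by blast
  then show ?thesis by simp
qed

lemma symmetric_subset_adjoint:
  assumes "linear_operator_in H T" "symmetric_operator T"
  shows "T \<subseteq> operator_adjoint_in H T"
  using assms by (fastforce simp: linear_operator_in_def symmetric_operator_def operator_adjoint_in_def)

lemma closed_subspace_has_projections:
  fixes M :: "'h::{real_inner,complete_space} set"
  assumes "subspace M" "closed M"
  shows "has_projections M"
  using assms by (intro has_projections_complete) (auto simp: complete_eq_closed)

lemma independent_card_eqI:
  assumes "finite I" "independent_modulo {0} I w"
  shows "card (w ` I) = card I" "dim (span (w ` I)) = card I"
  using independent_modulo_zero[OF assms] by (auto simp: card_image dim_eq_card_independent)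

text \<open>
  What the theory of Sturm--Liouville operators has to supply: finitely many elements \<open>\<zeta> i\<close> of the domain of
  the adjoint that are independent modulo the domain of \<open>L\<close> and whose images \<open>\<eta> i\<close> under the adjoint
  detect the kernel of the adjoint.
\<close>
locale boundary_elements =
  fixes H :: "'h::{real_inner,complete_space} set" and L Lstar :: "('h \<times> 'h) set"
    and J :: "'i set" and \<zeta> \<eta> :: "'i \<Rightarrow> 'h" and Y :: "'h set"
  assumes Lstar_def: "Lstar = operator_adjoint_in H L"
    and H: "subspace H"
    and L: "linear_operator_in H L" "densely_defined_in H L" "symmetric_operator L" "closed (Range L)"
    and J: "finite J"
    and elements: "\<And>i. i \<in> J \<Longrightarrow> (\<zeta> i, \<eta> i) \<in> Lstar"
    and detected: "\<And>v. (v, 0) \<in> Lstar \<Longrightarrow> (\<And>i. i \<in> J \<Longrightarrow> \<eta> i \<bullet> v = 0) \<Longrightarrow> v = 0"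
    and \<zeta>_independent: "independent_modulo (Domain L) J \<zeta>"
    and Y: "finite Y" "independent Y" "span Y = operator_kernel Lstar"
begin

lemma adjoint_inner: "(x, y) \<in> L \<Longrightarrow> (f, g) \<in> Lstar \<Longrightarrow> y \<bullet> f = x \<bullet> g"
  by (auto simp: Lstar_def operator_adjoint_in_def)

lemma Lstar_subspace: "subspace Lstar"
  unfolding Lstar_def using H by (rule subspace_operator_adjoint)

lemma L_subspace: "subspace L"
  using L(1) by (simp add: linear_operator_in_def)

lemma Lstar_unique: "(x, y) \<in> Lstar \<Longrightarrow> (x, y') \<in> Lstar \<Longrightarrow> y = y'"
  unfolding Lstar_def using single_valued_operator_adjoint[OF L(2)] H by blast

lemma Lstar_in_H: "(x, y) \<in> Lstar \<Longrightarrow> x \<in> H \<and> y \<in> H"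
  by (auto simp: Lstar_def operator_adjoint_in_def)

lemma L_subset_Lstar: "L \<subseteq> Lstar"
  unfolding Lstar_def using L(1,3) by (rule symmetric_subset_adjoint)

lemma Lstar_diff: "(x, y) \<in> Lstar \<Longrightarrow> (x', y') \<in> Lstar \<Longrightarrow> (x - x', y - y') \<in> Lstar"
  using subspace_diff[OF Lstar_subspace, of "(x, y)" "(x', y')"] by simp

lemma Lstar_add: "(x, y) \<in> Lstar \<Longrightarrow> (x', y') \<in> Lstar \<Longrightarrow> (x + x', y + y') \<in> Lstar"
  using subspace_add[OF Lstar_subspace, of "(x, y)" "(x', y')"] by simp

lemma Range_has_projections: "has_projections (Range L)"
  by (rule closed_subspace_has_projections[OF subspace_Range[OF L_subspace] L(4)])

lemma orthogonal_Range_in_kernel: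
  assumes "v \<in> H" "\<And>y. y \<in> Range L \<Longrightarrow> v \<bullet> y = 0"
  shows "(v, 0) \<in> Lstar"
  using assms subspace_0[OF H] by (auto simp: Lstar_def operator_adjoint_in_def inner_commute)

text \<open>
  A vector orthogonal to the range of \<open>L\<close> and to all \<open>\<eta> i\<close> is an undetected element of the kernel
  of the adjoint, hence zero.
\<close>
lemma H_eq_Range_plus_span:
  assumes "h \<in> H"
  obtains x y c where "(x, y) \<in> L" "h = y + (\<Sum>i\<in>J. c i *\<^sub>R \<eta> i)"
proof -
  have "has_projections (span (Range L \<union> \<eta> ` J))"
    using J by (intro has_projections_span_Un subspace_Range L_subspace Range_has_projections) auto
  then obtain m where m: "m \<in> span (Range L \<union> \<eta> ` J)"
    "\<And>y. y \<in> span (Range L \<union> \<eta> ` J) \<Longrightarrow> (h - m) \<bullet> y = 0"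
    unfolding has_projections_def by blast
  have "Range L \<union> \<eta> ` J \<subseteq> H"
    using L(1) elements Lstar_in_H by (auto simp: linear_operator_in_def)
  then have "m \<in> H" using m(1) span_minimal[OF _ H] by blast
  then have "h - m \<in> H" using assms H subspace_diff by blast
  then have "(h - m, 0) \<in> Lstar"
    by (rule orthogonal_Range_in_kernel) (intro m(2) span_base, blast)
  moreover have "\<eta> i \<bullet> (h - m) = 0" if "i \<in> J" for i
    using m(2)[of "\<eta> i"] that by (simp add: inner_commute span_base)
  ultimately have "h - m = 0" by (rule detected)
  then have "h \<in> span (Range L \<union> \<eta> ` J)" using m(1) by simp
  then obtain y s where ys: "h = y + s" "y \<in> span (Range L)" "s \<in> span (\<eta> ` J)"
    by (auto simp: span_Un)
  have "y \<in> Range L" using ys(2) subspace_Range[OF L_subspace] by (simp add: span_eq_iff[THEN iffD2])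
  then obtain x where "(x, y) \<in> L" by blast
  moreover obtain c where "s = (\<Sum>i\<in>J. c i *\<^sub>R \<eta> i)"
    using span_family_sum[OF J ys(3)] by blast
  ultimately show ?thesis using that ys(1) by blast
qed

lemma Lstar_sum: "(\<Sum>i\<in>J. c i *\<^sub>R \<zeta> i, \<Sum>i\<in>J. c i *\<^sub>R \<eta> i) \<in> Lstar"
  by (rule subspace_operator_sum[OF Lstar_subspace elements])

lemma Lstar_onto:
  assumes "h \<in> H"
  obtains f where "(f, h) \<in> Lstar"
proof -
  obtain x y c where xy: "(x, y) \<in> L" "h = y + (\<Sum>i\<in>J. c i *\<^sub>R \<eta> i)"
    using H_eq_Range_plus_span[OF assms] by metis
  have "(x + (\<Sum>i\<in>J. c i *\<^sub>R \<zeta> i), h) \<in> Lstar"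
    unfolding xy(2) using xy(1) L_subset_Lstar Lstar_sum by (intro Lstar_add) auto
  then show ?thesis by (rule that)
qed

lemma kernel_iff: "v \<in> span Y \<longleftrightarrow> (v, 0) \<in> Lstar"
  by (simp add: Y(3) operator_kernel_def)

lemma Domain_Lstar_decomposition:
  assumes "(f, h) \<in> Lstar"
  obtains x c v where "x \<in> Domain L" "v \<in> span Y" "f = x + ((\<Sum>i\<in>J. c i *\<^sub>R \<zeta> i) + v)"
proof -
  obtain x y c where xy: "(x, y) \<in> L" "h = y + (\<Sum>i\<in>J. c i *\<^sub>R \<eta> i)"
    using H_eq_Range_plus_span Lstar_in_H[OF assms] by metis
  have "(x + (\<Sum>i\<in>J. c i *\<^sub>R \<zeta> i), h) \<in> Lstar"
    unfolding xy(2) using xy(1) L_subset_Lstar Lstar_sum by (intro Lstar_add) auto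
  from Lstar_diff[OF assms this] have "f - (x + (\<Sum>i\<in>J. c i *\<^sub>R \<zeta> i)) \<in> span Y"
    by (simp add: kernel_iff)
  then show ?thesis using xy(1) that[of x "f - (x + (\<Sum>i\<in>J. c i *\<^sub>R \<zeta> i))" c] by (auto simp: algebra_simps)
qed

text \<open>
  For \<open>x\<close> in the domain of \<open>L\<close> with \<open>L x = 0\<close> one has \<open>\<eta> i \<bullet> x = \<zeta> i \<bullet> L x = 0\<close>, so \<open>x\<close> is undetected.
\<close>
lemma Domain_inter_kernel:
  assumes "x \<in> Domain L" "x \<in> span Y"
  shows "x = 0"
proof -
  obtain y where y: "(x, y) \<in> L" using assms(1) by blast
  have ker: "(x, 0) \<in> Lstar" using assms(2) by (simp add: kernel_iff)
  then have "y = 0" using y L_subset_Lstar Lstar_unique by blast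
  then show ?thesis
    using detected[OF ker] adjoint_inner[OF y elements] by (simp add: inner_commute)
qed

text \<open>
  The adjoint maps \<open>Domain Lstar\<close> onto \<open>H\<close> and has kernel \<open>span Y\<close>, while \<open>L\<close> maps \<open>Domain L\<close>
  injectively onto the orthogonal complement of \<open>span Y\<close>.  Hence \<open>Y\<close> together with preimages of the
  elements of \<open>Y\<close> is a basis of \<open>Domain Lstar\<close> modulo \<open>Domain L\<close>.
\<close>
lemma basis_modulo_Domain:
  obtains w where
    "\<And>y. y \<in> Y \<Longrightarrow> (w y, y) \<in> Lstar"
    "independent_modulo (Domain L) (Inl ` Y \<union> Inr ` Y) (case_sum (\<lambda>y. y) w)"
    "\<And>f. f \<in> Domain Lstar \<Longrightarrow> \<exists>x\<in>Domain L. \<exists>s\<in>span (Y \<union> w ` Y). f = x + s"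
proof -
  have Y_H: "y \<in> H" if "y \<in> span Y" for y
    using that Lstar_in_H by (auto simp: kernel_iff)
  have "\<exists>f. (f, y) \<in> Lstar" if "y \<in> Y" for y
    using Lstar_onto[OF Y_H[OF span_base[OF that]]] by blast
  then obtain w where w: "\<And>y. y \<in> Y \<Longrightarrow> (w y, y) \<in> Lstar" by metis
  have Y_indep: "c y = 0" if "(\<Sum>y\<in>Y. c y *\<^sub>R y) = 0" "y \<in> Y" for c y
    using that Y(1,2) dependent_finite by blast
  have split: "(\<Sum>i\<in>Inl ` Y \<union> Inr ` Y. c i *\<^sub>R case_sum (\<lambda>y. y) w i) =
      (\<Sum>y\<in>Y. c (Inl y) *\<^sub>R y) + (\<Sum>y\<in>Y. c (Inr y) *\<^sub>R w y)" for c
    using Y(1) by (subst sum.union_disjoint) (auto simp: sum.reindex)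
  have indep: "independent_modulo (Domain L) (Inl ` Y \<union> Inr ` Y) (case_sum (\<lambda>y. y) w)"
    unfolding independent_modulo_def
  proof (intro allI impI)
    fix c :: "'h + 'h \<Rightarrow> real"
    let ?v = "\<Sum>y\<in>Y. c (Inl y) *\<^sub>R y" and ?u = "\<Sum>y\<in>Y. c (Inr y) *\<^sub>R w y" and ?y = "\<Sum>y\<in>Y. c (Inr y) *\<^sub>R y"
    assume "(\<Sum>i\<in>Inl ` Y \<union> Inr ` Y. c i *\<^sub>R case_sum (\<lambda>y. y) w i) \<in> Domain L"
    then obtain r where r: "(?v + ?u, r) \<in> L" unfolding split by blast
    have v: "?v \<in> span Y" and y: "?y \<in> span Y" by (intro span_sum span_scale span_base; assumption)+
    have "(?u, ?y) \<in> Lstar" by (rule subspace_operator_sum[OF Lstar_subspace w])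
    with v have "(?v + ?u, 0 + ?y) \<in> Lstar" by (intro Lstar_add) (simp add: kernel_iff)
    then have "r = ?y" using r L_subset_Lstar Lstar_unique[of "?v + ?u" r "?y"] by auto
    then have "?y \<bullet> ?y = (?v + ?u) \<bullet> 0"
      using adjoint_inner[OF r] y by (simp add: kernel_iff)
    then have "?y = 0" by simp
    then have inr: "c (Inr y) = 0" if "y \<in> Y" for y using Y_indep[of "\<lambda>y. c (Inr y)"] \<open>?y = 0\<close> that by blast
    then have "?u = 0" by simp
    then have "?v \<in> Domain L" using r by auto
    then have "?v = 0" using Domain_inter_kernel v by blast
    then have "c (Inl y) = 0" if "y \<in> Y" for y using Y_indep[of "\<lambda>y. c (Inl y)"] that by blast
    with inr show "\<forall>i\<in>Inl ` Y \<union> Inr ` Y. c i = 0" by auto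
  qed
  have "\<exists>x\<in>Domain L. \<exists>s\<in>span (Y \<union> w ` Y). f = x + s" if f: "f \<in> Domain Lstar" for f
  proof -
    obtain h where h: "(f, h) \<in> Lstar" using f by blast
    obtain r where r: "r \<in> Range L" "\<And>y. y \<in> Range L \<Longrightarrow> (h - r) \<bullet> y = 0"
      using Range_has_projections unfolding has_projections_def by blast
    obtain x where x: "(x, r) \<in> L" using r(1) by blast
    have "h - r \<in> H"
      using Lstar_in_H[OF h] x L_subset_Lstar Lstar_in_H[of x r] H subspace_diff by blast
    then have "h - r \<in> span Y"
      using orthogonal_Range_in_kernel r(2) by (simp add: kernel_iff)
    then obtain c where c: "h - r = (\<Sum>y\<in>Y. c y *\<^sub>R y)" using span_finite[OF Y(1)] by auto
    have "(x + (\<Sum>y\<in>Y. c y *\<^sub>R w y), r + (\<Sum>y\<in>Y. c y *\<^sub>R y)) \<in> Lstar"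
      using x L_subset_Lstar subspace_operator_sum[OF Lstar_subspace w] by (intro Lstar_add) auto
    from Lstar_diff[OF h this] have "f - (x + (\<Sum>y\<in>Y. c y *\<^sub>R w y)) \<in> span Y"
      by (simp add: kernel_iff flip: c)
    then have "f - (x + (\<Sum>y\<in>Y. c y *\<^sub>R w y)) \<in> span (Y \<union> w ` Y)"
      using span_mono[of Y "Y \<union> w ` Y"] by blast
    moreover have "(\<Sum>y\<in>Y. c y *\<^sub>R w y) \<in> span (Y \<union> w ` Y)"
      by (intro span_sum span_scale span_base) auto
    ultimately have "f - (x + (\<Sum>y\<in>Y. c y *\<^sub>R w y)) + (\<Sum>y\<in>Y. c y *\<^sub>R w y) \<in> span (Y \<union> w ` Y)"
      by (rule span_add)
    then show ?thesis using x by (intro bexI[of _ x] bexI[of _ "f - x"]) (auto simp: algebra_simps)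
  qed
  with w indep show ?thesis by (rule that)
qed

text \<open>
  Complete the \<open>\<zeta> i\<close> by elements of \<open>Y\<close> to a basis of \<open>Domain Lstar\<close> modulo \<open>Domain L\<close>; it has as many
  elements as the basis of \<open>basis_modulo_Domain\<close>.
\<close>
lemma complement_of_Domain:
  obtains Y' where "Y' \<subseteq> Y" "card J + card Y' = 2 * card Y"
    "dim (span (\<zeta> ` J \<union> Y')) = 2 * card Y"
    "is_direct_sum (Domain Lstar) (Domain L) (span (\<zeta> ` J \<union> Y'))"
    "is_direct_sum (span (\<zeta> ` J \<union> Y')) (span Y') (span (\<zeta> ` J))"
proof -
  note D = subspace_Domain[OF L_subspace]
  obtain Y' where Y': "Y' \<subseteq> Y"
    "independent_modulo (Domain L) (Inl ` J \<union> Inr ` Y') (case_sum \<zeta> (\<lambda>y. y))"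
    "Y \<subseteq> {x + s |x s. x \<in> Domain L \<and> s \<in> span (\<zeta> ` J \<union> Y')}"
    by (rule exists_complementary_subset[OF D J Y(1) \<zeta>_independent])
  let ?W = "span (\<zeta> ` J \<union> Y')" and ?K = "Inl ` J \<union> Inr ` Y'" and ?v = "case_sum \<zeta> (\<lambda>y. y)"
  have fin_Y': "finite Y'" using Y'(1) Y(1) by (rule finite_subset)
  have fin: "finite ?K" "finite (\<zeta> ` J \<union> Y')" using J fin_Y' by auto
  have card_K: "card ?K = card J + card Y'"
    using J fin_Y' by (subst card_Un_disjoint) (auto simp: card_image)
  have img: "?v ` ?K = \<zeta> ` J \<union> Y'" by (auto simp: image_Un image_image)
  have sum_subspace: "subspace {x + s |x s. x \<in> Domain L \<and> s \<in> ?W}"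
    by (rule subspace_sums[OF D subspace_span])
  have kernel: "span Y \<subseteq> {x + s |x s. x \<in> Domain L \<and> s \<in> ?W}"
    using Y'(3) sum_subspace by (rule span_minimal)
  have L_sub: "Domain L \<subseteq> Domain Lstar" using L_subset_Lstar by blast
  have W_sub: "?W \<subseteq> Domain Lstar"
  proof (rule span_minimal)
    have "y \<in> Domain Lstar" if "y \<in> Y'" for y
      using that Y'(1) span_base[of y Y] by (auto simp: kernel_iff)
    then show "\<zeta> ` J \<union> Y' \<subseteq> Domain Lstar" using elements by auto
  qed (rule subspace_Domain[OF Lstar_subspace])
  have decomp: "Domain Lstar = {x + s |x s. x \<in> Domain L \<and> s \<in> ?W}"
  proof
    show "Domain Lstar \<subseteq> {x + s |x s. x \<in> Domain L \<and> s \<in> ?W}"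
    proof
      fix f assume "f \<in> Domain Lstar"
      then obtain h where "(f, h) \<in> Lstar" by blast
      then obtain x c v where f: "x \<in> Domain L" "v \<in> span Y" "f = x + ((\<Sum>i\<in>J. c i *\<^sub>R \<zeta> i) + v)"
        using Domain_Lstar_decomposition by metis
      have "(\<Sum>i\<in>J. c i *\<^sub>R \<zeta> i) \<in> ?W" by (intro span_sum span_scale span_base) auto
      then have "x + (\<Sum>i\<in>J. c i *\<^sub>R \<zeta> i) \<in> {x + s |x s. x \<in> Domain L \<and> s \<in> ?W}" using f(1) by blast
      then have "x + (\<Sum>i\<in>J. c i *\<^sub>R \<zeta> i) + v \<in> {x + s |x s. x \<in> Domain L \<and> s \<in> ?W}"
        by (rule subspace_add[OF sum_subspace _ subsetD[OF kernel f(2)]])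
      then show "f \<in> {x + s |x s. x \<in> Domain L \<and> s \<in> ?W}" by (simp only: f(3) add.assoc)
    qed
    show "{x + s |x s. x \<in> Domain L \<and> s \<in> ?W} \<subseteq> Domain Lstar"
      using subspace_add[OF subspace_Domain[OF Lstar_subspace]] L_sub W_sub by blast
  qed
  obtain w where w: "\<And>y. y \<in> Y \<Longrightarrow> (w y, y) \<in> Lstar"
    "independent_modulo (Domain L) (Inl ` Y \<union> Inr ` Y) (case_sum (\<lambda>y. y) w)"
    "\<And>f. f \<in> Domain Lstar \<Longrightarrow> \<exists>x\<in>Domain L. \<exists>s\<in>span (Y \<union> w ` Y). f = x + s"
    by (rule basis_modulo_Domain) blast
  have card_2Y: "card (Inl ` Y \<union> Inr ` Y :: ('h + 'h) set) = 2 * card Y"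
    using Y(1) by (subst card_Un_disjoint) (auto simp: card_image)
  have "card ?K \<le> card (Y \<union> w ` Y)"
  proof (rule independent_modulo_card_le[OF D fin(1) _ Y'(2)])
    fix i assume "i \<in> ?K"
    then have "?v i \<in> \<zeta> ` J \<union> Y'" using img by blast
    from subsetD[OF W_sub span_base[OF this]] have "?v i \<in> Domain Lstar" .
    then show "\<exists>x\<in>Domain L. \<exists>y\<in>span (Y \<union> w ` Y). ?v i = x + y" by (rule w(3))
  qed (use Y(1) in simp)
  also have "\<dots> \<le> 2 * card Y"
    using card_Un_le[of Y "w ` Y"] card_image_le[OF Y(1), of w] by linarith
  finally have le1: "card J + card Y' \<le> 2 * card Y" by (simp only: card_K)
  have "card (Inl ` Y \<union> Inr ` Y :: ('h + 'h) set) \<le> card (\<zeta> ` J \<union> Y')"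
  proof (rule independent_modulo_card_le[OF D _ fin(2) w(2)])
    fix i :: "'h + 'h" assume "i \<in> Inl ` Y \<union> Inr ` Y"
    moreover have "y \<in> Domain Lstar" if "y \<in> Y" for y
      using that span_base[of y Y] by (auto simp: kernel_iff)
    moreover have "w y \<in> Domain Lstar" if "y \<in> Y" for y using w(1)[OF that] by blast
    ultimately have "case_sum (\<lambda>y. y) w i \<in> Domain Lstar" by auto
    then show "\<exists>x\<in>Domain L. \<exists>y\<in>?W. case_sum (\<lambda>y. y) w i = x + y" unfolding decomp by blast
  qed (use Y(1) in simp)
  also have "\<dots> \<le> card J + card Y'"
    using card_Un_le[of "\<zeta> ` J" Y'] card_image_le[OF J, of \<zeta>] by linarith
  finally have card: "card J + card Y' = 2 * card Y" using le1 card_2Y by linarith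
  have indep0: "independent_modulo {0} ?K ?v"
    using Y'(2) by (rule independent_modulo_mono) (use subspace_0[OF D] in simp)
  show ?thesis
  proof (rule that[OF Y'(1) card])
    show "dim ?W = 2 * card Y"
      using independent_card_eqI(2)[OF fin(1) indep0] by (simp only: img card_K card)
    show "is_direct_sum (Domain Lstar) (Domain L) ?W"
      unfolding is_direct_sum_def
      using D independent_modulo_direct_sum[OF D fin(1) Y'(2)] decomp by (simp only: img subspace_span simp_thms)
    have "x = 0" if x: "x \<in> span Y'" "x \<in> span (\<zeta> ` J)" for x
    proof -
      obtain d where d: "x = (\<Sum>y\<in>Y'. d y *\<^sub>R y)" using x(1) span_finite[OF fin_Y'] by auto
      obtain c where c: "x = (\<Sum>i\<in>J. c i *\<^sub>R \<zeta> i)"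
        using span_family_sum[OF J x(2)] by blast
      have "(\<Sum>i\<in>?K. case_sum (\<lambda>i. c i) (\<lambda>y. - d y) i *\<^sub>R ?v i) = x - x"
        using J fin_Y' c d by (subst sum.union_disjoint) (auto simp: sum.reindex sum_negf)
      then have "\<forall>i\<in>?K. case_sum (\<lambda>i. c i) (\<lambda>y. - d y) i = 0"
        using indep0 unfolding independent_modulo_def by simp
      then have "d y = 0" if "y \<in> Y'" for y using that by force
      then show ?thesis by (simp add: d)
    qed
    then have "span Y' \<inter> span (\<zeta> ` J) = {0}" using span_zero by blast
    moreover have "?W = {x + y |x y. x \<in> span Y' \<and> y \<in> span (\<zeta> ` J)}"
      using span_Un[of Y' "\<zeta> ` J"] by (simp add: Un_commute)
    ultimately show "is_direct_sum ?W (span Y') (span (\<zeta> ` J))"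
      by (simp add: is_direct_sum_def)
  qed
qed

end

section \<open>The decomposition of the domain of the adjoint\<close>

text \<open>
  By symmetry of the operator the boundary form of an element of its domain with every \<open>z j\<close>
  vanishes, and the form is nondegenerate.
\<close>
lemma (in sturm_liouville) boundary_elements_independent:
  assumes J: "finite J"
    and z: "\<And>i. i \<in> J \<Longrightarrow> sl_regular (z i)" "\<And>i. i \<in> J \<Longrightarrow> square_integrable_on I (z i)"
      "\<And>i. i \<in> J \<Longrightarrow> vanishes_near_left a b (z i)"
      "\<And>i. i \<in> J \<Longrightarrow> (L2_class I (z i), y i) \<in> Lmax"
    and bv: "inj_on (\<lambda>i. bv (z i)) J" "independent ((\<lambda>i. bv (z i)) ` J)"
      "span ((\<lambda>i. bv (z i)) ` J) = UNIV"
    and L: "linear_operator_in (L2 I) L0"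
      "densely_defined_in (L2 I) L0"
      "symmetric_operator L0"
  shows "independent_modulo (Domain L0) J (\<lambda>i. L2_class I (z i))"
  unfolding independent_modulo_def
proof (intro allI impI)
  let ?B = "\<lambda>i. bv (z i)"
  fix c assume "(\<Sum>i\<in>J. c i *\<^sub>R L2_class I (z i)) \<in> Domain L0"
  then obtain r where r: "(\<Sum>i\<in>J. c i *\<^sub>R L2_class I (z i), r) \<in> L0" by blast
  have "(\<Sum>i\<in>J. c i *\<^sub>R L2_class I (z i), \<Sum>i\<in>J. c i *\<^sub>R y i) \<in> Lmax"
    by (rule subspace_operator_sum[OF subspace_operator_adjoint[OF subspace_L2] z(4)])
  then have r_eq: "r = (\<Sum>i\<in>J. c i *\<^sub>R y i)"
    using single_valued_operator_adjoint[OF L(2) _ _ subspace_L2] symmetric_subset_adjoint[OF L(1,3)] r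
    by blast
  have "boundary_form (?B j) (\<Sum>i\<in>J. c i *\<^sub>R ?B i) = 0" if j: "j \<in> J" for j
  proof -
    note lz = adjoint_sl_regular[OF z(1,2,4)]
    have "r \<bullet> L2_class I (z j) = (\<Sum>i\<in>J. c i *\<^sub>R L2_class I (z i)) \<bullet> y j"
      using r z(4)[OF j] by (auto simp: operator_adjoint_in_def)
    then have "(\<Sum>i\<in>J. c i * (y i \<bullet> L2_class I (z j) - L2_class I (z i) \<bullet> y j)) = 0"
      by (simp add: r_eq inner_sum_left right_diff_distrib sum_subtractf)
    moreover have "y i \<bullet> L2_class I (z j) - L2_class I (z i) \<bullet> y j = boundary_form (?B i) (?B j)"
      if i: "i \<in> J" for i
      using green_formula[OF z(1,2)[OF i] lz(1)[OF i i i] z(1,2)[OF j] lz(1)[OF j j j] z(3)[OF i]]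
        lz(2)[OF i i i] lz(2)[OF j j j] by simp
    ultimately have "boundary_form (\<Sum>i\<in>J. c i *\<^sub>R ?B i) (?B j) = 0"
      by (simp add: boundary_form_sum_left)
    then show ?thesis using boundary_form_commute[of "\<Sum>i\<in>J. c i *\<^sub>R ?B i" "?B j"] by simp
  qed
  then have "boundary_form q (\<Sum>i\<in>J. c i *\<^sub>R ?B i) = 0" if "q \<in> ?B ` J" for q using that by blast
  from boundary_form_nondegenerate[OF this bv(3)] have "(\<Sum>i\<in>J. c i *\<^sub>R ?B i) \<in> {0}" by simp
  then show "\<forall>i\<in>J. c i = 0"
    using independent_modulo_zeroI[OF J bv(1,2)] unfolding independent_modulo_def by blast
qed

theorem lemma4p4:
  fixes a b :: ereal
    and P Q R :: "real \<Rightarrow> real^'n^'n"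
    and H :: "(real^'n) l2 set"
    and L Lstar :: "((real^'n) l2 \<times> (real^'n) l2) set"
    and k :: nat
    and Y Z :: "(real^'n) l2 set"
    and z :: "nat \<Rightarrow> real \<Rightarrow> real^'n"
  defines "H \<equiv> L2 (einterval a b)"
    and "L \<equiv> minimal_operator a b P Q R"
    and "Lstar \<equiv> operator_adjoint_in H L"
    and "Z \<equiv> span ((\<lambda>i. L2_class (einterval a b) (z i)) ` {1..2 * CARD('n)})"
  assumes "a < b"
    and "sl_coefficients a b P Q R"
    and "regular_right_endpoint b P Q R"
    and "closed_operator_in H L"
    and "densely_defined_in H L"
    and "symmetric_operator L"
    and "fredholm_operator_in H L"
    and "finite Y" and "card Y = k"
    and "independent Y" and "span Y = operator_kernel Lstar"
    and "\<And>i. i \<in> {1..2 * CARD('n)} \<Longrightarrow> smooth_on (einterval a b) (z i)"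
    and "\<And>i. i \<in> {1..2 * CARD('n)} \<Longrightarrow> vanishes_near_left a b (z i)"
    and "\<And>i. i \<in> {1..2 * CARD('n)} \<Longrightarrow>
           square_integrable_on (einterval a b) (z i) \<and>
           L2_class (einterval a b) (z i) \<in> Domain Lstar"
    and "inj_on (\<lambda>i. boundary_value b P Q (z i)) {1..2 * CARD('n)}"
    and "independent ((\<lambda>i. boundary_value b P Q (z i)) ` {1..2 * CARD('n)})"
    and "span ((\<lambda>i. boundary_value b P Q (z i)) ` {1..2 * CARD('n)}) = UNIV"
  shows "CARD('n) \<le> k \<and> k \<le> 2 * CARD('n) \<and>
    (\<exists>W. subspace W \<and> dim W = 2 * k \<and>
         is_direct_sum (Domain Lstar) (Domain L) W \<and>
         (k \<noteq> CARD('n) \<longrightarrow>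
            (\<exists>Ybar. Ybar \<subseteq> Y \<and> card Ybar = 2 * k - 2 * CARD('n) \<and>
                    dim (span Ybar) = 2 * k - 2 * CARD('n) \<and>
                    is_direct_sum W (span Ybar) Z)) \<and>
         (k = CARD('n) \<longrightarrow> W = Z))"
proof -
  let ?J = "{1..2 * CARD('n)}" and ?\<zeta> = "\<lambda>i. L2_class (einterval a b) (z i)"
  interpret sturm_liouville a b P Q R
    using assms(5-7) by unfold_locales
  have z_regular: "sl_regular (z i)" if "i \<in> ?J" for i
    by (rule smooth_on_sl_regular) (use that assms in blast)
  have z_L2: "square_integrable_on (einterval a b) (z i)" if "i \<in> ?J" for i
    using that assms by blast
  have "\<exists>y. (?\<zeta> i, y) \<in> Lstar" if "i \<in> ?J" for i using that assms by blast
  then obtain \<eta> where \<eta>: "\<And>i. i \<in> ?J \<Longrightarrow> (?\<zeta> i, \<eta> i) \<in> Lstar" by metis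
  note \<eta>' = \<eta>[unfolded Lstar_def H_def L_def]
  have linear: "linear_operator_in H L" using assms by (simp add: closed_operator_in_def)
  interpret boundary_elements H L Lstar ?J ?\<zeta> \<eta> Y
  proof
    show "Lstar = operator_adjoint_in H L" by (simp add: Lstar_def)
    show "subspace H" unfolding H_def by (rule subspace_L2)
    show "closed (Range L)" using assms by (simp add: fredholm_operator_in_def)
    show "v = 0" if "(v, 0) \<in> Lstar" "\<And>i. i \<in> ?J \<Longrightarrow> \<eta> i \<bullet> v = 0" for v
      using adjoint_kernel_detected[of ?J z \<eta> v, OF z_regular z_L2 _ \<eta>'] that assms
      unfolding Lstar_def H_def L_def by blast
    show "independent_modulo (Domain L) ?J ?\<zeta>"
      unfolding L_def
      by (rule boundary_elements_independent[OF _ z_regular z_L2 _ \<eta>'])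
        (use assms linear in \<open>auto simp: H_def L_def\<close>)
  qed (use assms linear \<eta> in auto)
  obtain Y' where Y': "Y' \<subseteq> Y" "card ?J + card Y' = 2 * card Y"
    "dim (span (?\<zeta> ` ?J \<union> Y')) = 2 * card Y"
    "is_direct_sum (Domain Lstar) (Domain L) (span (?\<zeta> ` ?J \<union> Y'))"
    "is_direct_sum (span (?\<zeta> ` ?J \<union> Y')) (span Y') (span (?\<zeta> ` ?J))"
    by (rule complement_of_Domain)
  have card: "2 * CARD('n) + card Y' = 2 * k" using Y'(2) assms by simp
  (* gives k \<le> 2 n, since k = 2 n - (k - card Y') *)
  have "card Y' \<le> k" using card_mono[OF \<open>finite Y\<close> Y'(1)] assms by simp
  then have bounds: "CARD('n) \<le> k" "k \<le> 2 * CARD('n)" using card by linarith+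
  have dim_Y': "dim (span Y') = card Y'"
    using independent_mono[OF \<open>independent Y\<close> Y'(1)] by (simp add: dim_eq_card_independent)
  have W_eq: "span (?\<zeta> ` ?J \<union> Y') = Z" if "k = CARD('n)"
  proof -
    have "card Y' = 0" using card that by simp
    then have "Y' = {}" using finite_subset[OF Y'(1) \<open>finite Y\<close>] by simp
    then show ?thesis by (simp add: Z_def)
  qed
  show ?thesis
  proof (rule conjI[OF bounds(1) conjI[OF bounds(2) exI[of _ "span (?\<zeta> ` ?J \<union> Y')"]]], intro conjI impI)
    show "dim (span (?\<zeta> ` ?J \<union> Y')) = 2 * k" using Y'(3) \<open>card Y = k\<close> by simp
    show "is_direct_sum (Domain Lstar) (Domain L) (span (?\<zeta> ` ?J \<union> Y'))" by (rule Y'(4))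
    show "\<exists>Ybar. Ybar \<subseteq> Y \<and> card Ybar = 2 * k - 2 * CARD('n) \<and>
        dim (span Ybar) = 2 * k - 2 * CARD('n) \<and> is_direct_sum (span (?\<zeta> ` ?J \<union> Y')) (span Ybar) Z"
      using Y'(1,5) card dim_Y' by (intro exI[of _ Y']) (simp add: Z_def)
    show "span (?\<zeta> ` ?J \<union> Y') = Z" if "k = CARD('n)" using that by (rule W_eq)
  qed (rule subspace_span)
qed

end
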